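(* Let $r\ge 1$ be an integer. The osculating bundle functor $\mathrm{Osc}^{r-1}$, which assigns to a smooth manifold $M$ the fibered manifold $\mathrm{Osc}^{r-1}M\to M$ of prominent elements of the $r$-fold iterated tangent bundle $\underbrace{T\cdots T}_{r}M$, works on the category with manifolds as objects and smooth maps as morphisms, and it is naturally equivalent to the higher order tangent functor $T^{r-1}$.
   Context: Throughout, $T$ denotes the tangent functor, and for an integer $s\ge 0$ let $T^{\circ s}=\underbrace{T\circ\cdots\circ T}_{s}$ denote the $s$-fold iterated tangent functor, with $T^{\circ 0}=\mathrm{id}$. For a manifold $N$, let $\pi_N\colon TN\to N$ be the tangent bundle projection. For a manifold $M$ and integers $a,b\ge 0$ with $a+1+b=r$, define the projection $${}_a\pi^1_b := T^{\circ a}\bigl(\pi_{T^{\circ b}M}\bigr)\colon T^{\circ r}M\to T^{\circ (r-1)}M,$$ i.e. the functor $T^{\circ a}$ applied to the canonical projection $T(T^{\circ b}M)\to T^{\circ b}M$. When $a=0$ the left index is omitted, so $\pi^1_{r-1}=\pi_{T^{\circ(r-1)}M}$. An element $Z\in T^{\circ r}M$ is called prominent if it satisfies the semiholonomity condition $$\pi^1_{r-1}(Z)={}_{q-1}\pi^1_{r-q}(Z)\qquad\text{for all } q=1,\dots,r.$$ The prominent elements of $T^{\circ r}M$ form a smooth manifold with a fiber bundle structure over $M$; this fibered manifold is called the osculating bundle of $M$ and is denoted $\mathrm{Osc}^{r-1}M$. On a smooth map $f\colon M\to N$, $\mathrm{Osc}^{r-1}f$ is the restriction of $T^{\circ r}f$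 to $\mathrm{Osc}^{r-1}M$. For an integer $k\ge 0$, the $k$-th order tangent bundle is $T^kM=J^k_0(\mathbb R,M)$, the space of all $k$-jets at $0$ of smooth maps from open intervals containing $0\in\mathbb R$ into $M$; on a smooth map $f\colon M\to N$, $T^kf(j^k_0\gamma)=j^k_0(f\circ\gamma)$. The functor $T^k$ (holonomic $k$-velocities) is not to be confused with the iterated functor $T^{\circ k}$.
   Formalization: The equivalence is proved with T^r in place of T^{r-1}: with the stated definitions Osc^0 M = TM while T^0 M = M, and in general Osc^{r-1}M has dimension (r+1) dim M, that of T^r M, so the printed exponent is off by one. *)

theory Defs
  imports "HOL-Analysis.Analysis"
begin

section \<open>Smooth maps between open subsets of Euclidean spaces\<close>

text \<open>
  The dimension doubles with every application of the tangent functor, so it cannot be a type.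
  The space of dimension \<open>n\<close> is \<^const>\<open>Euclidean_space\<close> \<open>n\<close>: sequences
  \<open>nat \<Rightarrow> real\<close> vanishing from index \<open>n\<close> on.
\<close>

definition partial :: "nat \<Rightarrow> ((nat \<Rightarrow> real) \<Rightarrow> real) \<Rightarrow> (nat \<Rightarrow> real) \<Rightarrow> real" where
  "partial b f x = deriv (\<lambda>t. f (x(b := t))) (x b)"

text \<open>For \<open>S\<close> open in the space of dimension \<open>m\<close>: all partial derivatives of order at most \<open>k\<close>
  exist and are continuous on \<open>S\<close>.\<close>

primrec C_k :: "nat \<Rightarrow> nat \<Rightarrow> (nat \<Rightarrow> real) set \<Rightarrow> ((nat \<Rightarrow> real) \<Rightarrow> real) \<Rightarrow> bool" where
  "C_k 0 m S f \<longleftrightarrow> continuous_map (subtopology (Euclidean_space m) S) euclideanreal f"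
| "C_k (Suc k) m S f \<longleftrightarrow>
     continuous_map (subtopology (Euclidean_space m) S) euclideanreal f \<and>
     (\<forall>b<m. (\<forall>x\<in>S. (\<lambda>t. f (x(b := t))) differentiable (at (x b))) \<and> C_k k m S (partial b f))"

definition smooth_between ::
    "nat \<Rightarrow> nat \<Rightarrow> (nat \<Rightarrow> real) set \<Rightarrow> ((nat \<Rightarrow> real) \<Rightarrow> (nat \<Rightarrow> real)) \<Rightarrow> bool" where
  "smooth_between m n S f \<longleftrightarrow> (\<forall>a<n. \<forall>k. C_k k m S (\<lambda>x. f x a))"


section \<open>Smooth manifolds and smooth maps\<close>

text \<open>
  A manifold is a set \<open>pts\<close> with an atlas \<open>(cdom i, chart i)\<close> indexed by a set \<open>idx\<close>; the atlas
  need not be maximal. The topology is the one determined by the charts.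
\<close>

record ('p, 'i) mfd =
  mdim :: nat
  pts :: "'p set"
  idx :: "'i set"
  cdom :: "'i \<Rightarrow> 'p set"
  chart :: "'i \<Rightarrow> 'p \<Rightarrow> nat \<Rightarrow> real"

definition param :: "('p, 'i) mfd \<Rightarrow> 'i \<Rightarrow> (nat \<Rightarrow> real) \<Rightarrow> 'p" where
  "param M i = the_inv_into (cdom M i) (chart M i)"

definition mtop :: "('p, 'i) mfd \<Rightarrow> 'p topology" where
  "mtop M = topology (\<lambda>U. U \<subseteq> pts M \<and>
     (\<forall>i\<in>idx M. openin (Euclidean_space (mdim M)) (chart M i ` (U \<inter> cdom M i))))"

definition manifold :: "('p, 'i) mfd \<Rightarrow> bool" where
  "manifold M \<longleftrightarrow>
     pts M = (\<Union>i\<in>idx M. cdom M i) \<and>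
     (\<forall>i\<in>idx M. inj_on (chart M i) (cdom M i)) \<and>
     (\<forall>i\<in>idx M. \<forall>j\<in>idx M.
        openin (Euclidean_space (mdim M)) (chart M i ` (cdom M i \<inter> cdom M j)) \<and>
        smooth_between (mdim M) (mdim M) (chart M i ` (cdom M i \<inter> cdom M j))
          (\<lambda>x. chart M j (param M i x))) \<and>
     Hausdorff_space (mtop M) \<and> second_countable (mtop M)"

definition smooth_map :: "('p, 'i) mfd \<Rightarrow> ('q, 'j) mfd \<Rightarrow> ('p \<Rightarrow> 'q) \<Rightarrow> bool" where
  "smooth_map M N f \<longleftrightarrow>
     continuous_map (mtop M) (mtop N) f \<and>
     (\<forall>i\<in>idx M. \<forall>j\<in>idx N.
        smooth_between (mdim M) (mdim N) (chart M i ` (cdom M i \<inter> f -` cdom N j))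
          (\<lambda>x. chart N j (f (param M i x))))"

definition jacobian ::
    "('p, 'i) mfd \<Rightarrow> 'i \<Rightarrow> ('q, 'j) mfd \<Rightarrow> 'j \<Rightarrow> ('p \<Rightarrow> 'q) \<Rightarrow> 'p \<Rightarrow> nat \<Rightarrow> nat \<Rightarrow> real" where
  "jacobian M i N j f p a b = partial b (\<lambda>x. chart N j (f (param M i x)) a) (chart M i p)"

definition compatible_chart :: "('p, 'i) mfd \<Rightarrow> 'p set \<Rightarrow> ('p \<Rightarrow> nat \<Rightarrow> real) \<Rightarrow> bool" where
  "compatible_chart M U \<phi> \<longleftrightarrow>
     openin (mtop M) U \<and> inj_on \<phi> U \<and> openin (Euclidean_space (mdim M)) (\<phi> ` U) \<and>
     (\<forall>i\<in>idx M.
        smooth_between (mdim M) (mdim M) (chart M i ` (U \<inter> cdom M i)) (\<lambda>x. \<phi> (param M i x)) \<and>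
        smooth_between (mdim M) (mdim M) (\<phi> ` (U \<inter> cdom M i))
          (\<lambda>x. chart M i (the_inv_into U \<phi> x)))"

text \<open>
  The subset \<open>S\<close> with the charts obtained from slice charts of dimension \<open>k\<close>.
  It is a \<^const>\<open>manifold\<close> only if such charts cover \<open>S\<close>, that is, if \<open>S\<close> is an embedded
  submanifold of dimension \<open>k\<close>.
\<close>

definition submfd ::
    "('p, 'i) mfd \<Rightarrow> nat \<Rightarrow> 'p set \<Rightarrow> ('p, 'p set \<times> ('p \<Rightarrow> nat \<Rightarrow> real)) mfd" where
  "submfd M k S =
     \<lparr> mdim = k,
       pts = S,
       idx = {(U, \<phi>). compatible_chart M U \<phi> \<and> \<phi> ` (U \<inter> S) = {x \<in> \<phi> ` U. \<forall>a\<ge>k. x a = 0}},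
       cdom = (\<lambda>(U, \<phi>). U \<inter> S),
       chart = (\<lambda>(U, \<phi>). \<phi>) \<rparr>"


section \<open>Fibered manifolds, functors into them, natural equivalence\<close>

record ('q, 'j, 'p, 'i) fibmfd =
  total :: "('q, 'j) mfd"
  base :: "('p, 'i) mfd"
  fproj :: "'q \<Rightarrow> 'p"

definition surjective_submersion :: "('q, 'j) mfd \<Rightarrow> ('p, 'i) mfd \<Rightarrow> ('q \<Rightarrow> 'p) \<Rightarrow> bool" where
  "surjective_submersion Y M f \<longleftrightarrow>
     smooth_map Y M f \<and> f ` pts Y = pts M \<and>
     (\<forall>y\<in>pts Y. \<forall>j\<in>idx Y. \<forall>i\<in>idx M. y \<in> cdom Y j \<longrightarrow> f y \<in> cdom M i \<longrightarrow>
        (\<forall>w. \<exists>v. \<forall>a<mdim M. (\<Sum>b<mdim Y. jacobian Y j M i f y a b * v b) = w a))"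

definition fibered_manifold :: "('q, 'j, 'p, 'i) fibmfd \<Rightarrow> bool" where
  "fibered_manifold Y \<longleftrightarrow>
     manifold (total Y) \<and> manifold (base Y) \<and>
     surjective_submersion (total Y) (base Y) (fproj Y)"

definition fibered_morphism ::
    "('q, 'j, 'p, 'i) fibmfd \<Rightarrow> ('q2, 'j2, 'p2, 'i2) fibmfd \<Rightarrow> ('q \<Rightarrow> 'q2) \<Rightarrow> ('p \<Rightarrow> 'p2) \<Rightarrow> bool"
    where
  "fibered_morphism Y Z h f \<longleftrightarrow>
     smooth_map (total Y) (total Z) h \<and> smooth_map (base Y) (base Z) f \<and>
     (\<forall>y\<in>pts (total Y). fproj Z (h y) = f (fproj Y y))"

text \<open>Isomorphisms over the identity of the common base.\<close>

definition fibered_iso ::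
    "('q, 'j, 'p, 'i) fibmfd \<Rightarrow> ('q2, 'j2, 'p, 'i) fibmfd \<Rightarrow> ('q \<Rightarrow> 'q2) \<Rightarrow> bool" where
  "fibered_iso Y Z h \<longleftrightarrow>
     base Y = base Z \<and> fibered_morphism Y Z h id \<and>
     (\<exists>g. fibered_morphism Z Y g id \<and>
          (\<forall>y\<in>pts (total Y). g (h y) = y) \<and> (\<forall>z\<in>pts (total Z). h (g z) = z))"

text \<open>
  A functor from manifolds and smooth maps to fibered manifolds, preserving bases: \<open>F M\<close> is
  fibered over \<open>M\<close> and \<open>Fm M N f\<close> is (the total part of) a morphism over \<open>f\<close>.
  Morphisms are functions on the point types, considered equal if they agree on the points of
  the domain; hence the congruence clause.
\<close>

definition fibered_functor ::
    "(('p, 'i) mfd \<Rightarrow> ('q, 'j, 'p, 'i) fibmfd) \<Rightarrow>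
     (('p, 'i) mfd \<Rightarrow> ('p, 'i) mfd \<Rightarrow> ('p \<Rightarrow> 'p) \<Rightarrow> 'q \<Rightarrow> 'q) \<Rightarrow> bool" where
  "fibered_functor F Fm \<longleftrightarrow>
     (\<forall>M. manifold M \<longrightarrow> fibered_manifold (F M) \<and> base (F M) = M) \<and>
     (\<forall>M N f. manifold M \<and> manifold N \<and> smooth_map M N f \<longrightarrow>
        fibered_morphism (F M) (F N) (Fm M N f) f) \<and>
     (\<forall>M N f g. manifold M \<and> manifold N \<and> smooth_map M N f \<and> smooth_map M N g \<and>
        (\<forall>x\<in>pts M. f x = g x) \<longrightarrow> (\<forall>y\<in>pts (total (F M)). Fm M N f y = Fm M N g y)) \<and>
     (\<forall>M. manifold M \<longrightarrow> (\<forall>y\<in>pts (total (F M)). Fm M M id y = y)) \<and>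
     (\<forall>M N P f g. manifold M \<and> manifold N \<and> manifold P \<and> smooth_map M N f \<and> smooth_map N P g \<longrightarrow>
        (\<forall>y\<in>pts (total (F M)). Fm M P (g \<circ> f) y = Fm N P g (Fm M N f y)))"

definition naturally_equivalent ::
    "(('p, 'i) mfd \<Rightarrow> ('q, 'j, 'p, 'i) fibmfd) \<Rightarrow>
     (('p, 'i) mfd \<Rightarrow> ('p, 'i) mfd \<Rightarrow> ('p \<Rightarrow> 'p) \<Rightarrow> 'q \<Rightarrow> 'q) \<Rightarrow>
     (('p, 'i) mfd \<Rightarrow> ('q2, 'j2, 'p, 'i) fibmfd) \<Rightarrow>
     (('p, 'i) mfd \<Rightarrow> ('p, 'i) mfd \<Rightarrow> ('p \<Rightarrow> 'p) \<Rightarrow> 'q2 \<Rightarrow> 'q2) \<Rightarrow> bool" where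
  "naturally_equivalent F Fm G Gm \<longleftrightarrow>
     fibered_functor F Fm \<and> fibered_functor G Gm \<and>
     (\<exists>\<eta>. (\<forall>M. manifold M \<longrightarrow> fibered_iso (F M) (G M) (\<eta> M)) \<and>
          (\<forall>M N f. manifold M \<and> manifold N \<and> smooth_map M N f \<longrightarrow>
             (\<forall>y\<in>pts (total (F M)). \<eta> N (Fm M N f y) = Gm M N f (\<eta> M y))))"


section \<open>The tangent functor and its iterates\<close>

text \<open>
  A universe of points closed under taking tangent vectors, so that the tangent functor is an
  endofunctor and can be iterated a variable number of times. Any manifold with points in
  \<open>'a\<close> and charts indexed by \<open>'i\<close> is included by means of \<open>Pt\<close>.
  A tangent vector \<open>Vec p \<xi>\<close> at \<open>p\<close> is the family of its components \<open>\<xi> i\<close> in all the charts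
  \<open>i\<close> around \<open>p\<close>, related by the usual transformation law.
\<close>

datatype ('a, 'i) pt = Pt 'a | Vec "('a, 'i) pt" "'i \<Rightarrow> nat \<Rightarrow> real"

type_synonym ('a, 'i) manif = "(('a, 'i) pt, 'i) mfd"

definition tangent_at :: "('a, 'i) manif \<Rightarrow> ('a, 'i) pt \<Rightarrow> ('i \<Rightarrow> nat \<Rightarrow> real) \<Rightarrow> bool" where
  "tangent_at M p \<xi> \<longleftrightarrow>
     p \<in> pts M \<and>
     (\<forall>i a. \<not> (i \<in> idx M \<and> p \<in> cdom M i \<and> a < mdim M) \<longrightarrow> \<xi> i a = 0) \<and>
     (\<forall>i\<in>idx M. \<forall>j\<in>idx M. p \<in> cdom M i \<longrightarrow> p \<in> cdom M j \<longrightarrow>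
        (\<forall>a<mdim M. \<xi> j a = (\<Sum>b<mdim M. jacobian M i M j id p a b * \<xi> i b)))"

primrec foot :: "('a, 'i) pt \<Rightarrow> ('a, 'i) pt" where
  "foot (Vec p \<xi>) = p"

primrec components :: "('a, 'i) pt \<Rightarrow> 'i \<Rightarrow> nat \<Rightarrow> real" where
  "components (Vec p \<xi>) = \<xi>"

definition TB :: "('a, 'i) manif \<Rightarrow> ('a, 'i) manif" where
  "TB M =
     \<lparr> mdim = 2 * mdim M,
       pts = {Vec p \<xi> | p \<xi>. tangent_at M p \<xi>},
       idx = idx M,
       cdom = (\<lambda>i. {Vec p \<xi> | p \<xi>. tangent_at M p \<xi> \<and> p \<in> cdom M i}),
       chart = (\<lambda>i v a. if a < mdim M then chart M i (foot v) a
                        else components v i (a - mdim M)) \<rparr>"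

definition Tmap ::
    "('a, 'i) manif \<Rightarrow> ('a, 'i) manif \<Rightarrow> (('a, 'i) pt \<Rightarrow> ('a, 'i) pt) \<Rightarrow> ('a, 'i) pt \<Rightarrow> ('a, 'i) pt"
    where
  "Tmap M N f v =
     (let p = foot v; i = (SOME i. i \<in> idx M \<and> p \<in> cdom M i)
      in Vec (f p)
           (\<lambda>j a. if j \<in> idx N \<and> f p \<in> cdom N j \<and> a < mdim N
                  then \<Sum>b<mdim M. jacobian M i N j f p a b * components v i b
                  else 0))"

primrec Tmap_iter ::
    "nat \<Rightarrow> ('a, 'i) manif \<Rightarrow> ('a, 'i) manif \<Rightarrow> (('a, 'i) pt \<Rightarrow> ('a, 'i) pt) \<Rightarrow>
     ('a, 'i) pt \<Rightarrow> ('a, 'i) pt" where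
  "Tmap_iter 0 M N f = f"
| "Tmap_iter (Suc s) M N f = Tmap ((TB ^^ s) M) ((TB ^^ s) N) (Tmap_iter s M N f)"


section \<open>Osculating bundles\<close>

text \<open>\<open>proj1 a b M\<close> is \<open>T\<^sup>a\<close> applied to the tangent bundle projection of \<open>T\<^sup>b M\<close>.\<close>

definition proj1 :: "nat \<Rightarrow> nat \<Rightarrow> ('a, 'i) manif \<Rightarrow> ('a, 'i) pt \<Rightarrow> ('a, 'i) pt" where
  "proj1 a b M = Tmap_iter a (TB ((TB ^^ b) M)) ((TB ^^ b) M) foot"

definition prominent :: "nat \<Rightarrow> ('a, 'i) manif \<Rightarrow> ('a, 'i) pt \<Rightarrow> bool" where
  "prominent r M Z \<longleftrightarrow>
     Z \<in> pts ((TB ^^ r) M) \<and> (\<forall>q\<in>{1..r}. proj1 0 (r - 1) M Z = proj1 (q - 1) (r - q) M Z)"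

text \<open>
  \<open>osc s M\<close> consists of the prominent elements of the iterated tangent bundle of order \<open>s + 1\<close>.
  In an iterated bundle chart a point of the latter has coordinate vectors indexed by the subsets
  of an \<open>(s + 1)\<close>-element set; prominence means that they depend only on the size of the subset,
  which leaves \<open>s + 2\<close> free vectors.
\<close>

definition osc ::
    "nat \<Rightarrow> ('a, 'i) manif \<Rightarrow>
     (('a, 'i) pt, ('a, 'i) pt set \<times> (('a, 'i) pt \<Rightarrow> nat \<Rightarrow> real), ('a, 'i) pt, 'i) fibmfd" where
  "osc s M =
     \<lparr> total = submfd ((TB ^^ Suc s) M) ((s + 2) * mdim M) {Z. prominent (Suc s) M Z},
       base = M,
       fproj = foot ^^ Suc s \<rparr>"

definition osc_map ::
    "nat \<Rightarrow> ('a, 'i) manif \<Rightarrow> ('a, 'i) manif \<Rightarrow> (('a, 'i) pt \<Rightarrow> ('a, 'i) pt) \<Rightarrow>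
     ('a, 'i) pt \<Rightarrow> ('a, 'i) pt" where
  "osc_map s = Tmap_iter (Suc s)"


section \<open>Higher order tangent bundles\<close>

definition interval_mfd :: "real set \<Rightarrow> (real, unit) mfd" where
  "interval_mfd I =
     \<lparr> mdim = 1, pts = I, idx = UNIV, cdom = (\<lambda>_. I),
       chart = (\<lambda>_ t a. if a = 0 then t else 0) \<rparr>"

text \<open>Only the germ of a curve at \<open>0\<close> matters; its values far from \<open>0\<close> are arbitrary.\<close>

definition curve :: "('p, 'i) mfd \<Rightarrow> (real \<Rightarrow> 'p) \<Rightarrow> bool" where
  "curve M \<gamma> \<longleftrightarrow> (\<exists>c d. c < 0 \<and> 0 < d \<and> smooth_map (interval_mfd {c<..<d}) M \<gamma>)"

definition jet0 :: "nat \<Rightarrow> ('p, 'i) mfd \<Rightarrow> (real \<Rightarrow> 'p) \<Rightarrow> (real \<Rightarrow> 'p) set" where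
  "jet0 k M \<gamma> =
     {\<delta>. curve M \<delta> \<and> \<delta> 0 = \<gamma> 0 \<and>
        (\<forall>i\<in>idx M. \<gamma> 0 \<in> cdom M i \<longrightarrow>
           (\<forall>l\<le>k. \<forall>a<mdim M.
              (deriv ^^ l) (\<lambda>t. chart M i (\<delta> t) a) 0 = (deriv ^^ l) (\<lambda>t. chart M i (\<gamma> t) a) 0))}"

definition jet_rep :: "(real \<Rightarrow> 'p) set \<Rightarrow> real \<Rightarrow> 'p" where
  "jet_rep J = (SOME \<gamma>. \<gamma> \<in> J)"

text \<open>The chart of \<open>T\<^sup>k M\<close> induced by a chart of \<open>M\<close> lists the derivatives of order
  \<open>0, \<dots>, k\<close> at \<open>0\<close>, in blocks of length \<open>mdim M\<close>.\<close>

definition velocity :: "nat \<Rightarrow> ('p, 'i) mfd \<Rightarrow> ((real \<Rightarrow> 'p) set, 'i, 'p, 'i) fibmfd" where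
  "velocity k M =
     \<lparr> total =
         \<lparr> mdim = (k + 1) * mdim M,
           pts = {jet0 k M \<gamma> | \<gamma>. curve M \<gamma>},
           idx = idx M,
           cdom = (\<lambda>i. {jet0 k M \<gamma> | \<gamma>. curve M \<gamma> \<and> \<gamma> 0 \<in> cdom M i}),
           chart = (\<lambda>i J a. if a < (k + 1) * mdim M
                            then (deriv ^^ (a div mdim M))
                                   (\<lambda>t. chart M i (jet_rep J t) (a mod mdim M)) 0
                            else 0) \<rparr>,
       base = M,
       fproj = (\<lambda>J. jet_rep J 0) \<rparr>"

definition velocity_map ::
    "nat \<Rightarrow> ('p, 'i) mfd \<Rightarrow> ('p, 'i) mfd \<Rightarrow> ('p \<Rightarrow> 'p) \<Rightarrow> (real \<Rightarrow> 'p) set \<Rightarrow> (real \<Rightarrow> 'p) set" where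
  "velocity_map k M N f J = jet0 k N (f \<circ> jet_rep J)"

end

theory Submission
  imports Defs "HOL-Homology.Invariance_of_Domain"
begin

text \<open>
  A curve \<open>\<gamma>\<close> in \<open>M\<close> has a velocity \<open>\<gamma>'\<close>, a curve in \<open>TM\<close>, and hence an iterated velocity
  \<open>\<gamma>\<^sup>(\<^sup>r\<^sup>)\<close> in the \<open>r\<close>-fold iterated tangent bundle. By the chain rule \<open>T f\<close> maps velocities of
  \<open>\<gamma>\<close> to velocities of \<open>f \<circ> \<gamma>\<close>; applied to \<open>f\<close> itself and to the bundle projections, this
  shows that \<open>\<gamma>\<^sup>(\<^sup>r\<^sup>)(0)\<close> is prominent and that it depends naturally on \<open>\<gamma>\<close>.

  In a bundle chart the coordinates of an element of the iterated tangent bundle come in blocks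
  indexed by the subsets \<open>A\<close> of an \<open>r\<close>-element set, and the block of \<open>\<gamma>\<^sup>(\<^sup>r\<^sup>)(0)\<close> at \<open>A\<close> is the
  derivative of \<open>\<gamma>\<close> of order \<open>|A|\<close>. The projections delete elements of the index set, so an
  element is prominent iff its blocks depend only on \<open>|A|\<close>, and then a Taylor polynomial
  realizes it as an iterated velocity. Thus \<open>j\<^sup>r\<^sub>0 \<gamma> \<mapsto> \<gamma>\<^sup>(\<^sup>r\<^sup>)(0)\<close> is a natural bijection from
  velocities of order \<open>r\<close> onto prominent elements. The atlas of the former is the pullback of
  an atlas of linear slice charts of the latter, whence the smooth structure, the
  functoriality and the submersion property are transported along this bijection.
\<close>

section \<open>Calculus in coordinate spaces\<close>

text \<open>Prominence is turned into equations between coordinates in one direction only, by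
  computing \<open>T^a\<close> of a projection in charts. The converse costs nothing: symmetric
  blocks are realized by a curve, and iterated velocities are prominent by naturality. The same
  detour shows that \<open>Tmap_iter\<close> preserves prominence, so no higher chain rule is ever
  written out. A subset is encoded by the number \<open>A\<close> whose binary digits are its
  indicator, and block \<open>A\<close> occupies the coordinates \<open>A * m + c\<close>. Among the
  subsets with \<open>l\<close> elements the initial segment \<open>2 ^ l - 1\<close> serves as
  representative. The sizes \<open>0, \<dots>, r\<close> leave \<open>r + 1\<close> blocks, as many
  as there are derivatives in a velocity of order \<open>r\<close>. The atlas of
  \<open>submfd\<close> contains every slice chart, not only the linear ones used here, so its
  transition maps and the submersion condition have to be treated for arbitrary slice charts. The
  induced charts of jets, in contrast, correspond exactly to the linear slice charts; this is why
  the smooth structure on jets is obtained from the osculating bundle, and the submersion property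
  travels in the opposite direction.\<close>

definition coords :: "nat \<Rightarrow> (nat \<Rightarrow> real) set" where
  "coords n = {x. \<forall>i\<ge>n. x i = 0}"

lemma topspace_coords [simp]: "topspace (Euclidean_space n) = coords n"
  by (simp add: coords_def topspace_Euclidean_space)

lemma Euclidean_space_eq: "Euclidean_space n = top_of_set (coords n)"
  by (simp add: coords_def Euclidean_space_def euclidean_product_topology)

lemma coords_eqI: "x \<in> coords n \<Longrightarrow> y \<in> coords n \<Longrightarrow> (\<And>i. i < n \<Longrightarrow> x i = y i) \<Longrightarrow> x = y"
  by (rule ext) (metis (mono_tags, lifting) coords_def mem_Collect_eq not_less)

lemma coords_mono: "m \<le> n \<Longrightarrow> coords m \<subseteq> coords n"
  by (auto simp: coords_def)

lemma coords_upd: "x \<in> coords n \<Longrightarrow> b < n \<Longrightarrow> x(b := t) \<in> coords n"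
  by (auto simp: coords_def)

text \<open>A neighbourhood in the product topology restricts every coordinate, but inside
  \<open>coords n\<close> only the first \<open>n\<close> can vary, and finitely many radii have a
  positive minimum. Openness thus becomes a statement about boxes.\<close>

lemma openin_coords_iff:
  "openin (Euclidean_space n) S \<longleftrightarrow>
     S \<subseteq> coords n \<and> (\<forall>x\<in>S. \<exists>d>0. \<forall>y\<in>coords n. (\<forall>a<n. \<bar>y a - x a\<bar> < d) \<longrightarrow> y \<in> S)"
    (is "?L \<longleftrightarrow> ?R")
proof
  assume L: ?L
  show ?R
  proof (intro conjI ballI)
    show "S \<subseteq> coords n" using openin_subset[OF L] by simp
    fix x assume x: "x \<in> S"
    from L obtain T where T: "open T" "S = coords n \<inter> T"
      by (auto simp: Euclidean_space_eq openin_open)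
    have "openin (powertop_real UNIV) T"
      using T by (simp add: euclidean_product_topology)
    then have "\<exists>U. (\<forall>i. open (U i)) \<and> x \<in> Pi\<^sub>E UNIV U \<and> Pi\<^sub>E UNIV U \<subseteq> T"
      using x T unfolding openin_product_topology_alt by simp (metis IntD2)
    then obtain U where U: "\<And>i. open (U i)" "x \<in> Pi\<^sub>E UNIV U" "Pi\<^sub>E UNIV U \<subseteq> T"
      by blast
    have "\<forall>i. \<exists>d>0. \<forall>t. \<bar>t - x i\<bar> < d \<longrightarrow> t \<in> U i"
      using U(1,2) unfolding open_dist dist_real_def by (metis PiE_mem UNIV_I)
    then obtain d where d: "\<And>i. d i > 0" "\<And>i t. \<bar>t - x i\<bar> < d i \<Longrightarrow> t \<in> U i" by metis
    \<comment> \<open>The element \<open>1\<close> keeps the minimum defined for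
      \<open>n = 0\<close>.\<close>
    define e where "e = Min (insert 1 (d ` {..<n}))"
    have e: "e > 0" using d(1) by (auto simp: e_def Min_gr_iff)
    have e2: "e \<le> d i" if "i < n" for i using that by (auto simp: e_def)
    have "y \<in> S" if y: "y \<in> coords n" "\<forall>a<n. \<bar>y a - x a\<bar> < e" for y
    proof -
      have "y i \<in> U i" for i
      proof (cases "i < n")
        case True then show ?thesis using y e2[OF True] by (intro d(2)) force
      next
        case False
        then have "y i = x i" using y x T(2) by (auto simp: coords_def)
        then show ?thesis using d by simp
      qed
      then have "y \<in> T" using U(3) by auto
      then show ?thesis using T y by auto
    qed
    then show "\<exists>d>0. \<forall>y\<in>coords n. (\<forall>a<n. \<bar>y a - x a\<bar> < d) \<longrightarrow> y \<in> S" using e by blast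
  qed
next
  assume R: ?R
  show ?L
  proof (subst openin_subopen, intro ballI)
    fix x assume x: "x \<in> S"
    then obtain d where d: "d > 0" "\<forall>y\<in>coords n. (\<forall>a<n. \<bar>y a - x a\<bar> < d) \<longrightarrow> y \<in> S"
      using R by blast
    let ?T = "\<Inter>a\<in>{..<n}. {y::nat\<Rightarrow>real. \<bar>y a - x a\<bar> < d}"
    have "open ?T"
      by (intro open_INT ballI finite_lessThan open_Collect_less continuous_intros
            continuous_on_product_coordinates)
    then have "openin (Euclidean_space n) (coords n \<inter> ?T)" by (auto simp: Euclidean_space_eq)
    moreover have "x \<in> coords n \<inter> ?T" using x R d(1) by auto
    moreover have "coords n \<inter> ?T \<subseteq> S" using d by auto
    ultimately show "\<exists>T. openin (Euclidean_space n) T \<and> x \<in> T \<and> T \<subseteq> S" by blast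
  qed
qed

lemma openin_coords_box:
  assumes "openin (Euclidean_space n) S" "x \<in> S"
  obtains d where "d > 0" "\<And>y. y \<in> coords n \<Longrightarrow> (\<And>a. a < n \<Longrightarrow> \<bar>y a - x a\<bar> < d) \<Longrightarrow> y \<in> S"
  using assms unfolding openin_coords_iff by metis

lemma openin_coords_subset: "openin (Euclidean_space n) S \<Longrightarrow> S \<subseteq> coords n"
  using openin_subset by fastforce

abbreviation cont_on :: "nat \<Rightarrow> (nat \<Rightarrow> real) set \<Rightarrow> ((nat \<Rightarrow> real) \<Rightarrow> real) \<Rightarrow> bool" where
  "cont_on m S f \<equiv> continuous_map (subtopology (Euclidean_space m) S) euclideanreal f"

text \<open>Openness of \<open>S\<close> is built into the right-hand side: \<open>d\<close> also
  guarantees \<open>y \<in> S\<close>, so the criterion passes between open sets without tracking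
  the domain.\<close>

lemma cont_on_iff:
  assumes S: "openin (Euclidean_space m) S"
  shows "cont_on m S f \<longleftrightarrow>
    (\<forall>x\<in>S. \<forall>e>0. \<exists>d>0. \<forall>y\<in>coords m. (\<forall>a<m. \<bar>y a - x a\<bar> < d) \<longrightarrow> y \<in> S \<and> \<bar>f y - f x\<bar> < e)"
    (is "_ \<longleftrightarrow> ?R")
proof
  assume c: "cont_on m S f"
  show ?R
  proof (intro ballI allI impI)
    fix x and e :: real assume x: "x \<in> S" and e: "e > 0"
    have "openin (subtopology (Euclidean_space m) S)
       {y \<in> topspace (subtopology (Euclidean_space m) S). f y \<in> ball (f x) e}"
      using c by (intro openin_continuous_map_preimage) auto
    then have o: "openin (Euclidean_space m) {y \<in> S. f y \<in> ball (f x) e}"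
      using S openin_coords_subset[OF S]
      by (simp add: openin_open_subtopology Int_absorb1)
    from openin_coords_box[OF o, of x] x e obtain d where "d > 0"
      "\<And>y. y \<in> coords m \<Longrightarrow> (\<And>a. a < m \<Longrightarrow> \<bar>y a - x a\<bar> < d) \<Longrightarrow> y \<in> {y \<in> S. f y \<in> ball (f x) e}"
      by auto
    then show "\<exists>d>0. \<forall>y\<in>coords m. (\<forall>a<m. \<bar>y a - x a\<bar> < d) \<longrightarrow> y \<in> S \<and> \<bar>f y - f x\<bar> < e"
      by (intro exI[of _ d]) (auto simp: dist_real_def abs_minus_commute)
  qed
next
  assume R: ?R
  show "cont_on m S f"
    unfolding continuous_map_def
  proof (intro conjI allI impI)
    fix U :: "real set" assume "openin euclideanreal U"
    then have U: "open U" by simp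
    have eq: "{x \<in> topspace (subtopology (Euclidean_space m) S). f x \<in> U} = {x \<in> S. f x \<in> U}"
      using openin_coords_subset[OF S] by auto
    have "openin (Euclidean_space m) {x \<in> S. f x \<in> U}"
      unfolding openin_coords_iff
    proof (intro conjI ballI)
      show "{x \<in> S. f x \<in> U} \<subseteq> coords m" using openin_coords_subset[OF S] by auto
      fix x assume x: "x \<in> {x \<in> S. f x \<in> U}"
      then obtain e where e: "e > 0" "\<And>t. \<bar>t - f x\<bar> < e \<Longrightarrow> t \<in> U"
        using U unfolding open_dist dist_real_def by auto
      with R x obtain d where "d > 0"
        "\<forall>y\<in>coords m. (\<forall>a<m. \<bar>y a - x a\<bar> < d) \<longrightarrow> y \<in> S \<and> \<bar>f y - f x\<bar> < e"
        by blast
      then show "\<exists>d>0. \<forall>y\<in>coords m. (\<forall>a<m. \<bar>y a - x a\<bar> < d) \<longrightarrow> y \<in> {x \<in> S. f x \<in> U}"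
        using e by (intro exI[of _ d]) auto
    qed
    then show "openin (subtopology (Euclidean_space m) S)
        {x \<in> topspace (subtopology (Euclidean_space m) S). f x \<in> U}"
      unfolding eq by (intro openin_subtopology_Int2[of _ _ S, THEN back_subst[of "openin _"]]) auto
  qed auto
qed

text \<open>Makes \<open>partial\<close> a local notion: the line along which the derivative is
  taken stays in the open set near the point.\<close>

lemma openin_coords_line:
  assumes "openin (Euclidean_space m) S" "x \<in> S" "b < m"
  shows "\<forall>\<^sub>F t in nhds (x b). x(b := t) \<in> S"
proof -
  obtain d where d: "d > 0" "\<And>y. y \<in> coords m \<Longrightarrow> (\<And>a. a < m \<Longrightarrow> \<bar>y a - x a\<bar> < d) \<Longrightarrow> y \<in> S"
    using openin_coords_box assms by metis
  have "x(b := t) \<in> S" if "\<bar>t - x b\<bar> < d" for t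
    using that assms openin_coords_subset[OF assms(1)] d(1) by (intro d(2) coords_upd) auto
  then show ?thesis
    using d(1) unfolding eventually_nhds_metric dist_real_def by auto
qed

section \<open>Partial derivatives and functions of class \<open>C_k\<close>\<close>

abbreviation pdiff :: "nat \<Rightarrow> ((nat \<Rightarrow> real) \<Rightarrow> real) \<Rightarrow> (nat \<Rightarrow> real) \<Rightarrow> bool" where
  "pdiff b f x \<equiv> (\<lambda>t. f (x(b := t))) differentiable (at (x b))"

lemma has_partial:
  "pdiff b f x \<Longrightarrow> ((\<lambda>t. f (x(b := t))) has_field_derivative partial b f x) (at (x b))"
  unfolding partial_def by (simp add: DERIV_deriv_iff_real_differentiable)

lemma partialI:
  "((\<lambda>t. f (x(b := t))) has_field_derivative D) (at (x b)) \<Longrightarrow> pdiff b f x \<and> partial b f x = D"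
  unfolding partial_def using DERIV_imp_deriv real_differentiable_def by blast

lemma partial_cong:
  assumes "openin (Euclidean_space m) S" "x \<in> S" "b < m" "\<And>y. y \<in> S \<Longrightarrow> f y = g y"
  shows "partial b f x = partial b g x" "pdiff b f x \<longleftrightarrow> pdiff b g x"
proof -
  have ev: "\<forall>\<^sub>F t in nhds (x b). f (x(b := t)) = g (x(b := t))"
    using openin_coords_line[OF assms(1-3)] by eventually_elim (use assms(4) in auto)
  show "partial b f x = partial b g x" unfolding partial_def using ev by (intro deriv_cong_ev) auto
  show "pdiff b f x \<longleftrightarrow> pdiff b g x"
    using DERIV_cong_ev[OF refl ev refl] unfolding real_differentiable_def by blast
qed

lemma C_k_imp_cont_on: "C_k k m S f \<Longrightarrow> cont_on m S f"
  by (cases k) auto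

lemma C_k_SucD:
  assumes "C_k (Suc k) m S f"
  shows "b < m \<Longrightarrow> x \<in> S \<Longrightarrow> pdiff b f x" "b < m \<Longrightarrow> C_k k m S (partial b f)"
  using assms unfolding C_k.simps by blast+

lemma C_k_Suc_imp: "C_k (Suc k) m S f \<Longrightarrow> C_k k m S f"
  by (induction k arbitrary: f) auto

lemma C_k_mono: "C_k l m S f \<Longrightarrow> k \<le> l \<Longrightarrow> C_k k m S f"
  by (induction l) (auto simp: le_Suc_eq simp del: C_k.simps dest: C_k_Suc_imp)

lemma cont_on_local:
  assumes "openin (Euclidean_space m) S"
    and "\<And>x. x \<in> S \<Longrightarrow> \<exists>T g. openin (Euclidean_space m) T \<and> x \<in> T \<and> T \<subseteq> S \<and> cont_on m T g \<and>
           (\<forall>y\<in>T. f y = g y)"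
  shows "cont_on m S f"
  unfolding cont_on_iff[OF assms(1)]
proof (intro ballI allI impI)
  fix x and e :: real assume x: "x \<in> S" and e: "e > 0"
  from assms(2)[OF x] obtain T g where T: "openin (Euclidean_space m) T" "x \<in> T" "T \<subseteq> S"
    "cont_on m T g" "\<forall>y\<in>T. f y = g y" by blast
  from T(4) e T(2) show "\<exists>d>0. \<forall>y\<in>coords m. (\<forall>a<m. \<bar>y a - x a\<bar> < d) \<longrightarrow> y \<in> S \<and> \<bar>f y - f x\<bar> < e"
    unfolding cont_on_iff[OF T(1)] using T(2,3,5) by (metis subsetD)
qed

text \<open>Continuity and partial derivatives only depend on germs. The comparison function
  \<open>g\<close> may change from point to point, so a coordinate expression valid in a small chart
  is enough.\<close>

lemma C_k_local:
  assumes "openin (Euclidean_space m) S"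
    and "\<And>x. x \<in> S \<Longrightarrow> \<exists>T g. openin (Euclidean_space m) T \<and> x \<in> T \<and> T \<subseteq> S \<and> C_k k m T g \<and>
           (\<forall>y\<in>T. f y = g y)"
  shows "C_k k m S f"
  using assms(2)
proof (induction k arbitrary: f)
  case 0
  then show ?case using cont_on_local[OF assms(1)] by simp
next
  case (Suc k)
  have "cont_on m S f"
  proof (rule cont_on_local[OF assms(1)])
    fix x assume "x \<in> S"
    from Suc.prems[OF this] show "\<exists>T g. openin (Euclidean_space m) T \<and> x \<in> T \<and> T \<subseteq> S \<and>
        cont_on m T g \<and> (\<forall>y\<in>T. f y = g y)"
      using C_k_imp_cont_on by blast
  qed
  moreover have "pdiff b f x" if b: "b < m" and x: "x \<in> S" for b x
  proof -
    from Suc.prems[OF x] obtain T g where T: "openin (Euclidean_space m) T" "x \<in> T"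
      "C_k (Suc k) m T g" "\<forall>y\<in>T. f y = g y" by blast
    then show ?thesis using partial_cong(2)[OF T(1,2) b, of f g] b by auto
  qed
  moreover have "C_k k m S (partial b f)" if b: "b < m" for b
  proof (rule Suc.IH)
    fix x assume x: "x \<in> S"
    from Suc.prems[OF x] obtain T g where T: "openin (Euclidean_space m) T" "x \<in> T" "T \<subseteq> S"
      "C_k (Suc k) m T g" "\<forall>y\<in>T. f y = g y" by blast
    have "\<forall>y\<in>T. partial b f y = partial b g y"
      using partial_cong(1)[OF T(1) _ b, of _ f g] T(5) by auto
    then show "\<exists>T g. openin (Euclidean_space m) T \<and> x \<in> T \<and> T \<subseteq> S \<and> C_k k m T g \<and>
           (\<forall>y\<in>T. partial b f y = g y)"
      using T b by (intro exI[of _ T] exI[of _ "partial b g"]) auto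
  qed
  ultimately show ?case by simp
qed

lemma C_k_cong:
  assumes "openin (Euclidean_space m) S" "C_k k m S g" "\<And>x. x \<in> S \<Longrightarrow> f x = g x"
  shows "C_k k m S f"
  by (rule C_k_local[OF assms(1)]) (use assms in blast)

lemma C_k_subset:
  assumes "C_k k m S f" "T \<subseteq> S"
  shows "C_k k m T f"
  using assms(1)
proof (induction k arbitrary: f)
  case 0
  then show ?case using continuous_map_from_subtopology_mono[OF _ assms(2)] by auto
next
  case (Suc k)
  then show ?case using continuous_map_from_subtopology_mono[OF _ assms(2)] assms(2) by auto
qed

text \<open>The operator \<open>partial b\<close> does not mention the dimension. On a slice there
  are merely fewer directions \<open>b < m\<close>, and the same functions serve as derivatives;
  what remains is to identify the subspace topologies.\<close>

lemma C_k_slice: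
  assumes "C_k k n S f" "m \<le> n" "T \<subseteq> S" "T \<subseteq> coords m"
  shows "C_k k m T f"
proof -
  have eq: "subtopology (Euclidean_space m) T = subtopology (Euclidean_space n) T"
    using assms(4) coords_mono[OF assms(2)]
    by (simp add: Euclidean_space_eq subtopology_subtopology Int_absorb1 subset_trans)
  from assms(1) show ?thesis
  proof (induction k arbitrary: f)
    case 0
    then show ?case using continuous_map_from_subtopology_mono[OF _ assms(3)] eq by auto
  next
    case (Suc k)
    then show ?case
      using continuous_map_from_subtopology_mono[OF _ assms(3)] assms(2,3) eq by auto
  qed
qed

lemma cont_on_coord: "cont_on m S (\<lambda>x. x a)"
  by (auto simp: Euclidean_space_eq subtopology_subtopology
        intro!: continuous_on_product_coordinates[THEN continuous_on_subset])

lemma partial_const [simp]: "partial b (\<lambda>x. c) = (\<lambda>x. 0)"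
  by (simp add: partial_def fun_eq_iff)

lemma C_k_const: "C_k k m S (\<lambda>x. c)"
  by (induction k arbitrary: c) auto

lemma partial_coord: "pdiff b (\<lambda>x. x a) x" "partial b (\<lambda>x. x a) = (\<lambda>x. if a = b then 1 else 0)"
proof -
  have *: "((\<lambda>t. (x(b := t)) a) has_field_derivative (if a = b then 1 else 0)) (at (x b))" for x :: "nat \<Rightarrow> real"
    by (cases "a = b") auto
  show "pdiff b (\<lambda>x. x a) x" "partial b (\<lambda>x. x a) = (\<lambda>x. if a = b then 1 else 0)"
    using partialI[of "\<lambda>x. x a", OF *] by (auto simp: fun_eq_iff)
qed

lemma C_k_coord: "C_k k m S (\<lambda>x. x a)"
  by (cases k) (auto simp: cont_on_coord partial_coord C_k_const simp del: fun_upd_apply)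

lemma partial_add:
  assumes "pdiff b f x" "pdiff b g x"
  shows "pdiff b (\<lambda>x. f x + g x) x" "partial b (\<lambda>x. f x + g x) x = partial b f x + partial b g x"
  using partialI[of "\<lambda>x. f x + g x", OF DERIV_add[OF has_partial has_partial, OF assms]] by auto

lemma partial_mult:
  assumes "pdiff b f x" "pdiff b g x"
  shows "pdiff b (\<lambda>x. f x * g x) x"
    "partial b (\<lambda>x. f x * g x) x = partial b f x * g x + partial b g x * f x"
  using partialI[of "\<lambda>x. f x * g x", OF DERIV_mult[OF has_partial has_partial, OF assms]] by auto

lemma C_k_add:
  assumes S: "openin (Euclidean_space m) S" and "C_k k m S f" "C_k k m S g"
  shows "C_k k m S (\<lambda>x. f x + g x)"
  using assms(2,3)
proof (induction k arbitrary: f g)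
  case 0
  then show ?case by (auto intro: continuous_intros)
next
  case (Suc k)
  have "C_k k m S (partial b (\<lambda>x. f x + g x))" if "b < m" for b
    by (rule C_k_cong[OF S Suc.IH[of "partial b f" "partial b g"]])
       (use Suc.prems that in \<open>auto simp: partial_add\<close>)
  then show ?case using Suc.prems by (auto intro: continuous_intros partial_add)
qed

lemma C_k_mult:
  assumes S: "openin (Euclidean_space m) S" and "C_k k m S f" "C_k k m S g"
  shows "C_k k m S (\<lambda>x. f x * g x)"
  using assms(2,3)
proof (induction k arbitrary: f g)
  case 0
  then show ?case by (auto intro: continuous_intros)
next
  case (Suc k)
  have "C_k k m S (partial b (\<lambda>x. f x * g x))" if "b < m" for b
    by (rule C_k_cong[OF S C_k_add[OF S Suc.IH[of "partial b f" g] Suc.IH[of "partial b g" f]]])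
       (use Suc.prems that in \<open>auto simp: partial_mult dest: C_k_Suc_imp simp del: C_k.simps\<close>, auto simp: partial_mult)
  then show ?case using Suc.prems by (auto intro: continuous_intros partial_mult)
qed

lemma C_k_sum:
  assumes S: "openin (Euclidean_space m) S" and "\<And>i. i \<in> I \<Longrightarrow> C_k k m S (f i)"
  shows "C_k k m S (\<lambda>x. \<Sum>i\<in>I. f i x)"
  using assms(2)
  by (induction I rule: infinite_finite_induct) (auto intro: C_k_const C_k_add[OF S])

section \<open>The chain rule\<close>

text \<open>Continuous partial derivatives imply total differentiability. The way from
  \<open>p\<close> to \<open>y\<close> is a staircase of edges parallel to the axes; on each edge
  the mean value inequality applies, and continuity bounds the deviation of the slope from its value
  at \<open>p\<close> by \<open>e\<close>.\<close>

lemma C1_approx: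
  assumes S: "openin (Euclidean_space n) S" and g: "C_k (Suc 0) n S g" and p: "p \<in> S"
    and e: "e > (0::real)"
  obtains d where "d > 0"
    "\<And>y. y \<in> coords n \<Longrightarrow> (\<And>a. a < n \<Longrightarrow> \<bar>y a - p a\<bar> < d) \<Longrightarrow>
      \<bar>g y - g p - (\<Sum>a<n. partial a g p * (y a - p a))\<bar> \<le> e * (\<Sum>a<n. \<bar>y a - p a\<bar>)"
proof -
  have "\<forall>a. \<exists>d>0. a < n \<longrightarrow> (\<forall>y\<in>coords n. (\<forall>a<n. \<bar>y a - p a\<bar> < d) \<longrightarrow>
          y \<in> S \<and> \<bar>partial a g y - partial a g p\<bar> < e)"
    using g p e cont_on_iff[OF S] by (simp) (metis zero_less_one)
  then obtain D where D: "\<And>a. D a > 0" "\<And>a y. a < n \<Longrightarrow> y \<in> coords n \<Longrightarrow> (\<forall>b<n. \<bar>y b - p b\<bar> < D a) \<Longrightarrow>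
          y \<in> S \<and> \<bar>partial a g y - partial a g p\<bar> < e" by metis
  define d where "d = Min (insert 1 (D ` {..<n}))"
  have d: "d > 0" using D(1) by (auto simp: d_def)
  have d2: "d \<le> D i" if "i < n" for i using that by (auto simp: d_def)
  show ?thesis
  proof (rule that[OF d])
    fix y assume y: "y \<in> coords n" "\<And>a. a < n \<Longrightarrow> \<bar>y a - p a\<bar> < d"
    have pE: "p \<in> coords n" using p openin_coords_subset[OF S] by auto
    \<comment> \<open>Corner number \<open>j\<close> of the staircase: the first \<open>j\<close>
      coordinates have already been moved to \<open>y\<close>.\<close>
    define z where "z j = (\<lambda>a. if a < j then y a else p a)" for j
    have z0: "z 0 = p" by (auto simp: z_def)
    have zn: "z n = y" using y(1) pE by (auto simp: z_def coords_def)
    have step: "\<bar>g (z (Suc j)) - g (z j) - partial j g p * (y j - p j)\<bar> \<le> e * \<bar>y j - p j\<bar>"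
      if j: "j < n" for j
    proof -
      have zE: "z j \<in> coords n" using y(1) pE by (auto simp: z_def coords_def)
      have near: "(z j)(j := t) \<in> S \<and> \<bar>partial j g ((z j)(j := t)) - partial j g p\<bar> < e"
        if t: "t \<in> ball (p j) d" for t
        using t y(2) d2[OF j] D(1)[of j]
        by (intro D(2) j coords_upd zE) (fastforce simp: z_def dist_real_def)
      \<comment> \<open>Subtracting the linear part leaves a function whose derivative is the
        deviation of the partial derivative, hence smaller than \<open>e\<close>.\<close>
      define h where "h t = g ((z j)(j := t)) - partial j g p * t" for t
      have der: "(h has_field_derivative (partial j g ((z j)(j := t)) - partial j g p)) (at t within ball (p j) d)"
        if t: "t \<in> ball (p j) d" for t
      proof -
        have "\<forall>x\<in>S. pdiff j g x" using g j by simp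
        then have "pdiff j g ((z j)(j := t))" using near[OF t] by blast
        from has_partial[OF this]
        have "((\<lambda>s. g ((z j)(j := s))) has_field_derivative partial j g ((z j)(j := t))) (at t within ball (p j) d)"
          by (simp only: fun_upd_upd fun_upd_same has_field_derivative_at_within)
        then show ?thesis unfolding h_def by (auto intro!: derivative_eq_intros)
      qed
      have "norm (h (y j) - h (p j)) \<le> e * norm (y j - p j)"
        by (rule field_differentiable_bound[OF convex_ball der])
          (use near y(2)[OF j] d in \<open>auto simp: dist_real_def less_imp_le\<close>)
      moreover have "(z j)(j := y j) = z (Suc j)" "(z j)(j := p j) = z j"
        by (auto simp: z_def)
      ultimately show ?thesis by (simp add: h_def algebra_simps)
    qed
    have "g y - g p = (\<Sum>j<n. g (z (Suc j)) - g (z j))"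
      using sum_lessThan_telescope[of "\<lambda>j. g (z j)" n] by (simp add: z0 zn)
    then have "\<bar>g y - g p - (\<Sum>a<n. partial a g p * (y a - p a))\<bar> =
        \<bar>\<Sum>j<n. g (z (Suc j)) - g (z j) - partial j g p * (y j - p j)\<bar>"
      by (simp add: sum_subtractf)
    also have "\<dots> \<le> (\<Sum>j<n. e * \<bar>y j - p j\<bar>)"
      by (rule order.trans[OF sum_abs]) (use step in \<open>auto intro: sum_mono\<close>)
    finally show "\<bar>g y - g p - (\<Sum>a<n. partial a g p * (y a - p a))\<bar> \<le> e * (\<Sum>a<n. \<bar>y a - p a\<bar>)"
      by (simp add: sum_distrib_left)
  qed
qed

text \<open>The curve is differentiable at \<open>t0\<close> only and may be arbitrary elsewhere, so
  the derivative is obtained from the remainder \<open>R\<close> of the linear approximation, not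
  from a formula on a neighbourhood.\<close>

lemma chain_rule:
  assumes S: "openin (Euclidean_space n) S" and g: "C_k (Suc 0) n S g" and p: "c t0 \<in> S"
    and ev: "\<forall>\<^sub>F t in nhds t0. c t \<in> coords n"
    and c: "\<And>a. a < n \<Longrightarrow> ((\<lambda>t. c t a) has_field_derivative c' a) (at t0)"
  shows "((\<lambda>t. g (c t)) has_field_derivative (\<Sum>a<n. partial a g (c t0) * c' a)) (at (t0::real))"
proof -
  define R where "R t = g (c t) - g (c t0) - (\<Sum>a<n. partial a g (c t0) * (c t a - c t0 a))" for t
  define K where "K = (\<Sum>a<n. \<bar>c' a\<bar>)"
  have K: "K \<ge> 0" by (auto simp: K_def intro: sum_nonneg)
  have q: "((\<lambda>t. (\<Sum>a<n. \<bar>(c t a - c t0 a) / (t - t0)\<bar>)) \<longlongrightarrow> K) (at t0)"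
    unfolding K_def using c by (intro tendsto_sum tendsto_rabs) (auto simp: has_field_derivative_iff)
  have "((\<lambda>t. R t / (t - t0)) \<longlongrightarrow> 0) (at t0)"
  proof (rule tendstoI)
    fix \<epsilon> :: real assume \<epsilon>: "\<epsilon> > 0"
    \<comment> \<open>Near \<open>t0\<close> the sum of the absolute difference quotients stays
      below \<open>K + 1\<close>, so this choice bounds the quotient of the remainder by
      \<open>\<epsilon> / 2\<close>.\<close>
    define e where "e = \<epsilon> / (2 * (K + 1))"
    have e: "e > 0" using \<epsilon> K by (auto simp: e_def)
    obtain d where d: "d > 0" "\<And>y. y \<in> coords n \<Longrightarrow> (\<And>a. a < n \<Longrightarrow> \<bar>y a - c t0 a\<bar> < d) \<Longrightarrow>
      \<bar>g y - g (c t0) - (\<Sum>a<n. partial a g (c t0) * (y a - c t0 a))\<bar> \<le> e * (\<Sum>a<n. \<bar>y a - c t0 a\<bar>)"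
      by (rule C1_approx[OF S g p e]) blast
    have e1: "\<forall>\<^sub>F t in at t0. c t \<in> coords n" using ev by (simp add: eventually_nhds_conv_at)
    have "\<forall>\<^sub>F t in at t0. \<forall>a\<in>{..<n}. \<bar>c t a - c t0 a\<bar> < d"
    proof (intro eventually_ball_finite ballI)
      fix a assume "a \<in> {..<n}"
      then have "((\<lambda>t. c t a) \<longlongrightarrow> c t0 a) (at t0)"
        using DERIV_isCont[OF c] by (auto simp: isCont_def)
      then show "\<forall>\<^sub>F t in at t0. \<bar>c t a - c t0 a\<bar> < d"
        using d(1) by (auto simp: tendsto_iff dist_real_def)
    qed simp
    moreover have "\<forall>\<^sub>F t in at t0. (\<Sum>a<n. \<bar>(c t a - c t0 a) / (t - t0)\<bar>) < K + 1"
      using q by (rule order_tendstoD) simp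
    moreover have "\<forall>\<^sub>F t in at t0. t \<noteq> t0" by (simp add: eventually_at_filter)
    ultimately show "\<forall>\<^sub>F t in at t0. dist (R t / (t - t0)) 0 < \<epsilon>"
      using e1
    proof eventually_elim
      case (elim t)
      have "\<bar>R t\<bar> \<le> e * (\<Sum>a<n. \<bar>c t a - c t0 a\<bar>)" unfolding R_def using elim by (intro d(2)) auto
      then have "\<bar>R t\<bar> / \<bar>t - t0\<bar> \<le> e * (\<Sum>a<n. \<bar>c t a - c t0 a\<bar>) / \<bar>t - t0\<bar>"
        by (intro divide_right_mono) auto
      also have "\<dots> = e * (\<Sum>a<n. \<bar>(c t a - c t0 a) / (t - t0)\<bar>)"
        by (simp only: times_divide_eq_right[symmetric] sum_divide_distrib abs_divide)
      also have "\<dots> \<le> e * (K + 1)" using elim e by (intro mult_left_mono) auto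
      also have "\<dots> = \<epsilon> / 2" using K by (simp add: e_def field_simps)
      also have "\<dots> < \<epsilon>" using \<epsilon> by simp
      finally show ?case by (simp add: dist_real_def)
    qed
  qed
  moreover have "R t0 = 0" by (simp add: R_def)
  ultimately have R: "(R has_field_derivative 0) (at t0)" by (simp add: has_field_derivative_iff)
  have "((\<lambda>t. R t + g (c t0) + (\<Sum>a<n. partial a g (c t0) * (c t a - c t0 a))) has_field_derivative
      0 + 0 + (\<Sum>a<n. partial a g (c t0) * (c' a - 0))) (at t0)"
    by (intro DERIV_add DERIV_sum DERIV_cmult DERIV_diff R c DERIV_const) auto
  then show ?thesis by (simp add: R_def)
qed

text \<open>The chain rule applied to the image under \<open>F\<close> of the line
  \<open>x(b := t)\<close>.\<close>

lemma partial_compose: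
  assumes S: "openin (Euclidean_space m) S" and T: "openin (Euclidean_space n) T"
    and F: "\<And>x. x \<in> S \<Longrightarrow> F x \<in> T"
    and g: "C_k (Suc 0) n T g" and x: "x \<in> S" and b: "b < m"
    and d: "\<And>a. a < n \<Longrightarrow> pdiff b (\<lambda>x. F x a) x"
  shows "pdiff b (\<lambda>x. g (F x)) x"
    "partial b (\<lambda>x. g (F x)) x = (\<Sum>a<n. partial a g (F x) * partial b (\<lambda>x. F x a) x)"
proof -
  have "((\<lambda>t. g (F (x(b := t)))) has_field_derivative
      (\<Sum>a<n. partial a g (F (x(b := x b))) * partial b (\<lambda>x. F x a) x)) (at (x b))"
  proof (rule chain_rule[OF T g])
    show "\<forall>\<^sub>F t in nhds (x b). F (x(b := t)) \<in> coords n"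
      using openin_coords_line[OF S x b] by eventually_elim (use F openin_coords_subset[OF T] in auto)
    show "((\<lambda>t. F (x(b := t)) a) has_field_derivative partial b (\<lambda>x. F x a) x) (at (x b))"
      if "a < n" for a using has_partial[OF d[OF that]] .
  qed (use F x in auto)
  from partialI[of "\<lambda>x. g (F x)", OF this]
  show "pdiff b (\<lambda>x. g (F x)) x"
    "partial b (\<lambda>x. g (F x)) x = (\<Sum>a<n. partial a g (F x) * partial b (\<lambda>x. F x a) x)"
    by auto
qed

lemma cont_on_into_coords:
  assumes S: "openin (Euclidean_space m) S" and T: "T \<subseteq> coords n"
    and F: "\<And>x. x \<in> S \<Longrightarrow> F x \<in> T"
    and c: "\<And>a. a < n \<Longrightarrow> cont_on m S (\<lambda>x. F x a)"
  shows "continuous_map (subtopology (Euclidean_space m) S) (subtopology (Euclidean_space n) T) F"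
proof -
  have "continuous_map (subtopology (Euclidean_space m) S) (Euclidean_space n)
         (\<lambda>x i. if i < n then F x i else 0)"
    using c by (subst continuous_map_componentwise_Euclidean_space) auto
  then have "continuous_map (subtopology (Euclidean_space m) S) (Euclidean_space n) F"
    by (rule continuous_map_eq) (use F T openin_coords_subset[OF S] in \<open>fastforce simp: coords_def\<close>)
  then show ?thesis using F by (auto simp: continuous_map_in_subtopology)
qed

text \<open>By the chain rule a partial derivative of the composite is a sum of products of
  derivatives of \<open>g\<close>, composed with \<open>F\<close>, and derivatives of
  \<open>F\<close>. All factors are one class lower, which is the induction step.\<close>

lemma C_k_compose:
  assumes S: "openin (Euclidean_space m) S" and T: "openin (Euclidean_space n) T"
    and F: "\<And>x. x \<in> S \<Longrightarrow> F x \<in> T"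
  shows "C_k k n T g \<Longrightarrow> (\<And>a. a < n \<Longrightarrow> C_k k m S (\<lambda>x. F x a)) \<Longrightarrow> C_k k m S (\<lambda>x. g (F x))"
proof (induction k arbitrary: g)
  case 0
  then have "continuous_map (subtopology (Euclidean_space m) S) (subtopology (Euclidean_space n) T) F"
    by (intro cont_on_into_coords[OF S openin_coords_subset[OF T] F]) auto
  from continuous_map_compose[OF this] 0 show ?case by (simp add: comp_def)
next
  case (Suc k)
  have 1: "C_k (Suc 0) n T g" by (rule C_k_mono[OF Suc.prems(1)]) simp
  have 2: "pdiff b (\<lambda>x. F x a) x" if "b < m" "a < n" "x \<in> S" for a b x
    by (rule C_k_SucD(1)[OF Suc.prems(2)]) fact+
  have "C_k k m S (partial b (\<lambda>x. g (F x)))" if b: "b < m" for b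
  proof (rule C_k_cong[OF S])
    show "C_k k m S (\<lambda>x. \<Sum>a<n. partial a g (F x) * partial b (\<lambda>x. F x a) x)"
    proof (intro C_k_sum[OF S] C_k_mult[OF S])
      fix a assume "a \<in> {..<n}"
      then have a: "a < n" by simp
      show "C_k k m S (\<lambda>x. partial a g (F x))"
        by (rule Suc.IH[OF C_k_SucD(2)[OF Suc.prems(1) a] C_k_Suc_imp[OF Suc.prems(2)]])
      show "C_k k m S (partial b (\<lambda>x. F x a))"
        by (rule C_k_SucD(2)[OF Suc.prems(2)[OF a] b])
    qed
    show "partial b (\<lambda>x. g (F x)) x = (\<Sum>a<n. partial a g (F x) * partial b (\<lambda>x. F x a) x)"
      if "x \<in> S" for x
      by (rule partial_compose(2)[OF S T F 1 that b 2[OF b _ that]])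
  qed
  moreover have "pdiff b (\<lambda>x. g (F x)) x" if "b < m" "x \<in> S" for b x
    by (rule partial_compose(1)[OF S T F 1 that(2,1) 2[OF that(1) _ that(2)]])
  moreover have "cont_on m S (\<lambda>x. g (F x))"
  proof -
    have "continuous_map (subtopology (Euclidean_space m) S) (subtopology (Euclidean_space n) T) F"
      by (intro cont_on_into_coords[OF S openin_coords_subset[OF T] F] C_k_imp_cont_on[OF Suc.prems(2)])
    from continuous_map_compose[OF this C_k_imp_cont_on[OF Suc.prems(1)]] show ?thesis
      by (simp add: comp_def)
  qed
  ultimately show ?case by simp
qed

section \<open>Smooth functions and maps between coordinate spaces\<close>

definition smooth_fun :: "nat \<Rightarrow> (nat \<Rightarrow> real) set \<Rightarrow> ((nat \<Rightarrow> real) \<Rightarrow> real) \<Rightarrow> bool" where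
  "smooth_fun m S f \<longleftrightarrow> (\<forall>k. C_k k m S f)"

lemma smooth_between_iff: "smooth_between m n S f \<longleftrightarrow> (\<forall>a<n. smooth_fun m S (\<lambda>x. f x a))"
  by (simp add: smooth_between_def smooth_fun_def)

lemma smooth_fun_partial: "smooth_fun m S f \<Longrightarrow> b < m \<Longrightarrow> smooth_fun m S (partial b f)"
  unfolding smooth_fun_def using C_k.simps(2) by blast

lemma smooth_fun_pdiff: "smooth_fun m S f \<Longrightarrow> b < m \<Longrightarrow> x \<in> S \<Longrightarrow> pdiff b f x"
  unfolding smooth_fun_def using C_k.simps(2) by blast

lemma smooth_fun_cont_on: "smooth_fun m S f \<Longrightarrow> cont_on m S f"
  unfolding smooth_fun_def using C_k.simps(1) by blast

lemma smooth_fun_C1: "smooth_fun m S f \<Longrightarrow> C_k (Suc 0) m S f"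
  unfolding smooth_fun_def by blast

lemma smooth_fun_subset: "smooth_fun m S f \<Longrightarrow> T \<subseteq> S \<Longrightarrow> smooth_fun m T f"
  unfolding smooth_fun_def using C_k_subset by blast

lemma smooth_fun_slice: "smooth_fun n S f \<Longrightarrow> m \<le> n \<Longrightarrow> T \<subseteq> S \<Longrightarrow> T \<subseteq> coords m \<Longrightarrow> smooth_fun m T f"
  unfolding smooth_fun_def using C_k_slice by blast

lemma smooth_fun_const: "smooth_fun m S (\<lambda>x. c)" and smooth_fun_coord: "smooth_fun m S (\<lambda>x. x a)"
  unfolding smooth_fun_def by (auto simp: C_k_const C_k_coord)

lemma smooth_fun_cong:
  "openin (Euclidean_space m) S \<Longrightarrow> smooth_fun m S g \<Longrightarrow> (\<And>x. x \<in> S \<Longrightarrow> f x = g x) \<Longrightarrow> smooth_fun m S f"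
  unfolding smooth_fun_def using C_k_cong[of m S _ g f] by blast

lemma smooth_fun_local:
  assumes "openin (Euclidean_space m) S"
    and "\<And>x. x \<in> S \<Longrightarrow> \<exists>T g. openin (Euclidean_space m) T \<and> x \<in> T \<and> T \<subseteq> S \<and> smooth_fun m T g \<and>
           (\<forall>y\<in>T. f y = g y)"
  shows "smooth_fun m S f"
  unfolding smooth_fun_def
proof
  fix k
  show "C_k k m S f"
  proof (rule C_k_local[OF assms(1)])
    fix x assume "x \<in> S"
    from assms(2)[OF this] obtain T g where "openin (Euclidean_space m) T" "x \<in> T" "T \<subseteq> S"
      "smooth_fun m T g" "\<forall>y\<in>T. f y = g y" by blast
    then show "\<exists>T g. openin (Euclidean_space m) T \<and> x \<in> T \<and> T \<subseteq> S \<and> C_k k m T g \<and>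
           (\<forall>y\<in>T. f y = g y)" unfolding smooth_fun_def by (intro exI[of _ T] exI[of _ g]) simp
  qed
qed

lemma smooth_fun_mult: "openin (Euclidean_space m) S \<Longrightarrow> smooth_fun m S f \<Longrightarrow> smooth_fun m S g \<Longrightarrow> smooth_fun m S (\<lambda>x. f x * g x)"
  unfolding smooth_fun_def by (auto intro: C_k_mult)

lemma smooth_fun_add: "openin (Euclidean_space m) S \<Longrightarrow> smooth_fun m S f \<Longrightarrow> smooth_fun m S g \<Longrightarrow> smooth_fun m S (\<lambda>x. f x + g x)"
  unfolding smooth_fun_def by (auto intro: C_k_add)

lemma smooth_fun_sum:
  "openin (Euclidean_space m) S \<Longrightarrow> (\<And>i. i \<in> I \<Longrightarrow> smooth_fun m S (f i)) \<Longrightarrow> smooth_fun m S (\<lambda>x. \<Sum>i\<in>I. f i x)"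
  unfolding smooth_fun_def by (auto intro: C_k_sum)

lemma smooth_fun_compose:
  assumes "openin (Euclidean_space m) S" "openin (Euclidean_space n) T"
    and "\<And>x. x \<in> S \<Longrightarrow> F x \<in> T" "smooth_fun n T g" "smooth_between m n S F"
  shows "smooth_fun m S (\<lambda>x. g (F x))"
  unfolding smooth_fun_def
proof
  fix k
  show "C_k k m S (\<lambda>x. g (F x))"
    by (rule C_k_compose[OF assms(1-3)]) (use assms(4,5) in \<open>auto simp: smooth_fun_def smooth_between_def\<close>)
qed

lemma smooth_between_compose:
  assumes "openin (Euclidean_space m) S" "openin (Euclidean_space n) T"
    and "\<And>x. x \<in> S \<Longrightarrow> F x \<in> T" "smooth_between n l T G" "smooth_between m n S F"
  shows "smooth_between m l S (\<lambda>x. G (F x))"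
  using assms(4) smooth_fun_compose[OF assms(1-3) _ assms(5)] by (auto simp: smooth_between_iff)

lemma smooth_between_subset: "smooth_between m n S f \<Longrightarrow> T \<subseteq> S \<Longrightarrow> smooth_between m n T f"
  by (auto simp: smooth_between_iff intro: smooth_fun_subset)

lemma smooth_between_cong:
  "openin (Euclidean_space m) S \<Longrightarrow> smooth_between m n S g \<Longrightarrow> (\<And>x a. x \<in> S \<Longrightarrow> a < n \<Longrightarrow> f x a = g x a) \<Longrightarrow>
   smooth_between m n S f"
  unfolding smooth_between_iff by (auto intro: smooth_fun_cong)

lemma smooth_between_local:
  assumes "openin (Euclidean_space m) S"
    and "\<And>x. x \<in> S \<Longrightarrow> \<exists>T g. openin (Euclidean_space m) T \<and> x \<in> T \<and> T \<subseteq> S \<and> smooth_between m n T g \<and>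
           (\<forall>y\<in>T. \<forall>a<n. f y a = g y a)"
  shows "smooth_between m n S f"
  unfolding smooth_between_iff
proof (intro allI impI smooth_fun_local[OF assms(1)])
  fix a x assume a: "a < n" and "x \<in> S"
  from assms(2)[OF this(2)] obtain T g where "openin (Euclidean_space m) T" "x \<in> T" "T \<subseteq> S"
    "smooth_between m n T g" "\<forall>y\<in>T. \<forall>a<n. f y a = g y a" by blast
  then show "\<exists>T g. openin (Euclidean_space m) T \<and> x \<in> T \<and> T \<subseteq> S \<and> smooth_fun m T g \<and> (\<forall>y\<in>T. f y a = g y)"
    using a by (intro exI[of _ T] exI[of _ "\<lambda>x. g x a"]) (auto simp: smooth_between_iff)
qed

lemma smooth_between_slice:
  "smooth_between n l S f \<Longrightarrow> m \<le> n \<Longrightarrow> T \<subseteq> S \<Longrightarrow> T \<subseteq> coords m \<Longrightarrow> smooth_between m l T f"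
  unfolding smooth_between_iff using smooth_fun_slice by blast

lemma smooth_between_cont_on:
  assumes S: "openin (Euclidean_space m) S" and "smooth_between m n S F" "\<And>x. x \<in> S \<Longrightarrow> F x \<in> coords n"
  shows "continuous_map (subtopology (Euclidean_space m) S) (Euclidean_space n) F"
proof -
  have "continuous_map (subtopology (Euclidean_space m) S) (subtopology (Euclidean_space n) (coords n)) F"
    by (rule cont_on_into_coords[OF S]) (use assms in \<open>auto simp: smooth_between_iff intro: smooth_fun_cont_on\<close>)
  then show ?thesis by (metis subtopology_topspace topspace_coords)
qed

lemma openin_preimage_smooth_between:
  assumes S: "openin (Euclidean_space m) S" and "smooth_between m n S F" "\<And>x. x \<in> S \<Longrightarrow> F x \<in> coords n"
    and T: "openin (Euclidean_space n) T"
  shows "openin (Euclidean_space m) {x \<in> S. F x \<in> T}"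
proof -
  have "openin (subtopology (Euclidean_space m) S) {x \<in> topspace (subtopology (Euclidean_space m) S). F x \<in> T}"
    by (rule openin_continuous_map_preimage[OF smooth_between_cont_on[OF assms(1-3)] T]) 
  moreover have "{x \<in> topspace (subtopology (Euclidean_space m) S). F x \<in> T} = {x \<in> S. F x \<in> T}"
    using openin_coords_subset[OF S] by auto
  ultimately show ?thesis using S by (simp add: openin_open_subtopology)
qed

lemma jacobian_compose:
  assumes S: "openin (Euclidean_space m) S" and T: "openin (Euclidean_space n) T"
    and F: "\<And>x. x \<in> S \<Longrightarrow> F x \<in> T" "smooth_between m n S F"
    and G: "smooth_fun n T g"
    and x: "x \<in> S" "b < m"
  shows "partial b (\<lambda>x. g (F x)) x = (\<Sum>a<n. partial a g (F x) * partial b (\<lambda>x. F x a) x)"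
  using F(2) x
  by (intro partial_compose(2)[OF S T F(1) smooth_fun_C1[OF G]]) (auto simp: smooth_between_iff intro: smooth_fun_pdiff)

section \<open>Manifolds and smooth maps\<close>

text \<open>The chart axioms of \<open>manifold\<close>, separated from the topological ones. For
  each new bundle they are established first; the Hausdorff property and second countability are
  then proved for the topology \<open>mtop\<close> which the charts determine.\<close>

definition atlas :: "('p, 'i) mfd \<Rightarrow> bool" where
  "atlas M \<longleftrightarrow>
     pts M = (\<Union>i\<in>idx M. cdom M i) \<and>
     (\<forall>i\<in>idx M. inj_on (chart M i) (cdom M i)) \<and>
     (\<forall>i\<in>idx M. \<forall>j\<in>idx M.
        openin (Euclidean_space (mdim M)) (chart M i ` (cdom M i \<inter> cdom M j)) \<and>
        smooth_between (mdim M) (mdim M) (chart M i ` (cdom M i \<inter> cdom M j))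
          (\<lambda>x. chart M j (param M i x)))"

lemma manifold_iff:
  "manifold M \<longleftrightarrow> atlas M \<and> Hausdorff_space (mtop M) \<and> second_countable (mtop M)"
  unfolding manifold_def atlas_def by blast

lemma manifold_atlas: "manifold M \<Longrightarrow> atlas M"
  by (simp add: manifold_iff)

abbreviation local_rep :: "('p, 'i) mfd \<Rightarrow> 'i \<Rightarrow> ('q, 'j) mfd \<Rightarrow> 'j \<Rightarrow> ('p \<Rightarrow> 'q) \<Rightarrow> (nat \<Rightarrow> real) \<Rightarrow> nat \<Rightarrow> real" where
  "local_rep M i N j f \<equiv> \<lambda>x. chart N j (f (param M i x))"

text \<open>The constant \<open>topology\<close> returns the intended open sets only for a family
  that is a topology. Injectivity of the charts enters for finite intersections, whose images must
  be the intersections of the images.\<close>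

lemma openin_mtop:
  assumes "\<And>i. i \<in> idx M \<Longrightarrow> inj_on (chart M i) (cdom M i)"
  shows "openin (mtop M) U \<longleftrightarrow> U \<subseteq> pts M \<and>
     (\<forall>i\<in>idx M. openin (Euclidean_space (mdim M)) (chart M i ` (U \<inter> cdom M i)))"
proof -
  have "istopology (\<lambda>U. U \<subseteq> pts M \<and>
     (\<forall>i\<in>idx M. openin (Euclidean_space (mdim M)) (chart M i ` (U \<inter> cdom M i))))"
    unfolding istopology_def
  proof (intro conjI allI impI ballI; (elim conjE)?)
    fix S T i assume i: "i \<in> idx M"
      and S: "\<forall>i\<in>idx M. openin (Euclidean_space (mdim M)) (chart M i ` (S \<inter> cdom M i))"
      and T: "\<forall>i\<in>idx M. openin (Euclidean_space (mdim M)) (chart M i ` (T \<inter> cdom M i))"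
    have "chart M i ` (S \<inter> T \<inter> cdom M i) = chart M i ` (S \<inter> cdom M i) \<inter> chart M i ` (T \<inter> cdom M i)"
      by (subst inj_on_image_Int[OF assms[OF i], symmetric]) auto
    then show "openin (Euclidean_space (mdim M)) (chart M i ` (S \<inter> T \<inter> cdom M i))"
      using S T i by auto
  next
    fix K i assume K: "\<forall>U\<in>K. U \<subseteq> pts M \<and>
          (\<forall>i\<in>idx M. openin (Euclidean_space (mdim M)) (chart M i ` (U \<inter> cdom M i)))"
      and i: "i \<in> idx M"
    have "chart M i ` (\<Union>K \<inter> cdom M i) = (\<Union>U\<in>K. chart M i ` (U \<inter> cdom M i))" by auto
    then show "openin (Euclidean_space (mdim M)) (chart M i ` (\<Union>K \<inter> cdom M i))"
      using K i by auto
  qed auto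
  then show ?thesis unfolding mtop_def by (simp add: topology_inverse')
qed

context
  fixes M :: "('p, 'i) mfd"
  assumes M: "atlas M"
begin

lemma chart_inj: "i \<in> idx M \<Longrightarrow> inj_on (chart M i) (cdom M i)"
  using M by (simp add: atlas_def)

lemma cdom_pts: "i \<in> idx M \<Longrightarrow> p \<in> cdom M i \<Longrightarrow> p \<in> pts M"
  using M by (auto simp: atlas_def)

lemma pts_cdom: "p \<in> pts M \<Longrightarrow> \<exists>i\<in>idx M. p \<in> cdom M i"
  using M by (auto simp: atlas_def)

lemma openin_mtop_iff:
  "openin (mtop M) U \<longleftrightarrow> U \<subseteq> pts M \<and>
     (\<forall>i\<in>idx M. openin (Euclidean_space (mdim M)) (chart M i ` (U \<inter> cdom M i)))"
  by (rule openin_mtop) (rule chart_inj)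

lemma param_chart: "i \<in> idx M \<Longrightarrow> p \<in> cdom M i \<Longrightarrow> param M i (chart M i p) = p"
  unfolding param_def by (rule the_inv_into_f_f[OF chart_inj])

lemma chart_param: "i \<in> idx M \<Longrightarrow> x \<in> chart M i ` cdom M i \<Longrightarrow> chart M i (param M i x) = x"
  using param_chart by auto

lemma param_in: "i \<in> idx M \<Longrightarrow> x \<in> chart M i ` U \<Longrightarrow> U \<subseteq> cdom M i \<Longrightarrow> param M i x \<in> U"
  using param_chart by auto

lemma overlap_open:
  "i \<in> idx M \<Longrightarrow> j \<in> idx M \<Longrightarrow>
     openin (Euclidean_space (mdim M)) (chart M i ` (cdom M i \<inter> cdom M j))"
  using M by (simp add: atlas_def)

lemma overlap_smooth:
  "i \<in> idx M \<Longrightarrow> j \<in> idx M \<Longrightarrow>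
     smooth_between (mdim M) (mdim M) (chart M i ` (cdom M i \<inter> cdom M j)) (\<lambda>x. chart M j (param M i x))"
  using M by (simp add: atlas_def)

lemma chart_image_open: "i \<in> idx M \<Longrightarrow> openin (Euclidean_space (mdim M)) (chart M i ` cdom M i)"
  using overlap_open[of i i] by simp

lemma chart_coords: "i \<in> idx M \<Longrightarrow> p \<in> cdom M i \<Longrightarrow> chart M i p \<in> coords (mdim M)"
  using openin_coords_subset[OF chart_image_open] by auto

lemma cdom_open: "i \<in> idx M \<Longrightarrow> openin (mtop M) (cdom M i)"
  unfolding openin_mtop_iff using overlap_open cdom_pts by (auto simp: Int_commute)

lemma pts_open: "openin (mtop M) (pts M)"
proof -
  have "pts M \<inter> cdom M i = cdom M i" if "i \<in> idx M" for i using cdom_pts that by auto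
  then show ?thesis unfolding openin_mtop_iff using chart_image_open by auto
qed

lemma topspace_mtop: "topspace (mtop M) = pts M"
  using pts_open openin_mtop_iff by (metis openin_subset openin_topspace subset_antisym)

lemma chart_open:
  "openin (mtop M) U \<Longrightarrow> i \<in> idx M \<Longrightarrow> openin (Euclidean_space (mdim M)) (chart M i ` (U \<inter> cdom M i))"
  unfolding openin_mtop_iff by blast

lemma chart_open_sub:
  "openin (mtop M) U \<Longrightarrow> i \<in> idx M \<Longrightarrow> U \<subseteq> cdom M i \<Longrightarrow>
    openin (Euclidean_space (mdim M)) (chart M i ` U)"
  using chart_open by (metis inf.orderE)

text \<open>Openness in \<open>mtop\<close> is tested in every chart \<open>j\<close>. There the set
  becomes the preimage of \<open>Q\<close> under a transition map, which is continuous.\<close>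

lemma param_open:
  assumes i: "i \<in> idx M" and Q: "openin (Euclidean_space (mdim M)) Q" "Q \<subseteq> chart M i ` cdom M i"
  shows "openin (mtop M) (param M i ` Q)"
  unfolding openin_mtop_iff
proof (intro conjI ballI)
  have sub: "param M i ` Q \<subseteq> cdom M i" using Q(2) param_chart[OF i] by auto
  then show "param M i ` Q \<subseteq> pts M" using cdom_pts i by auto
  fix j assume j: "j \<in> idx M"
  have "chart M j ` (param M i ` Q \<inter> cdom M j) =
      {y \<in> chart M j ` (cdom M j \<inter> cdom M i). chart M i (param M j y) \<in> Q}" (is "?A = ?B")
  proof
    show "?A \<subseteq> ?B"
    proof
      fix y assume "y \<in> ?A"
      then obtain x where x: "x \<in> Q" "param M i x \<in> cdom M j" "y = chart M j (param M i x)" by auto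
      then show "y \<in> ?B" using sub Q(2) by (auto simp: param_chart[OF j] chart_param[OF i])
    qed
    show "?B \<subseteq> ?A"
    proof
      fix y assume "y \<in> ?B"
      then obtain q where q: "q \<in> cdom M j" "q \<in> cdom M i" "y = chart M j q" "chart M i q \<in> Q"
        by (auto simp: param_chart[OF j])
      then have "q \<in> param M i ` Q" using param_chart[OF i q(2)] by force
      then show "y \<in> ?A" using q by auto
    qed
  qed
  moreover have "openin (Euclidean_space (mdim M)) ?B"
    by (rule openin_preimage_smooth_between[OF overlap_open[OF j i] overlap_smooth[OF j i] _ Q(1)])
       (auto simp: param_chart[OF j] chart_coords[OF i])
  ultimately show "openin (Euclidean_space (mdim M)) (chart M j ` (param M i ` Q \<inter> cdom M j))"
    by simp
qed

lemma openin_in_chart: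
  assumes i: "i \<in> idx M" and U: "U \<subseteq> cdom M i"
  shows "openin (mtop M) U \<longleftrightarrow> openin (Euclidean_space (mdim M)) (chart M i ` U)"
proof
  assume "openin (Euclidean_space (mdim M)) (chart M i ` U)"
  then have "openin (mtop M) (param M i ` (chart M i ` U))" using U by (intro param_open i) auto
  moreover have "param M i ` (chart M i ` U) = U" using U param_chart[OF i] by force
  ultimately show "openin (mtop M) U" by simp
qed (use chart_open_sub i U in auto)

end

text \<open>One pair of charts around each point is enough: a smooth coordinate expression is
  continuous, which gives continuity of \<open>f\<close>, and the expression in any other pair of
  charts differs by transition maps on both sides.\<close>

lemma smooth_mapI:
  assumes M: "atlas M" and N: "atlas N"
    and loc: "\<And>p. p \<in> pts M \<Longrightarrow> \<exists>i\<in>idx M. \<exists>j\<in>idx N. \<exists>U. openin (mtop M) U \<and> p \<in> U \<and>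
       U \<subseteq> cdom M i \<and> f ` U \<subseteq> cdom N j \<and> smooth_between (mdim M) (mdim N) (chart M i ` U) (local_rep M i N j f)"
  shows "smooth_map M N f"
proof -
  have into: "f p \<in> pts N" if "p \<in> pts M" for p
    using loc[OF that] cdom_pts[OF N] by blast
  have pre: "openin (mtop M) {p \<in> pts M. f p \<in> W}" if W: "openin (mtop N) W" for W
  proof (subst openin_subopen, intro ballI)
    fix p assume p: "p \<in> {p \<in> pts M. f p \<in> W}"
    from loc[of p] p obtain i j U where i: "i \<in> idx M" and j: "j \<in> idx N" and
      U: "openin (mtop M) U" "p \<in> U" "U \<subseteq> cdom M i" "f ` U \<subseteq> cdom N j" and
      sm: "smooth_between (mdim M) (mdim N) (chart M i ` U) (local_rep M i N j f)" by blast
    \<comment> \<open>The points of the chart whose images lie in \<open>W\<close>, described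
      entirely in coordinates so that continuity of the coordinate expression applies.\<close>
    define Q where "Q = {x \<in> chart M i ` U. local_rep M i N j f x \<in> chart N j ` (W \<inter> cdom N j)}"
    have "openin (Euclidean_space (mdim M)) Q"
      unfolding Q_def
      by (rule openin_preimage_smooth_between[OF chart_open_sub[OF M U(1) i U(3)] sm _ chart_open[OF N W j]])
         (use U i in \<open>auto intro!: chart_coords[OF N j] simp: param_chart[OF M i] subset_iff\<close>)
    moreover have sub: "Q \<subseteq> chart M i ` cdom M i" using U(3) by (auto simp: Q_def)
    ultimately have "openin (mtop M) (param M i ` Q)" by (rule param_open[OF M i])
    moreover have "p \<in> param M i ` Q"
      using p U param_chart[OF M i subsetD[OF U(3,2)]] by (intro image_eqI[of _ _ "chart M i p"]) (auto simp: Q_def)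
    moreover have "param M i ` Q \<subseteq> {p \<in> pts M. f p \<in> W}"
    proof
      fix q assume "q \<in> param M i ` Q"
      then obtain u where u: "u \<in> U" "q = u" "chart N j (f u) \<in> chart N j ` (W \<inter> cdom N j)"
        using U(3) param_chart[OF M i] by (auto simp: Q_def subset_iff)
      then obtain w where "w \<in> W" "w \<in> cdom N j" "chart N j (f u) = chart N j w" by auto
      then have "f u = w" using chart_inj[OF N j] U(4) u(1) by (meson inj_onD image_subset_iff)
      then show "q \<in> {p \<in> pts M. f p \<in> W}" using u \<open>w \<in> W\<close> U(3) cdom_pts[OF M i] by auto
    qed
    ultimately show "\<exists>T. openin (mtop M) T \<and> p \<in> T \<and> T \<subseteq> {p \<in> pts M. f p \<in> W}" by blast
  qed
  have sm: "smooth_between (mdim M) (mdim N) (chart M i ` (cdom M i \<inter> f -` cdom N j)) (local_rep M i N j f)"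
    if i: "i \<in> idx M" and j: "j \<in> idx N" for i j
  proof (rule smooth_between_local)
    have D: "openin (mtop M) (cdom M i \<inter> f -` cdom N j)"
    proof -
      have "cdom M i \<inter> f -` cdom N j = cdom M i \<inter> {p \<in> pts M. f p \<in> cdom N j}"
        using cdom_pts[OF M i] by auto
      then show ?thesis using pre[OF cdom_open[OF N j]] cdom_open[OF M i] by auto
    qed
    then show "openin (Euclidean_space (mdim M)) (chart M i ` (cdom M i \<inter> f -` cdom N j))"
      by (rule chart_open_sub[OF M _ i]) auto
    fix x assume "x \<in> chart M i ` (cdom M i \<inter> f -` cdom N j)"
    then obtain p where p: "p \<in> cdom M i" "f p \<in> cdom N j" "x = chart M i p" by auto
    from loc[OF cdom_pts[OF M i p(1)]] obtain i' j' U where i': "i' \<in> idx M" and j': "j' \<in> idx N" and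
      U: "openin (mtop M) U" "p \<in> U" "U \<subseteq> cdom M i'" "f ` U \<subseteq> cdom N j'" and
      sm: "smooth_between (mdim M) (mdim N) (chart M i' ` U) (local_rep M i' N j' f)" by blast
    let ?V = "U \<inter> (cdom M i \<inter> f -` cdom N j)"
    have V: "openin (mtop M) ?V" using U D by auto
    \<comment> \<open>Change of chart in \<open>M\<close>, the expression known to be smooth, change
      of chart in \<open>N\<close>.\<close>
    let ?g = "\<lambda>x. local_rep N j' N j id (local_rep M i' N j' f (local_rep M i M i' id x))"
    have o1: "openin (Euclidean_space (mdim M)) (chart M i ` ?V)" by (rule chart_open_sub[OF M V i]) auto
    have o2: "openin (Euclidean_space (mdim M)) (chart M i' ` U)" by (rule chart_open_sub[OF M U(1) i' U(3)])
    have o2': "openin (Euclidean_space (mdim M)) (chart M i' ` ?V)"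
      by (rule chart_open_sub[OF M V i']) (use U in auto)
    have o3: "openin (Euclidean_space (mdim N)) (chart N j' ` (cdom N j' \<inter> cdom N j))"
      by (rule overlap_open[OF N j' j])
    have "smooth_between (mdim M) (mdim N) (chart M i ` ?V) ?g"
    proof (rule smooth_between_compose[OF o1 o2', where G = "\<lambda>x. local_rep N j' N j id (local_rep M i' N j' f x)"])
      show "smooth_between (mdim M) (mdim M) (chart M i ` ?V) (local_rep M i M i' id)"
        using overlap_smooth[OF M i i'] by (simp, rule smooth_between_subset) (use U in auto)
      show "smooth_between (mdim M) (mdim N) (chart M i' ` ?V) (\<lambda>x. local_rep N j' N j id (local_rep M i' N j' f x))"
      proof (rule smooth_between_compose[OF o2' o3, where G = "local_rep N j' N j id"])
        show "smooth_between (mdim M) (mdim N) (chart M i' ` ?V) (local_rep M i' N j' f)"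
          by (rule smooth_between_subset[OF sm]) auto
        show "smooth_between (mdim N) (mdim N) (chart N j' ` (cdom N j' \<inter> cdom N j)) (local_rep N j' N j id)"
          using overlap_smooth[OF N j' j] by simp
        show "local_rep M i' N j' f x \<in> chart N j' ` (cdom N j' \<inter> cdom N j)" if "x \<in> chart M i' ` ?V" for x
        proof -
          have "param M i' x \<in> ?V" by (rule param_in[OF M i' that]) (use U in blast)
          then show ?thesis using U by blast
        qed
      qed
      show "local_rep M i M i' id x \<in> chart M i' ` ?V" if "x \<in> chart M i ` ?V" for x
      proof -
        have "param M i x \<in> ?V" by (rule param_in[OF M i that]) blast
        then show ?thesis by simp
      qed
    qed
    moreover have "local_rep M i N j f y = ?g y" if "y \<in> chart M i ` ?V" for y
    proof -
      have q: "param M i y \<in> ?V" using param_in[OF M i that] by auto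
      then have "param M i' (chart M i' (param M i y)) = param M i y" using param_chart[OF M i'] U by auto
      moreover have "param N j' (chart N j' (f (param M i y))) = f (param M i y)"
        using param_chart[OF N j'] U q by auto
      ultimately show ?thesis by simp
    qed
    moreover have "x \<in> chart M i ` ?V" "chart M i ` ?V \<subseteq> chart M i ` (cdom M i \<inter> f -` cdom N j)"
      using p U by auto
    ultimately show "\<exists>T g. openin (Euclidean_space (mdim M)) T \<and> x \<in> T \<and>
        T \<subseteq> chart M i ` (cdom M i \<inter> f -` cdom N j) \<and> smooth_between (mdim M) (mdim N) T g \<and>
        (\<forall>y\<in>T. \<forall>a<mdim N. local_rep M i N j f y a = g y a)"
      using o1 by (intro exI[of _ "chart M i ` ?V"] exI[of _ ?g]) simp
  qed
  have "continuous_map (mtop M) (mtop N) f"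
    unfolding continuous_map_def topspace_mtop[OF M] topspace_mtop[OF N] using into pre by auto
  then show ?thesis unfolding smooth_map_def using sm by blast
qed

lemma smooth_map_in:
  "atlas M \<Longrightarrow> atlas N \<Longrightarrow> smooth_map M N f \<Longrightarrow> p \<in> pts M \<Longrightarrow> f p \<in> pts N"
  unfolding smooth_map_def continuous_map_def by (auto simp: topspace_mtop)

lemma smooth_map_open:
  assumes "atlas M" "smooth_map M N f" "openin (mtop N) W"
  shows "openin (mtop M) {p \<in> pts M. f p \<in> W}"
  using openin_continuous_map_preimage[of "mtop M" "mtop N" f W] assms
  by (simp add: smooth_map_def topspace_mtop)

lemma smooth_map_open_chart:
  assumes M: "atlas M" and "smooth_map M N f" "openin (mtop N) W" and i: "i \<in> idx M"
  shows "openin (mtop M) (cdom M i \<inter> f -` W)"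
    "openin (Euclidean_space (mdim M)) (chart M i ` (cdom M i \<inter> f -` W))"
proof -
  have "cdom M i \<inter> f -` W = cdom M i \<inter> {p \<in> pts M. f p \<in> W}" using cdom_pts[OF M i] by auto
  then show "openin (mtop M) (cdom M i \<inter> f -` W)"
    using smooth_map_open[OF assms(1-3)] cdom_open[OF M i] by auto
  then show "openin (Euclidean_space (mdim M)) (chart M i ` (cdom M i \<inter> f -` W))"
    by (rule chart_open_sub[OF M _ i]) auto
qed

lemma smooth_mapD:
  "smooth_map M N f \<Longrightarrow> i \<in> idx M \<Longrightarrow> j \<in> idx N \<Longrightarrow>
    smooth_between (mdim M) (mdim N) (chart M i ` (cdom M i \<inter> f -` cdom N j)) (local_rep M i N j f)"
  unfolding smooth_map_def by blast

lemma smooth_map_compose: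
  assumes M: "atlas M" and N: "atlas N" and P: "atlas P"
    and f: "smooth_map M N f" and g: "smooth_map N P g"
  shows "smooth_map M P (g \<circ> f)"
proof (rule smooth_mapI[OF M P])
  fix p assume p: "p \<in> pts M"
  obtain i where i: "i \<in> idx M" "p \<in> cdom M i" using pts_cdom[OF M p] by blast
  have fp: "f p \<in> pts N" by (rule smooth_map_in[OF M N f p])
  obtain j where j: "j \<in> idx N" "f p \<in> cdom N j" using pts_cdom[OF N fp] by blast
  obtain k where k: "k \<in> idx P" "g (f p) \<in> cdom P k"
    using pts_cdom[OF P smooth_map_in[OF N P g fp]] by blast
  let ?W = "cdom N j \<inter> g -` cdom P k"
  let ?U = "cdom M i \<inter> f -` ?W"
  have W: "openin (mtop N) ?W" "openin (Euclidean_space (mdim N)) (chart N j ` ?W)"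
    by (rule smooth_map_open_chart[OF N g cdom_open[OF P k(1)] j(1)])+
  have U: "openin (mtop M) ?U" "openin (Euclidean_space (mdim M)) (chart M i ` ?U)"
    by (rule smooth_map_open_chart[OF M f W(1) i(1)])+
  have sm: "smooth_between (mdim M) (mdim P) (chart M i ` ?U) (\<lambda>x. local_rep N j P k g (local_rep M i N j f x))"
  proof (rule smooth_between_compose[OF U(2) W(2), where G = "local_rep N j P k g"])
    show "smooth_between (mdim N) (mdim P) (chart N j ` ?W) (local_rep N j P k g)"
      by (rule smooth_mapD[OF g j(1) k(1)])
    show "smooth_between (mdim M) (mdim N) (chart M i ` ?U) (local_rep M i N j f)"
      by (rule smooth_between_subset[OF smooth_mapD[OF f i(1) j(1)]]) auto
    show "local_rep M i N j f x \<in> chart N j ` ?W" if "x \<in> chart M i ` ?U" for x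
    proof -
      have "param M i x \<in> ?U" by (rule param_in[OF M i(1) that]) blast
      then show ?thesis by blast
    qed
  qed
  have "smooth_between (mdim M) (mdim P) (chart M i ` ?U) (local_rep M i P k (g \<circ> f))"
  proof (rule smooth_between_cong[OF U(2) sm])
    fix x a assume "x \<in> chart M i ` ?U"
    then have "param M i x \<in> ?U" by (rule param_in[OF M i(1)]) blast
    then have "f (param M i x) \<in> ?W" by blast
    then show "local_rep M i P k (g \<circ> f) x a = local_rep N j P k g (local_rep M i N j f x) a"
      using param_chart[OF N j(1)] by simp
  qed
  then show "\<exists>i\<in>idx M. \<exists>j\<in>idx P. \<exists>U. openin (mtop M) U \<and> p \<in> U \<and> U \<subseteq> cdom M i \<and>
      (g \<circ> f) ` U \<subseteq> cdom P j \<and> smooth_between (mdim M) (mdim P) (chart M i ` U) (local_rep M i P j (g \<circ> f))"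
    using i j k U(1) by (intro bexI[of _ i] bexI[of _ k] exI[of _ ?U]) auto
qed

lemma smooth_map_cong:
  assumes M: "atlas M" and N: "atlas N" and f: "smooth_map M N f"
    and eq: "\<And>p. p \<in> pts M \<Longrightarrow> g p = f p"
  shows "smooth_map M N g"
proof (rule smooth_mapI[OF M N])
  fix p assume p: "p \<in> pts M"
  obtain i where i: "i \<in> idx M" "p \<in> cdom M i" using pts_cdom[OF M p] by blast
  have fp: "f p \<in> pts N" by (rule smooth_map_in[OF M N f p])
  obtain j where j: "j \<in> idx N" "f p \<in> cdom N j" using pts_cdom[OF N fp] by blast
  let ?U = "cdom M i \<inter> f -` cdom N j"
  have U: "openin (mtop M) ?U" "openin (Euclidean_space (mdim M)) (chart M i ` ?U)"
    by (rule smooth_map_open_chart[OF M f cdom_open[OF N j(1)] i(1)])+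
  have "smooth_between (mdim M) (mdim N) (chart M i ` ?U) (local_rep M i N j g)"
  proof (rule smooth_between_cong[OF U(2) smooth_mapD[OF f i(1) j(1)]])
    fix x a assume "x \<in> chart M i ` ?U"
    then have "param M i x \<in> ?U" by (rule param_in[OF M i(1)]) blast
    then have "param M i x \<in> pts M" using cdom_pts[OF M i(1)] by blast
    then show "local_rep M i N j g x a = local_rep M i N j f x a" by (simp add: eq)
  qed
  moreover have "g ` ?U \<subseteq> cdom N j" using eq cdom_pts[OF M i(1)] by auto
  ultimately show "\<exists>i\<in>idx M. \<exists>j\<in>idx N. \<exists>U. openin (mtop M) U \<and> p \<in> U \<and>
       U \<subseteq> cdom M i \<and> g ` U \<subseteq> cdom N j \<and> smooth_between (mdim M) (mdim N) (chart M i ` U) (local_rep M i N j g)"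
    using i j U(1) by (intro bexI[of _ i] bexI[of _ j] exI[of _ ?U]) auto
qed

lemma smooth_map_id: 
  assumes M: "atlas M" shows "smooth_map M M id"
proof (rule smooth_mapI[OF M M])
  fix p assume "p \<in> pts M"
  then obtain i where i: "i \<in> idx M" "p \<in> cdom M i" using pts_cdom[OF M] by blast
  have "smooth_between (mdim M) (mdim M) (chart M i ` cdom M i) (local_rep M i M i id)"
    using overlap_smooth[OF M i(1) i(1)] by simp
  then show "\<exists>i\<in>idx M. \<exists>j\<in>idx M. \<exists>U. openin (mtop M) U \<and> p \<in> U \<and>
       U \<subseteq> cdom M i \<and> id ` U \<subseteq> cdom M j \<and> smooth_between (mdim M) (mdim M) (chart M i ` U) (local_rep M i M j id)"
    using i cdom_open[OF M i(1)] by (intro bexI[of _ i] exI[of _ "cdom M i"]) auto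
qed

text \<open>With \<open>id\<close> for one of the two maps this is the change-of-chart law for
  Jacobians, on which the well-definedness of tangent vectors and tangent maps rests.\<close>

lemma jacobian_compose_maps:
  assumes M: "atlas M" and N: "atlas N" and P: "atlas P"
    and f: "smooth_map M N f" and g: "smooth_map N P g"
    and i: "i \<in> idx M" "p \<in> cdom M i" and j: "j \<in> idx N" "f p \<in> cdom N j"
    and k: "k \<in> idx P" "g (f p) \<in> cdom P k" and a: "a < mdim P" and b: "b < mdim M"
  shows "jacobian M i P k (g \<circ> f) p a b =
    (\<Sum>c<mdim N. jacobian N j P k g (f p) a c * jacobian M i N j f p c b)"
proof -
  let ?W = "cdom N j \<inter> g -` cdom P k"
  let ?U = "cdom M i \<inter> f -` ?W"
  have W: "openin (mtop N) ?W" "openin (Euclidean_space (mdim N)) (chart N j ` ?W)"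
    by (rule smooth_map_open_chart[OF N g cdom_open[OF P k(1)] j(1)])+
  have U: "openin (mtop M) ?U" "openin (Euclidean_space (mdim M)) (chart M i ` ?U)"
    by (rule smooth_map_open_chart[OF M f W(1) i(1)])+
  have x: "chart M i p \<in> chart M i ` ?U" using i j k by auto
  have "jacobian M i P k (g \<circ> f) p a b =
     partial b (\<lambda>x. local_rep N j P k g (local_rep M i N j f x) a) (chart M i p)"
    unfolding jacobian_def
  proof (rule partial_cong(1)[OF U(2) x b])
    fix y assume "y \<in> chart M i ` ?U"
    then have "param M i y \<in> ?U" by (rule param_in[OF M i(1)]) blast
    then have "f (param M i y) \<in> ?W" by blast
    then show "chart P k ((g \<circ> f) (param M i y)) a = local_rep N j P k g (local_rep M i N j f y) a"
      using param_chart[OF N j(1)] by simp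
  qed
  also have "\<dots> = (\<Sum>c<mdim N. partial c (\<lambda>x. local_rep N j P k g x a) (local_rep M i N j f (chart M i p)) *
      partial b (\<lambda>x. local_rep M i N j f x c) (chart M i p))"
  proof (rule jacobian_compose[OF U(2) W(2) _ _ _ x b])
    show "local_rep M i N j f x \<in> chart N j ` ?W" if "x \<in> chart M i ` ?U" for x
    proof -
      have "param M i x \<in> ?U" by (rule param_in[OF M i(1) that]) blast
      then show ?thesis by blast
    qed
    show "smooth_between (mdim M) (mdim N) (chart M i ` ?U) (local_rep M i N j f)"
      by (rule smooth_between_subset[OF smooth_mapD[OF f i(1) j(1)]]) auto
    show "smooth_fun (mdim N) (chart N j ` ?W) (\<lambda>x. local_rep N j P k g x a)"
      using smooth_mapD[OF g j(1) k(1)] a by (simp add: smooth_between_iff)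
  qed
  finally show ?thesis unfolding jacobian_def using param_chart[OF M i] by simp
qed

lemma jacobian_cong:
  assumes M: "atlas M" and i: "i \<in> idx M" "p \<in> cdom M i" and b: "b < mdim M"
    and U: "openin (mtop M) U" "p \<in> U" and eq: "\<And>q. q \<in> U \<Longrightarrow> f q = g q"
  shows "jacobian M i N j f p a b = jacobian M i N j g p a b"
  unfolding jacobian_def
proof (rule partial_cong(1)[OF chart_open[OF M U(1) i(1)] _ b])
  show "chart M i p \<in> chart M i ` (U \<inter> cdom M i)" using U i by auto
  fix y assume "y \<in> chart M i ` (U \<inter> cdom M i)"
  then have "param M i y \<in> U \<inter> cdom M i" by (rule param_in[OF M i(1)]) blast
  then show "chart N j (f (param M i y)) a = chart N j (g (param M i y)) a" using eq by simp
qed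

text \<open>If a component of \<open>f\<close> is a coordinate function of the source, its row of
  the Jacobian is a unit vector. This applies to all bundle projections, which only select and
  renumber coordinates.\<close>

lemma jacobian_coord:
  assumes M: "atlas M" and i: "i \<in> idx M" "p \<in> cdom M i" and b: "b < mdim M"
    and U: "openin (mtop M) U" "p \<in> U" and eq: "\<And>q. q \<in> U \<Longrightarrow> q \<in> cdom M i \<Longrightarrow> chart N j (f q) a = chart M i q c"
  shows "jacobian M i N j f p a b = (if c = b then 1 else 0)"
proof -
  have "jacobian M i N j f p a b = partial b (\<lambda>x. x c) (chart M i p)"
    unfolding jacobian_def
  proof (rule partial_cong(1)[OF chart_open[OF M U(1) i(1)] _ b])
    show "chart M i p \<in> chart M i ` (U \<inter> cdom M i)" using U i by auto
    fix y assume y: "y \<in> chart M i ` (U \<inter> cdom M i)"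
    then have "param M i y \<in> U \<inter> cdom M i" by (rule param_in[OF M i(1)]) blast
    then show "chart N j (f (param M i y)) a = y c"
      using eq chart_param[OF M i(1), of y] y by auto
  qed
  then show ?thesis by (simp add: partial_coord)
qed

lemma jacobian_id:
  assumes M: "atlas M" and i: "i \<in> idx M" "p \<in> cdom M i" and b: "b < mdim M"
  shows "jacobian M i M i id p a b = (if a = b then 1 else 0)"
  using jacobian_coord[OF M i b pts_open[OF M], of M i id a a] cdom_pts[OF M i] by simp

lemma jacobian_smooth_fun:
  assumes "smooth_map M N f" "i \<in> idx M" "j \<in> idx N" "a < mdim N" "b < mdim M"
  shows "smooth_fun (mdim M) (chart M i ` (cdom M i \<inter> f -` cdom N j)) (partial b (\<lambda>x. local_rep M i N j f x a))"
  using smooth_mapD[OF assms(1-3)] assms(4,5) by (auto simp: smooth_between_iff intro: smooth_fun_partial)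

section \<open>Second countability and countable families of charts\<close>

lemma second_countable_coords: "second_countable (Euclidean_space m)"
proof -
  obtain B :: "(nat \<Rightarrow> real) set set" where "countable B" "\<And>C. C \<in> B \<Longrightarrow> open C"
    "\<And>S. open S \<Longrightarrow> \<exists>U. U \<subseteq> B \<and> S = \<Union>U"
    by (rule univ_second_countable) blast
  then have "second_countable (euclidean :: (nat \<Rightarrow> real) topology)"
    unfolding second_countable_def by (intro exI[of _ B]) (fastforce)
  then show ?thesis by (simp add: Euclidean_space_eq second_countable_subtopology)
qed

text \<open>However large the atlas is, countably many charts that cover suffice: pull a countable
  base of the coordinate space back through each of them.\<close>

lemma second_countable_mtopI:
  assumes M: "atlas M" and J: "J \<subseteq> idx M" "countable J" and cov: "pts M \<subseteq> (\<Union>i\<in>J. cdom M i)"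
  shows "second_countable (mtop M)"
proof -
  obtain B where B: "countable B" "\<And>V. V \<in> B \<Longrightarrow> openin (Euclidean_space (mdim M)) V"
    "\<And>U x. openin (Euclidean_space (mdim M)) U \<Longrightarrow> x \<in> U \<Longrightarrow> \<exists>V\<in>B. x \<in> V \<and> V \<subseteq> U"
    using second_countable_coords[of "mdim M"] unfolding second_countable_def by auto
  let ?C = "(\<lambda>(j, V). param M j ` (V \<inter> chart M j ` cdom M j)) ` (J \<times> B)"
  have c1: "countable ?C" using B(1) J(2) by simp
  have c2: "openin (mtop M) W" if W: "W \<in> ?C" for W
    using W J B(2) chart_image_open[OF M] by (auto intro!: param_open[OF M])
  have c3: "\<exists>V\<in>?C. p \<in> V \<and> V \<subseteq> U" if U: "openin (mtop M) U" "p \<in> U" for U p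
  proof -
    have "p \<in> pts M" using U openin_mtop_iff[OF M] by blast
    then obtain j where j: "j \<in> J" "p \<in> cdom M j" using cov by blast
    then have jM: "j \<in> idx M" using J by auto
    obtain V where V: "V \<in> B" "chart M j p \<in> V" "V \<subseteq> chart M j ` (U \<inter> cdom M j)"
      using B(3)[OF chart_open[OF M U(1) jM], of "chart M j p"] U(2) j(2) by auto
    have "p \<in> param M j ` (V \<inter> chart M j ` cdom M j)"
      using V j param_chart[OF M jM j(2)] by (intro image_eqI[of _ _ "chart M j p"]) auto
    moreover have "param M j ` (V \<inter> chart M j ` cdom M j) \<subseteq> U"
      using V(3) param_chart[OF M jM] by (auto simp: subset_iff image_iff)
    ultimately show ?thesis using j(1) V(1) by (intro bexI[of _ "param M j ` (V \<inter> chart M j ` cdom M j)"]) auto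
  qed
  show ?thesis unfolding second_countable_def
  proof (intro exI[of _ ?C] conjI ballI allI impI c1)
    show "openin (mtop M) V" if "V \<in> ?C" for V using c2[OF that] .
    show "\<exists>V\<in>?C. p \<in> V \<and> V \<subseteq> U" if "openin (mtop M) U \<and> p \<in> U" for U p
      using c3 that by simp
  qed
qed

text \<open>Second countability makes the space Lindelof, so the cover by chart domains has a
  countable subcover.\<close>

lemma countable_charts:
  assumes "manifold M"
  obtains J where "J \<subseteq> idx M" "countable J" "pts M = (\<Union>i\<in>J. cdom M i)"
proof -
  have M: "atlas M" using assms by (rule manifold_atlas)
  have "Lindelof_space (mtop M)"
    using assms by (simp add: manifold_iff second_countable_imp_Lindelof_space)
  moreover have "\<And>U. U \<in> cdom M ` idx M \<Longrightarrow> openin (mtop M) U" using cdom_open[OF M] by blast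
  moreover have "\<Union>(cdom M ` idx M) = topspace (mtop M)"
    using M by (simp add: topspace_mtop[OF M] atlas_def)
  ultimately have "\<exists>V. countable V \<and> V \<subseteq> cdom M ` idx M \<and> \<Union>V = topspace (mtop M)"
    by (rule Lindelof_spaceD)
  then obtain V where V: "countable V" "V \<subseteq> cdom M ` idx M" "\<Union>V = pts M"
    by (auto simp: topspace_mtop[OF M])
  then obtain J where "J \<subseteq> idx M" "countable J" "V = cdom M ` J"
    using countable_subset_image[of V "cdom M" "idx M"] by auto
  with V(3) show ?thesis using that[of J] by auto
qed

section \<open>Curves\<close>

definition line_point :: "real \<Rightarrow> nat \<Rightarrow> real" where
  "line_point t = (\<lambda>a. if a = 0 then t else 0)"

lemma line_point_0 [simp]: "line_point t 0 = t" by (simp add: line_point_def)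

lemma coords_1: "x \<in> coords 1 \<longleftrightarrow> x = line_point (x 0)"
  by (auto simp: coords_def line_point_def fun_eq_iff)

lemma inj_line_point: "inj_on line_point A"
  by (metis line_point_0 inj_onI)

lemma openin_line_point: "openin (Euclidean_space 1) (line_point ` J) \<longleftrightarrow> open J"
proof -
  have 1: "line_point ` J \<subseteq> coords 1" by (auto simp: coords_def line_point_def)
  have 2: "y \<in> line_point ` J \<longleftrightarrow> y 0 \<in> J" if "y \<in> coords 1" for y
    using that by (metis coords_1 line_point_0 image_iff)
  have 3: "(\<forall>y\<in>coords 1. P (y 0)) \<longleftrightarrow> (\<forall>t. P t)" for P :: "real \<Rightarrow> bool"
    by (metis coords_1 line_point_0)
  show ?thesis
    unfolding openin_coords_iff open_dist dist_real_def
    using 1 3[of "\<lambda>t. \<bar>t - _\<bar> < _ \<longrightarrow> t \<in> J"] by (simp add: 2 less_Suc_eq del: One_nat_def)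
qed

lemma interval_sel [simp]:
  "mdim (interval_mfd I) = 1" "pts (interval_mfd I) = I" "idx (interval_mfd I) = UNIV"
  "cdom (interval_mfd I) u = I" "chart (interval_mfd I) u = line_point"
  by (simp_all add: interval_mfd_def line_point_def fun_eq_iff)

lemma param_interval: "t \<in> I \<Longrightarrow> param (interval_mfd I) u (line_point t) = t"
  unfolding param_def by (simp add: the_inv_into_f_f[OF inj_line_point])

lemma mtop_interval:
  assumes "open I" shows "mtop (interval_mfd I) = top_of_set I"
proof -
  have "openin (mtop (interval_mfd I)) U \<longleftrightarrow> openin (top_of_set I) U" for U
    using assms by (subst openin_mtop)
      (auto simp: inj_line_point openin_line_point[unfolded One_nat_def] openin_open_eq Int_absorb2)
  then show ?thesis by (simp add: topology_eq)
qed

lemma interval_atlas: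
  assumes "open I" shows "atlas (interval_mfd I)"
proof -
  have "smooth_fun 1 (line_point ` I) (\<lambda>x. line_point (param (interval_mfd I) i x) a)" if "a < 1" for i a
    by (rule smooth_fun_cong[of _ _ "\<lambda>x. x a"])
       (use that assms in \<open>auto simp: param_interval openin_line_point[unfolded One_nat_def] smooth_fun_coord\<close>)
  then show ?thesis
    unfolding atlas_def using assms
    by (auto simp: inj_line_point openin_line_point[unfolded One_nat_def] smooth_between_iff)
qed

lemma partial_line_point [simp]: "partial 0 (\<lambda>x. g (x 0)) = (\<lambda>x. deriv g (x 0))"
  by (rule ext) (simp add: partial_def)

text \<open>In dimension one \<open>partial 0\<close> is \<open>deriv\<close>, so the recursion of
  \<open>C_k\<close> runs through the iterated derivatives, and differentiability of each includes
  the required continuity. Smoothness of curves can henceforth be discussed with ordinary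
  derivatives.\<close>

lemma smooth_fun_line_point:
  assumes J: "open J"
  shows "smooth_fun 1 (line_point ` J) (\<lambda>x. g (x 0)) \<longleftrightarrow> (\<forall>l. \<forall>t\<in>J. (deriv ^^ l) g differentiable (at t))" (is "?L \<longleftrightarrow> ?R")
proof
  assume L: ?L
  have "smooth_fun 1 (line_point ` J) (\<lambda>x. (deriv ^^ l) g (x 0))" for l
  proof (induction l)
    case (Suc l)
    have "smooth_fun 1 (line_point ` J) (partial 0 (\<lambda>x. (deriv ^^ l) g (x 0)))" by (rule smooth_fun_partial[OF Suc]) simp
    then show ?case by (simp only: partial_line_point funpow.simps o_apply)
  qed (use L in simp)
  then have "pdiff 0 (\<lambda>x. (deriv ^^ l) g (x 0)) (line_point t)" if "t \<in> J" for l t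
    by (rule smooth_fun_pdiff) (use that in auto)
  then show ?R by simp
next
  have "C_k k 1 (line_point ` J) (\<lambda>x. g (x 0))" if "\<forall>l. \<forall>t\<in>J. (deriv ^^ l) g differentiable (at t)" for k
    using that
  proof (induction k arbitrary: g)
    have co: "cont_on 1 (line_point ` J) (\<lambda>x. g (x 0))" if g: "\<forall>l. \<forall>t\<in>J. (deriv ^^ l) g differentiable (at t)" for g :: "real \<Rightarrow> real"
    proof -
      have "g differentiable (at t)" if "t \<in> J" for t using g[rule_format, of t 0] that by simp
      then have "continuous_on J g"
        by (intro continuous_at_imp_continuous_on ballI differentiable_imp_continuous_within)
      then have 1: "continuous_map (top_of_set J) euclideanreal g" by simp
      have "continuous_map (subtopology (Euclidean_space 1) (line_point ` J)) (top_of_set J) (\<lambda>x. x 0)"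
        using cont_on_coord[of 1 "line_point ` J" 0] by (auto simp: continuous_map_in_subtopology)
      from continuous_map_compose[OF this 1] show ?thesis by (simp add: comp_def)
    qed
    {
      case 0
      then show ?case using co by simp
    next
      case (Suc k)
      have "\<forall>l. \<forall>t\<in>J. (deriv ^^ l) (deriv g) differentiable (at t)"
      proof
        fix l
        show "\<forall>t\<in>J. (deriv ^^ l) (deriv g) differentiable (at t)"
          using Suc.prems[rule_format, of _ "Suc l"] by (simp only: funpow_Suc_right o_apply) blast
      qed
      from Suc.IH[OF this] have "C_k k 1 (line_point ` J) (partial 0 (\<lambda>x. g (x 0)))"
        by (simp only: partial_line_point)
      moreover have "\<forall>t\<in>J. g differentiable (at t)" using Suc.prems[rule_format, of _ 0] by simp
      ultimately show ?case using co[OF Suc.prems] by simp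
    }
  qed
  then show "?R \<Longrightarrow> ?L" unfolding smooth_fun_def by blast
qed

lemma curve_in:
  "open I \<Longrightarrow> atlas M \<Longrightarrow> smooth_map (interval_mfd I) M \<gamma> \<Longrightarrow> t \<in> I \<Longrightarrow> \<gamma> t \<in> pts M"
  using smooth_map_in[OF interval_atlas] by fastforce

lemma curve_open:
  assumes "open I" "smooth_map (interval_mfd I) M \<gamma>" "openin (mtop M) W"
  shows "open {t \<in> I. \<gamma> t \<in> W}"
  using smooth_map_open[OF interval_atlas[OF assms(1)] assms(2,3)] assms(1)
  by (auto simp: mtop_interval openin_open_eq)

lemma curve_smooth:
  assumes I: "open I" and M: "atlas M" and g: "smooth_map (interval_mfd I) M \<gamma>"
    and t: "t \<in> I" and j: "j \<in> idx M" "\<gamma> t \<in> cdom M j" and a: "a < mdim M"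
  shows "(deriv ^^ l) (\<lambda>s. chart M j (\<gamma> s) a) differentiable (at t)"
proof -
  let ?J = "I \<inter> \<gamma> -` cdom M j"
  have "?J = {t \<in> I. \<gamma> t \<in> cdom M j}" by auto
  then have J: "open ?J" using curve_open[OF I g cdom_open[OF M j(1)]] by simp
  have "smooth_between 1 (mdim M) (line_point ` ?J) (local_rep (interval_mfd I) () M j \<gamma>)"
    using smooth_mapD[OF g, of "()" j] j by simp
  then have "smooth_fun 1 (line_point ` ?J) (\<lambda>x. local_rep (interval_mfd I) () M j \<gamma> x a)"
    using a by (simp add: smooth_between_iff)
  then have "smooth_fun 1 (line_point ` ?J) (\<lambda>x. chart M j (\<gamma> (x 0)) a)"
    by (rule smooth_fun_cong[rotated]) (use J in \<open>auto simp: openin_line_point[unfolded One_nat_def] param_interval\<close>)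
  then show ?thesis using smooth_fun_line_point[OF J, of "\<lambda>s. chart M j (\<gamma> s) a"] t j by auto
qed

lemma curve_smoothI:
  assumes I: "open I" and M: "atlas M"
    and loc: "\<And>t. t \<in> I \<Longrightarrow> \<exists>j\<in>idx M. \<exists>J. open J \<and> t \<in> J \<and> J \<subseteq> I \<and> \<gamma> ` J \<subseteq> cdom M j \<and>
      (\<forall>a<mdim M. \<forall>l. \<forall>s\<in>J. (deriv ^^ l) (\<lambda>s. chart M j (\<gamma> s) a) differentiable (at s))"
  shows "smooth_map (interval_mfd I) M \<gamma>"
proof (rule smooth_mapI[OF interval_atlas[OF I] M])
  fix t assume "t \<in> pts (interval_mfd I)"
  then have "t \<in> I" by simp
  from loc[OF this] obtain j J where J: "j \<in> idx M" "open J" "t \<in> J" "J \<subseteq> I" "\<gamma> ` J \<subseteq> cdom M j"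
    "\<forall>a<mdim M. \<forall>l. \<forall>s\<in>J. (deriv ^^ l) (\<lambda>s. chart M j (\<gamma> s) a) differentiable (at s)"
    by blast
  have "smooth_fun 1 (line_point ` J) (\<lambda>x. local_rep (interval_mfd I) () M j \<gamma> x a)" if "a < mdim M" for a
  proof (rule smooth_fun_cong)
    show "openin (Euclidean_space 1) (line_point ` J)" using J by (simp add: openin_line_point[unfolded One_nat_def])
    show "smooth_fun 1 (line_point ` J) (\<lambda>x. chart M j (\<gamma> (x 0)) a)"
      using smooth_fun_line_point[OF J(2), of "\<lambda>s. chart M j (\<gamma> s) a"] J(6) that by auto
  qed (use J in \<open>auto simp: param_interval subset_iff\<close>)
  then have "smooth_between 1 (mdim M) (line_point ` J) (local_rep (interval_mfd I) () M j \<gamma>)"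
    by (simp add: smooth_between_iff)
  then show "\<exists>i\<in>idx (interval_mfd I). \<exists>j\<in>idx M. \<exists>U. openin (mtop (interval_mfd I)) U \<and> t \<in> U \<and>
       U \<subseteq> cdom (interval_mfd I) i \<and> \<gamma> ` U \<subseteq> cdom M j \<and>
       smooth_between (mdim (interval_mfd I)) (mdim M) (chart (interval_mfd I) i ` U) (local_rep (interval_mfd I) i M j \<gamma>)"
    using J I by (intro bexI[of _ "()"] bexI[of _ j] exI[of _ J]) (auto simp: mtop_interval openin_open_eq)
qed

lemma curve_smooth_deriv:
  assumes "open I" "atlas M" "smooth_map (interval_mfd I) M \<gamma>"
    and "t \<in> I" "j \<in> idx M" "\<gamma> t \<in> cdom M j" "a < mdim M"
  shows "((\<lambda>s. chart M j (\<gamma> s) a) has_field_derivative deriv (\<lambda>s. chart M j (\<gamma> s) a) t) (at t)"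
  using curve_smooth[OF assms, of 0] by (simp add: DERIV_deriv_iff_real_differentiable)

lemma curve_chain_rule:
  assumes I: "open I" and M: "atlas M" and N: "atlas N" and g: "smooth_map (interval_mfd I) M \<gamma>"
    and f: "smooth_map M N f"
    and t: "t \<in> I" and i: "i \<in> idx M" "\<gamma> t \<in> cdom M i" and j: "j \<in> idx N" "f (\<gamma> t) \<in> cdom N j"
    and a: "a < mdim N"
  shows "deriv (\<lambda>s. chart N j (f (\<gamma> s)) a) t =
    (\<Sum>b<mdim M. jacobian M i N j f (\<gamma> t) a b * deriv (\<lambda>s. chart M i (\<gamma> s) b) t)"
proof -
  let ?J = "{t \<in> I. \<gamma> t \<in> cdom M i}"
  have J: "open ?J" by (rule curve_open[OF I g cdom_open[OF M i(1)]])
  have ev: "\<forall>\<^sub>F s in nhds t. s \<in> ?J" by (rule eventually_nhds_in_open[OF J]) (use t i in simp)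
  let ?U = "cdom M i \<inter> f -` cdom N j"
  have U: "openin (Euclidean_space (mdim M)) (chart M i ` ?U)"
    by (rule smooth_map_open_chart(2)[OF M f cdom_open[OF N j(1)] i(1)])
  have "((\<lambda>s. local_rep M i N j f (chart M i (\<gamma> s)) a) has_field_derivative
     (\<Sum>b<mdim M. partial b (\<lambda>x. local_rep M i N j f x a) (chart M i (\<gamma> t)) * deriv (\<lambda>s. chart M i (\<gamma> s) b) t)) (at t)"
  proof (rule chain_rule[OF U])
    show "C_k (Suc 0) (mdim M) (chart M i ` ?U) (\<lambda>x. local_rep M i N j f x a)"
      by (rule smooth_fun_C1) (use smooth_mapD[OF f i(1) j(1)] a in \<open>simp add: smooth_between_iff\<close>)
    show "\<forall>\<^sub>F t in nhds t. chart M i (\<gamma> t) \<in> coords (mdim M)"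
      using ev by eventually_elim (use chart_coords[OF M i(1)] in auto)
  qed (use curve_smooth_deriv[OF I M g t i] i j in auto)
  then have "deriv (\<lambda>s. local_rep M i N j f (chart M i (\<gamma> s)) a) t =
     (\<Sum>b<mdim M. jacobian M i N j f (\<gamma> t) a b * deriv (\<lambda>s. chart M i (\<gamma> s) b) t)"
    unfolding jacobian_def by (rule DERIV_imp_deriv)
  moreover have "deriv (\<lambda>s. local_rep M i N j f (chart M i (\<gamma> s)) a) t = deriv (\<lambda>s. chart N j (f (\<gamma> s)) a) t"
  proof (rule deriv_cong_ev[OF _ refl])
    show "\<forall>\<^sub>F s in nhds t. local_rep M i N j f (chart M i (\<gamma> s)) a = chart N j (f (\<gamma> s)) a"
      using ev by eventually_elim (use param_chart[OF M i(1)] in auto)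
  qed
  ultimately show ?thesis by simp
qed

section \<open>The tangent functor\<close>

text \<open>In the charts of \<open>TB M\<close> this is the bundle projection.\<close>

definition truncate :: "nat \<Rightarrow> (nat \<Rightarrow> real) \<Rightarrow> nat \<Rightarrow> real" where
  "truncate m x = (\<lambda>a. if a < m then x a else 0)"

lemma truncate_coords: "truncate m x \<in> coords m"
  by (auto simp: truncate_def coords_def)

lemma smooth_truncate: "smooth_between n m S (truncate m)"
  by (auto simp: smooth_between_iff truncate_def smooth_fun_coord smooth_fun_const)

lemma openin_coords_UNIV: "openin (Euclidean_space n) (coords n)"
  by (metis openin_topspace topspace_coords)

lemma openin_truncate:
  assumes "openin (Euclidean_space m) S"
  shows "openin (Euclidean_space n) {x \<in> coords n. truncate m x \<in> S}"
  by (rule openin_preimage_smooth_between[OF openin_coords_UNIV smooth_truncate truncate_coords assms])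

lemma matvec_assoc:
  fixes A :: "nat \<Rightarrow> real"
  shows "(\<Sum>c<n. A c * (\<Sum>b<m. B c b * u b)) = (\<Sum>b<m. (\<Sum>c<n. A c * B c b) * u b)"
proof -
  have "(\<Sum>c<n. A c * (\<Sum>b<m. B c b * u b)) = (\<Sum>c<n. \<Sum>b<m. A c * B c b * u b)"
    by (simp add: sum_distrib_left mult.assoc)
  also have "\<dots> = (\<Sum>b<m. \<Sum>c<n. A c * B c b * u b)" by (rule sum.swap)
  finally show ?thesis by (simp add: sum_distrib_right)
qed

lemma TB_sel [simp]: "mdim (TB M) = 2 * mdim M" "idx (TB M) = idx M"
  by (simp_all add: TB_def)

lemma TB_pts: "v \<in> pts (TB M) \<longleftrightarrow> (\<exists>p \<xi>. v = Vec p \<xi> \<and> tangent_at M p \<xi>)"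
  by (auto simp: TB_def)

lemma TB_cdom: "v \<in> cdom (TB M) i \<longleftrightarrow> v \<in> pts (TB M) \<and> foot v \<in> cdom M i"
  by (auto simp: TB_def)

lemma TB_chart:
  "chart (TB M) i v a = (if a < mdim M then chart M i (foot v) a else components v i (a - mdim M))"
  by (simp add: TB_def)

lemma TB_foot: "v \<in> pts (TB M) \<Longrightarrow> foot v \<in> pts M"
  by (auto simp: TB_pts tangent_at_def)

lemma TB_components_0:
  "v \<in> pts (TB M) \<Longrightarrow> \<not> (i \<in> idx M \<and> foot v \<in> cdom M i \<and> a < mdim M) \<Longrightarrow> components v i a = 0"
  by (auto simp: TB_pts tangent_at_def)

lemma TB_change:
  assumes "v \<in> pts (TB M)" "i \<in> idx M" "j \<in> idx M" "foot v \<in> cdom M i" "foot v \<in> cdom M j" "a < mdim M"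
  shows "components v j a = (\<Sum>b<mdim M. jacobian M i M j id (foot v) a b * components v i b)"
  using assms by (auto simp: TB_pts tangent_at_def)

text \<open>A vector carries its components in all charts at once. Those in a single chart determine
  the others by the transformation law, and the remaining entries are zero by convention.\<close>

lemma TB_eqI:
  assumes v: "v \<in> pts (TB M)" and w: "w \<in> pts (TB M)" and f: "foot v = foot w"
    and i: "i \<in> idx M" "foot v \<in> cdom M i" and eq: "\<And>a. a < mdim M \<Longrightarrow> components v i a = components w i a"
  shows "v = w"
proof -
  have "components v j a = components w j a" for j a
  proof (cases "j \<in> idx M \<and> foot v \<in> cdom M j \<and> a < mdim M")
    case True
    then show ?thesis
      using TB_change[OF v i(1) _ i(2), of j a] TB_change[OF w i(1), of j a] i f eq by simp
  next
    case False
    then show ?thesis using TB_components_0[OF v False] TB_components_0[OF w] f by simp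
  qed
  then have "components v = components w" by auto
  then show ?thesis using v w f by (auto simp: TB_pts)
qed

section \<open>Tangent maps\<close>

text \<open>The differential of \<open>f\<close> at \<open>p\<close> applied to the vector with
  components \<open>u\<close> in the chart \<open>i\<close>. In contrast to \<open>Tmap\<close> the
  chart is a parameter, not a choice by \<open>SOME\<close>. Since \<open>u\<close> is arbitrary,
  the case \<open>f = id\<close> also constructs the tangent vector with prescribed
  components.\<close>

definition push_vector ::
    "('a, 'i) manif \<Rightarrow> 'i \<Rightarrow> ('a, 'i) manif \<Rightarrow> (('a, 'i) pt \<Rightarrow> ('a, 'i) pt) \<Rightarrow> ('a, 'i) pt \<Rightarrow>
     (nat \<Rightarrow> real) \<Rightarrow> ('a, 'i) pt" where
  "push_vector M i N f p u = Vec (f p) (\<lambda>j a. if j \<in> idx N \<and> f p \<in> cdom N j \<and> a < mdim N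
     then \<Sum>b<mdim M. jacobian M i N j f p a b * u b else 0)"

lemma push_vector_foot [simp]: "foot (push_vector M i N f p u) = f p"
  by (simp add: push_vector_def)

lemma push_vector_components:
  "j \<in> idx N \<Longrightarrow> f p \<in> cdom N j \<Longrightarrow> a < mdim N \<Longrightarrow>
    components (push_vector M i N f p u) j a = (\<Sum>b<mdim M. jacobian M i N j f p a b * u b)"
  by (simp add: push_vector_def)

lemma push_vector_in:
  assumes M: "atlas M" and N: "atlas N" and f: "smooth_map M N f" and i: "i \<in> idx M" "p \<in> cdom M i"
  shows "push_vector M i N f p u \<in> pts (TB N)"
proof -
  have "f p \<in> pts N" by (rule smooth_map_in[OF M N f cdom_pts[OF M i]])
  moreover have "(\<Sum>b<mdim M. jacobian M i N k f p a b * u b) =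
     (\<Sum>c<mdim N. jacobian N j N k id (f p) a c * (\<Sum>b<mdim M. jacobian M i N j f p c b * u b))"
    if j: "j \<in> idx N" "f p \<in> cdom N j" and k: "k \<in> idx N" "f p \<in> cdom N k" and a: "a < mdim N" for j k a
    unfolding matvec_assoc
    using jacobian_compose_maps[OF M N N f smooth_map_id[OF N] i j, of k a] k a by simp
  ultimately have "tangent_at N (f p) (\<lambda>j a. if j \<in> idx N \<and> f p \<in> cdom N j \<and> a < mdim N
     then \<Sum>b<mdim M. jacobian M i N j f p a b * u b else 0)"
    unfolding tangent_at_def by (intro conjI allI impI ballI) (simp_all only: if_True if_False simp_thms, simp)
  then show ?thesis unfolding TB_pts push_vector_def by blast
qed

text \<open>Independence of the chart; it makes the choice of a chart in \<open>Tmap\<close>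
  harmless.\<close>

lemma push_vector_change:
  assumes M: "atlas M" and N: "atlas N" and f: "smooth_map M N f" and v: "v \<in> pts (TB M)"
    and i: "i \<in> idx M" "foot v \<in> cdom M i" and i': "i' \<in> idx M" "foot v \<in> cdom M i'"
  shows "push_vector M i' N f (foot v) (components v i') = push_vector M i N f (foot v) (components v i)"
proof -
  have "(\<Sum>c<mdim M. jacobian M i' N j f (foot v) a c * components v i' c) =
     (\<Sum>b<mdim M. jacobian M i N j f (foot v) a b * components v i b)"
    if j: "j \<in> idx N" "f (foot v) \<in> cdom N j" and a: "a < mdim N" for j a
  proof -
    have "(\<Sum>c<mdim M. jacobian M i' N j f (foot v) a c * components v i' c) =
      (\<Sum>c<mdim M. jacobian M i' N j f (foot v) a c *
         (\<Sum>b<mdim M. jacobian M i M i' id (foot v) c b * components v i b))"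
      using TB_change[OF v i(1) i'(1) i(2) i'(2)] by simp
    also have "\<dots> = (\<Sum>b<mdim M. jacobian M i N j f (foot v) a b * components v i b)"
      unfolding matvec_assoc
      using jacobian_compose_maps[OF M M N smooth_map_id[OF M] f i, of i' j a] i' j a by simp
    finally show ?thesis .
  qed
  then show ?thesis by (auto simp: push_vector_def intro!: ext)
qed

lemma Tmap_eq_push_vector:
  assumes M: "atlas M" and N: "atlas N" and f: "smooth_map M N f" and v: "v \<in> pts (TB M)"
    and i: "i \<in> idx M" "foot v \<in> cdom M i"
  shows "Tmap M N f v = push_vector M i N f (foot v) (components v i)"
proof -
  let ?i = "SOME i. i \<in> idx M \<and> foot v \<in> cdom M i"
  have "?i \<in> idx M \<and> foot v \<in> cdom M ?i" by (rule someI[of _ i]) (use i in simp)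
  then have "push_vector M ?i N f (foot v) (components v ?i) = push_vector M i N f (foot v) (components v i)"
    by (intro push_vector_change[OF M N f v i]) simp_all
  then show ?thesis unfolding Tmap_def Let_def push_vector_def by simp
qed

lemma Tmap_foot [simp]: "foot (Tmap M N f v) = f (foot v)"
  by (simp add: Tmap_def Let_def)

lemma Tmap_in:
  assumes M: "atlas M" and N: "atlas N" and f: "smooth_map M N f" and v: "v \<in> pts (TB M)"
  shows "Tmap M N f v \<in> pts (TB N)"
proof -
  obtain i where i: "i \<in> idx M" "foot v \<in> cdom M i" using pts_cdom[OF M TB_foot[OF v]] by blast
  show ?thesis unfolding Tmap_eq_push_vector[OF M N f v i] by (rule push_vector_in[OF M N f i])
qed

lemma Tmap_components:
  assumes M: "atlas M" and N: "atlas N" and f: "smooth_map M N f" and v: "v \<in> pts (TB M)"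
    and i: "i \<in> idx M" "foot v \<in> cdom M i" and j: "j \<in> idx N" "f (foot v) \<in> cdom N j" "a < mdim N"
  shows "components (Tmap M N f v) j a = (\<Sum>b<mdim M. jacobian M i N j f (foot v) a b * components v i b)"
  unfolding Tmap_eq_push_vector[OF M N f v i] by (rule push_vector_components[of j N f, OF j])

lemma Tmap_id:
  assumes M: "atlas M" and v: "v \<in> pts (TB M)"
  shows "Tmap M M id v = v"
proof -
  obtain i where i: "i \<in> idx M" "foot v \<in> cdom M i" using pts_cdom[OF M TB_foot[OF v]] by blast
  show ?thesis
  proof (rule TB_eqI[OF Tmap_in[OF M M smooth_map_id[OF M] v] v _ i(1)])
    fix a assume a: "a < mdim M"
    show "components (Tmap M M id v) i a = components v i a"
      using Tmap_components[OF M M smooth_map_id[OF M] v i i(1) _ a] TB_change[OF v i(1) i(1) i(2) i(2) a] i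
      by simp
  qed (use i in auto)
qed

lemma Tmap_compose:
  assumes M: "atlas M" and N: "atlas N" and P: "atlas P"
    and f: "smooth_map M N f" and g: "smooth_map N P g" and v: "v \<in> pts (TB M)"
  shows "Tmap M P (g \<circ> f) v = Tmap N P g (Tmap M N f v)"
proof -
  note gf = smooth_map_compose[OF M N P f g]
  obtain i where i: "i \<in> idx M" "foot v \<in> cdom M i" using pts_cdom[OF M TB_foot[OF v]] by blast
  have v': "Tmap M N f v \<in> pts (TB N)" by (rule Tmap_in[OF M N f v])
  obtain j where j: "j \<in> idx N" "f (foot v) \<in> cdom N j" using pts_cdom[OF N TB_foot[OF v']] by auto
  have v'': "Tmap N P g (Tmap M N f v) \<in> pts (TB P)" by (rule Tmap_in[OF N P g v'])
  obtain k where k: "k \<in> idx P" "g (f (foot v)) \<in> cdom P k" using pts_cdom[OF P TB_foot[OF v'']] by auto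
  show ?thesis
  proof (rule TB_eqI[OF Tmap_in[OF M P gf v] v'' _ k(1)])
    fix a assume a: "a < mdim P"
    have "components (Tmap N P g (Tmap M N f v)) k a =
       (\<Sum>c<mdim N. jacobian N j P k g (f (foot v)) a c * components (Tmap M N f v) j c)"
      using Tmap_components[OF N P g v' j(1) _ k(1) _ a] j k by simp
    also have "\<dots> = (\<Sum>c<mdim N. jacobian N j P k g (f (foot v)) a c *
       (\<Sum>b<mdim M. jacobian M i N j f (foot v) c b * components v i b))"
      using Tmap_components[OF M N f v i j] by simp
    also have "\<dots> = (\<Sum>b<mdim M. jacobian M i P k (g \<circ> f) (foot v) a b * components v i b)"
      unfolding matvec_assoc using jacobian_compose_maps[OF M N P f g i j k a] by simp
    also have "\<dots> = components (Tmap M P (g \<circ> f) v) k a"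
      using Tmap_components[OF M P gf v i k(1) _ a] k by simp
    finally show "components (Tmap M P (g \<circ> f) v) k a = components (Tmap N P g (Tmap M N f v)) k a" by simp
  qed (use k in auto)
qed

text \<open>Outside \<open>pts M\<close> the two functions may differ, but \<open>pts M\<close> is
  open, so equality on points passes to the Jacobians.\<close>

lemma Tmap_cong:
  assumes M: "atlas M" and N: "atlas N" and f: "smooth_map M N f" and v: "v \<in> pts (TB M)"
    and eq: "\<And>p. p \<in> pts M \<Longrightarrow> g p = f p"
  shows "Tmap M N g v = Tmap M N f v"
proof -
  have g: "smooth_map M N g" by (rule smooth_map_cong[OF M N f eq])
  obtain i where i: "i \<in> idx M" "foot v \<in> cdom M i" using pts_cdom[OF M TB_foot[OF v]] by blast
  have "g (foot v) = f (foot v)" using eq TB_foot[OF v] by blast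
  moreover have "jacobian M i N j g (foot v) a b = jacobian M i N j f (foot v) a b" if "b < mdim M" for j a b
    by (rule jacobian_cong[OF M i that pts_open[OF M] TB_foot[OF v]]) (rule eq)
  ultimately show ?thesis
    unfolding Tmap_eq_push_vector[OF M N f v i] Tmap_eq_push_vector[OF M N g v i] push_vector_def
    by (intro arg_cong2[of _ _ _ _ Vec] ext) auto
qed

section \<open>The tangent bundle as a manifold\<close>

lemma TB_chart_truncate:
  assumes "atlas M" "i \<in> idx M" "foot v \<in> cdom M i"
  shows "truncate (mdim M) (chart (TB M) i v) = chart M i (foot v)"
  using chart_coords[OF assms] by (auto simp: truncate_def TB_chart coords_def fun_eq_iff)

lemma TB_chart_coords:
  assumes "v \<in> pts (TB M)"
  shows "chart (TB M) i v \<in> coords (2 * mdim M)"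
proof -
  have "components v i a = 0" if "\<not> a < mdim M" for a
    by (rule TB_components_0[OF assms]) (use that in blast)
  then show ?thesis by (simp add: TB_chart coords_def)
qed

lemma TB_chart_inj:
  assumes M: "atlas M" and i: "i \<in> idx M"
  shows "inj_on (chart (TB M) i) (cdom (TB M) i)"
proof (rule inj_onI)
  fix v w assume v: "v \<in> cdom (TB M) i" and w: "w \<in> cdom (TB M) i"
    and eq: "chart (TB M) i v = chart (TB M) i w"
  have "chart M i (foot v) = chart M i (foot w)"
    using TB_chart_truncate[OF M i] v w eq by (metis TB_cdom)
  then have f: "foot v = foot w"
    using chart_inj[OF M i] v w by (auto simp: TB_cdom dest: inj_onD)
  show "v = w"
  proof (rule TB_eqI[OF _ _ f i])
    fix a assume "a < mdim M"
    have "chart (TB M) i v (mdim M + a) = chart (TB M) i w (mdim M + a)" using eq by simp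
    then show "components v i a = components w i a" by (simp add: TB_chart)
  qed (use v w in \<open>auto simp: TB_cdom\<close>)
qed

text \<open>Over \<open>U\<close> the chart image is a product of the image of \<open>U\<close> with
  a full vector space: every sequence of fibre coordinates belongs to a tangent vector. In
  particular the image is open whenever that of \<open>U\<close> is.\<close>

lemma TB_chart_image:
  assumes M: "atlas M" and i: "i \<in> idx M" and U: "U \<subseteq> cdom M i"
  shows "chart (TB M) i ` {v \<in> cdom (TB M) i. foot v \<in> U} =
     {x \<in> coords (2 * mdim M). truncate (mdim M) x \<in> chart M i ` U}" (is "?A = ?B")
proof
  show "?A \<subseteq> ?B"
    using TB_chart_coords TB_chart_truncate[OF M i] by (auto simp: TB_cdom)
  show "?B \<subseteq> ?A"
  proof
    fix x assume x: "x \<in> ?B"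
    then obtain p where p: "p \<in> U" "truncate (mdim M) x = chart M i p" by auto
    then have pi: "p \<in> cdom M i" using U by auto
    \<comment> \<open>The vector at \<open>p\<close> whose components in the chart \<open>i\<close>
      are the second half of \<open>x\<close>; they are reproduced because the Jacobian of
      \<open>id\<close> in a single chart is the unit matrix.\<close>
    let ?v = "push_vector M i M id p (\<lambda>a. x (mdim M + a))"
    have v: "?v \<in> pts (TB M)" by (rule push_vector_in[OF M M smooth_map_id[OF M] i pi])
    have "chart (TB M) i ?v = x"
    proof (rule coords_eqI[OF TB_chart_coords[OF v]])
      show "x \<in> coords (2 * mdim M)" using x by simp
      fix a assume a: "a < 2 * mdim M"
      show "chart (TB M) i ?v a = x a"
      proof (cases "a < mdim M")
        case True
        then show ?thesis using fun_cong[OF p(2), of a] by (simp add: TB_chart truncate_def)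
      next
        case False
        then have a': "a - mdim M < mdim M" using a by simp
        have "components ?v i (a - mdim M) =
            (\<Sum>b<mdim M. (if a - mdim M = b then 1 else 0) * x (mdim M + b))"
          using push_vector_components[of i M id p "a - mdim M" M i] i pi a' jacobian_id[OF M i pi] by simp
        also have "\<dots> = x a" using a' False by (simp add: if_distrib[of "\<lambda>y. y * _"] cong: if_cong)
        finally show ?thesis using False by (simp add: TB_chart)
      qed
    qed
    then show "x \<in> ?A" using v p pi by (intro image_eqI[of _ _ ?v]) (auto simp: TB_cdom)
  qed
qed

text \<open>The two halves of the coordinate expression of a tangent map: the map itself, and its
  Jacobian applied to the fibre coordinates. The second costs one derivative, so it is a statement
  about functions of class infinity.\<close>

lemma smooth_fun_tangent_rep:
  assumes f: "smooth_map M N f" and i: "i \<in> idx M" and j: "j \<in> idx N" and c: "c < mdim N"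
    and M: "atlas M" and N: "atlas N"
    and S: "S = {x \<in> coords (2 * mdim M). truncate (mdim M) x \<in> chart M i ` (cdom M i \<inter> f -` cdom N j)}"
  shows "smooth_fun (2 * mdim M) S (\<lambda>x. local_rep M i N j f (truncate (mdim M) x) c)"
    "smooth_fun (2 * mdim M) S (\<lambda>x. \<Sum>b<mdim M. partial b (\<lambda>y. local_rep M i N j f y c) (truncate (mdim M) x) * x (mdim M + b))"
proof -
  let ?U = "chart M i ` (cdom M i \<inter> f -` cdom N j)"
  have U: "openin (Euclidean_space (mdim M)) ?U"
    by (rule smooth_map_open_chart(2)[OF M f cdom_open[OF N j] i])
  have So: "openin (Euclidean_space (2 * mdim M)) S" unfolding S by (rule openin_truncate[OF U])
  have t: "truncate (mdim M) x \<in> ?U" if "x \<in> S" for x using that S by simp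
  show "smooth_fun (2 * mdim M) S (\<lambda>x. local_rep M i N j f (truncate (mdim M) x) c)"
    by (rule smooth_fun_compose[OF So U t _ smooth_truncate, where g = "\<lambda>x. local_rep M i N j f x c"])
       (use smooth_mapD[OF f i j] c in \<open>auto simp: smooth_between_iff\<close>)
  show "smooth_fun (2 * mdim M) S (\<lambda>x. \<Sum>b<mdim M. partial b (\<lambda>y. local_rep M i N j f y c) (truncate (mdim M) x) * x (mdim M + b))"
  proof (intro smooth_fun_sum[OF So] smooth_fun_mult[OF So] smooth_fun_coord)
    fix b assume b: "b \<in> {..<mdim M}"
    show "smooth_fun (2 * mdim M) S (\<lambda>x. partial b (\<lambda>y. local_rep M i N j f y c) (truncate (mdim M) x))"
      by (rule smooth_fun_compose[OF So U t _ smooth_truncate, where g = "partial b (\<lambda>y. local_rep M i N j f y c)"])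
         (use jacobian_smooth_fun[OF f i j c] b in auto)
  qed
qed

lemma Tmap_coord:
  assumes M: "atlas M" and N: "atlas N" and f: "smooth_map M N f" and v: "v \<in> pts (TB M)"
    and i: "i \<in> idx M" "foot v \<in> cdom M i" and j: "j \<in> idx N" "f (foot v) \<in> cdom N j" and a: "a < 2 * mdim N"
  defines "x \<equiv> chart (TB M) i v"
  shows "chart (TB N) j (Tmap M N f v) a = (if a < mdim N then local_rep M i N j f (truncate (mdim M) x) a
     else \<Sum>b<mdim M. partial b (\<lambda>y. local_rep M i N j f y (a - mdim N)) (truncate (mdim M) x) * x (mdim M + b))"
proof -
  have tr: "truncate (mdim M) x = chart M i (foot v)" unfolding x_def by (rule TB_chart_truncate[OF M i])
  show ?thesis
  proof (cases "a < mdim N")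
    case True
    then show ?thesis unfolding tr using param_chart[OF M i] by (simp add: TB_chart)
  next
    case False
    then have "components (Tmap M N f v) j (a - mdim N) =
        (\<Sum>b<mdim M. jacobian M i N j f (foot v) (a - mdim N) b * components v i b)"
      using a by (intro Tmap_components[OF M N f v i j]) simp
    then show ?thesis using False unfolding tr by (simp add: TB_chart jacobian_def x_def)
  qed
qed

text \<open>Phrased with chart images and not as a \<open>smooth_map\<close>, because it is an
  ingredient of the proof that these charts form an atlas of \<open>TB M\<close> at all.\<close>

lemma smooth_Tmap_rep:
  assumes M: "atlas M" and N: "atlas N" and f: "smooth_map M N f" and i: "i \<in> idx M" and j: "j \<in> idx N"
  shows "smooth_between (2 * mdim M) (2 * mdim N)
     (chart (TB M) i ` {v \<in> cdom (TB M) i. foot v \<in> cdom M i \<inter> f -` cdom N j})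
     (local_rep (TB M) i (TB N) j (Tmap M N f))"
    (is "smooth_between _ _ ?S _")
proof -
  have S: "?S = {x \<in> coords (2 * mdim M). truncate (mdim M) x \<in> chart M i ` (cdom M i \<inter> f -` cdom N j)}"
    by (rule TB_chart_image[OF M i]) auto
  have U: "openin (Euclidean_space (mdim M)) (chart M i ` (cdom M i \<inter> f -` cdom N j))"
    by (rule smooth_map_open_chart(2)[OF M f cdom_open[OF N j] i])
  have So: "openin (Euclidean_space (2 * mdim M)) ?S" unfolding S by (rule openin_truncate[OF U])
  have eq: "local_rep (TB M) i (TB N) j (Tmap M N f) x a =
     (if a < mdim N then local_rep M i N j f (truncate (mdim M) x) a
     else \<Sum>b<mdim M. partial b (\<lambda>y. local_rep M i N j f y (a - mdim N)) (truncate (mdim M) x) * x (mdim M + b))"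
    if x: "x \<in> ?S" and a: "a < 2 * mdim N" for x a
  proof -
    from x obtain v where v: "v \<in> cdom (TB M) i" "f (foot v) \<in> cdom N j" "x = chart (TB M) i v" by auto
    have "param (TB M) i x = v"
      unfolding param_def v(3) by (rule the_inv_into_f_f[OF TB_chart_inj[OF M i] v(1)])
    then show ?thesis using Tmap_coord[OF M N f _ i _ j v(2) a] v by (simp add: TB_cdom)
  qed
  show ?thesis unfolding smooth_between_iff
  proof (intro allI impI)
    fix a assume a: "a < 2 * mdim N"
    show "smooth_fun (2 * mdim M) ?S (\<lambda>x. local_rep (TB M) i (TB N) j (Tmap M N f) x a)"
    proof (cases "a < mdim N")
      case True
      show ?thesis by (rule smooth_fun_cong[OF So smooth_fun_tangent_rep(1)[OF f i j True M N S]]) (use eq a True in simp)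
    next
      case False
      then have "a - mdim N < mdim N" using a by simp
      then show ?thesis
        by (intro smooth_fun_cong[OF So smooth_fun_tangent_rep(2)[OF f i j _ M N S]]) (use eq a False in simp_all)
    qed
  qed
qed

text \<open>Since \<open>Tmap M M id\<close> is the identity, the transition maps of the tangent
  bundle are its coordinate expressions, already known to be smooth.\<close>

lemma TB_atlas:
  assumes M: "atlas M" shows "atlas (TB M)"
proof -
  have inter: "cdom (TB M) i \<inter> cdom (TB M) j = {v \<in> cdom (TB M) i. foot v \<in> cdom M i \<inter> cdom M j}" for i j
    by (auto simp: TB_cdom)
  have 1: "pts (TB M) = (\<Union>i\<in>idx (TB M). cdom (TB M) i)"
    using pts_cdom[OF M] TB_foot by (fastforce simp: TB_cdom)
  have 2: "openin (Euclidean_space (2 * mdim M)) (chart (TB M) i ` (cdom (TB M) i \<inter> cdom (TB M) j))"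
    if "i \<in> idx M" "j \<in> idx M" for i j
    using openin_truncate[OF overlap_open[OF M that]] TB_chart_image[OF M that(1), of "cdom M i \<inter> cdom M j"]
    unfolding inter by simp
  have 3: "smooth_between (2 * mdim M) (2 * mdim M) (chart (TB M) i ` (cdom (TB M) i \<inter> cdom (TB M) j))
       (\<lambda>x. chart (TB M) j (param (TB M) i x))" if i: "i \<in> idx M" and j: "j \<in> idx M" for i j
  proof (rule smooth_between_cong[OF 2[OF i j]])
    show "smooth_between (2 * mdim M) (2 * mdim M) (chart (TB M) i ` (cdom (TB M) i \<inter> cdom (TB M) j))
       (local_rep (TB M) i (TB M) j (Tmap M M id))"
      using smooth_Tmap_rep[OF M M smooth_map_id[OF M] i j] unfolding inter by simp
    fix x a assume "x \<in> chart (TB M) i ` (cdom (TB M) i \<inter> cdom (TB M) j)"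
    then obtain v where v: "v \<in> cdom (TB M) i" "x = chart (TB M) i v" by auto
    have "param (TB M) i x = v"
      unfolding param_def v(2) by (rule the_inv_into_f_f[OF TB_chart_inj[OF M i] v(1)])
    then show "chart (TB M) j (param (TB M) i x) a = local_rep (TB M) i (TB M) j (Tmap M M id) x a"
      using Tmap_id[OF M] v by (simp add: TB_cdom)
  qed
  show ?thesis unfolding atlas_def using 1 2 3 TB_chart_inj[OF M] by simp
qed

lemma foot_rep:
  assumes M: "atlas M" and i: "i \<in> idx M" and v: "v \<in> cdom (TB M) i"
  shows "chart M i (foot v) = truncate (mdim M) (chart (TB M) i v)"
  using TB_chart_truncate[OF M i] v by (simp add: TB_cdom)

lemma smooth_foot:
  assumes M: "atlas M" shows "smooth_map (TB M) M foot"
proof (rule smooth_mapI[OF TB_atlas[OF M] M])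
  note T = TB_atlas[OF M]
  fix v assume v: "v \<in> pts (TB M)"
  obtain i where i: "i \<in> idx M" "foot v \<in> cdom M i" using pts_cdom[OF M TB_foot[OF v]] by blast
  then have i': "i \<in> idx (TB M)" by simp
  have "smooth_between (mdim (TB M)) (mdim M) (chart (TB M) i ` cdom (TB M) i) (local_rep (TB M) i M i foot)"
  proof (rule smooth_between_cong[OF chart_image_open[OF T i'] smooth_truncate])
    fix x a assume "x \<in> chart (TB M) i ` cdom (TB M) i"
    then show "local_rep (TB M) i M i foot x a = truncate (mdim M) x a"
      using foot_rep[OF M i(1)] param_chart[OF T i'] by auto
  qed
  then show "\<exists>i\<in>idx (TB M). \<exists>j\<in>idx M. \<exists>U. openin (mtop (TB M)) U \<and> v \<in> U \<and>
       U \<subseteq> cdom (TB M) i \<and> foot ` U \<subseteq> cdom M j \<and>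
       smooth_between (mdim (TB M)) (mdim M) (chart (TB M) i ` U) (local_rep (TB M) i M j foot)"
    using i i' v cdom_open[OF T i'] by (intro bexI[of _ i] exI[of _ "cdom (TB M) i"]) (auto simp: TB_cdom)
qed

lemma smooth_Tmap:
  assumes M: "atlas M" and N: "atlas N" and f: "smooth_map M N f"
  shows "smooth_map (TB M) (TB N) (Tmap M N f)"
proof (rule smooth_mapI[OF TB_atlas[OF M] TB_atlas[OF N]])
  fix v assume v: "v \<in> pts (TB M)"
  obtain i where i: "i \<in> idx M" "foot v \<in> cdom M i" using pts_cdom[OF M TB_foot[OF v]] by blast
  obtain j where j: "j \<in> idx N" "f (foot v) \<in> cdom N j"
    using pts_cdom[OF N TB_foot[OF Tmap_in[OF M N f v]]] by auto
  let ?U = "{v \<in> cdom (TB M) i. foot v \<in> cdom M i \<inter> f -` cdom N j}"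
  have "?U = {v \<in> pts (TB M). foot v \<in> cdom M i \<inter> f -` cdom N j}" by (auto simp: TB_cdom)
  then have "openin (mtop (TB M)) ?U"
    using smooth_map_open[OF TB_atlas[OF M] smooth_foot[OF M] smooth_map_open_chart(1)[OF M f cdom_open[OF N j(1)] i(1)]]
    by simp
  moreover have "Tmap M N f ` ?U \<subseteq> cdom (TB N) j"
    using Tmap_in[OF M N f] by (auto simp: TB_cdom)
  ultimately show "\<exists>i\<in>idx (TB M). \<exists>j\<in>idx (TB N). \<exists>U. openin (mtop (TB M)) U \<and> v \<in> U \<and>
       U \<subseteq> cdom (TB M) i \<and> Tmap M N f ` U \<subseteq> cdom (TB N) j \<and>
       smooth_between (mdim (TB M)) (mdim (TB N)) (chart (TB M) i ` U) (local_rep (TB M) i (TB N) j (Tmap M N f))"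
    using i j v smooth_Tmap_rep[OF M N f i(1) j(1)]
    by (intro bexI[of _ i] bexI[of _ j] exI[of _ ?U]) (auto simp: TB_cdom)
qed

lemma Hausdorff_coords: "Hausdorff_space (Euclidean_space n)"
  by (simp add: Euclidean_space_eq Hausdorff_space_subtopology)

lemma separate_in_chart:
  assumes M: "atlas M" and i: "i \<in> idx M" "p \<in> cdom M i" "q \<in> cdom M i" and ne: "p \<noteq> q"
  shows "\<exists>U V. openin (mtop M) U \<and> openin (mtop M) V \<and> p \<in> U \<and> q \<in> V \<and> disjnt U V"
proof -
  have "chart M i p \<noteq> chart M i q" using chart_inj[OF M i(1)] i ne by (meson inj_onD)
  then obtain Q R where Q: "openin (Euclidean_space (mdim M)) Q" "openin (Euclidean_space (mdim M)) R"
    "chart M i p \<in> Q" "chart M i q \<in> R" "disjnt Q R"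
    using Hausdorff_coords[of "mdim M"] chart_coords[OF M i(1)] i unfolding Hausdorff_space_def topspace_coords by metis
  let ?Q = "Q \<inter> chart M i ` cdom M i" and ?R = "R \<inter> chart M i ` cdom M i"
  have "openin (mtop M) (param M i ` ?Q)" "openin (mtop M) (param M i ` ?R)"
    using Q chart_image_open[OF M i(1)] by (auto intro!: param_open[OF M i(1)])
  moreover have "p \<in> param M i ` ?Q"
    using Q i param_chart[OF M i(1,2)] by (intro image_eqI[of _ _ "chart M i p"]) auto
  moreover have "q \<in> param M i ` ?R"
    using Q i param_chart[OF M i(1,3)] by (intro image_eqI[of _ _ "chart M i q"]) auto
  moreover have "disjnt (param M i ` ?Q) (param M i ` ?R)"
  proof -
    have False if z: "z \<in> param M i ` ?Q" "z \<in> param M i ` ?R" for z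
    proof -
      from z(1) obtain x where x: "x \<in> Q" "x \<in> chart M i ` cdom M i" "z = param M i x" by blast
      from z(2) obtain y where y: "y \<in> R" "y \<in> chart M i ` cdom M i" "z = param M i y" by blast
      have "x = chart M i z" "y = chart M i z"
        unfolding x(3) using chart_param[OF M i(1) x(2)] chart_param[OF M i(1) y(2)] x(3) y(3) by simp_all
      then show False using x(1) y(1) Q(5) by (auto simp: disjnt_iff)
    qed
    then show ?thesis unfolding disjnt_iff by blast
  qed
  ultimately show ?thesis by blast
qed

text \<open>Vectors with different feet are separated by preimages of neighbourhoods of the feet;
  vectors with the same foot lie in a common chart and are separated there. A countable cover of
  \<open>M\<close> by charts lifts to one of \<open>TB M\<close>.\<close>

lemma manifold_TB:
  assumes "manifold M" shows "manifold (TB M)"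
proof -
  have M: "atlas M" and H: "Hausdorff_space (mtop M)" using assms by (auto simp: manifold_iff)
  note T = TB_atlas[OF M]
  have "\<exists>U V. openin (mtop (TB M)) U \<and> openin (mtop (TB M)) V \<and> v \<in> U \<and> w \<in> V \<and> disjnt U V"
    if v: "v \<in> pts (TB M)" and w: "w \<in> pts (TB M)" and ne: "v \<noteq> w" for v w
  proof (cases "foot v = foot w")
    case True
    obtain i where i: "i \<in> idx M" "foot v \<in> cdom M i" using pts_cdom[OF M TB_foot[OF v]] by blast
    show ?thesis by (rule separate_in_chart[OF T _ _ _ ne, of i]) (use i v w True in \<open>auto simp: TB_cdom\<close>)
  next
    case False
    then obtain U V where U: "openin (mtop M) U" "openin (mtop M) V" "foot v \<in> U" "foot w \<in> V" "disjnt U V"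
      using H TB_foot[OF v] TB_foot[OF w] unfolding Hausdorff_space_def topspace_mtop[OF M] by metis
    show ?thesis
      using smooth_map_open[OF T smooth_foot[OF M] U(1)] smooth_map_open[OF T smooth_foot[OF M] U(2)]
      by (intro exI[of _ "{v \<in> pts (TB M). foot v \<in> U}"] exI[of _ "{v \<in> pts (TB M). foot v \<in> V}"])
         (use v w U in \<open>auto simp: disjnt_def\<close>)
  qed
  then have "Hausdorff_space (mtop (TB M))" unfolding Hausdorff_space_def topspace_mtop[OF T] by blast
  moreover obtain J where J: "J \<subseteq> idx M" "countable J" "pts M = (\<Union>i\<in>J. cdom M i)"
    by (rule countable_charts[OF assms])
  have "second_countable (mtop (TB M))"
  proof (rule second_countable_mtopI[OF T _ J(2)])
    show "pts (TB M) \<subseteq> (\<Union>i\<in>J. cdom (TB M) i)" using J(3) TB_foot by (fastforce simp: TB_cdom)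
  qed (use J in simp)
  ultimately show ?thesis using T by (simp add: manifold_iff)
qed

section \<open>Iterated tangent bundles and maps\<close>

lemma TB_iter_sel [simp]: "mdim ((TB ^^ s) M) = 2 ^ s * mdim M" "idx ((TB ^^ s) M) = idx M"
  by (induction s) auto

lemma manifold_TB_iter: "manifold M \<Longrightarrow> manifold ((TB ^^ s) M)"
  by (induction s) (auto intro: manifold_TB)

lemma atlas_TB_iter: "atlas M \<Longrightarrow> atlas ((TB ^^ s) M)"
  by (induction s) (auto intro: TB_atlas)

lemma smooth_Tmap_iter:
  assumes "atlas M" "atlas N" "smooth_map M N f"
  shows "smooth_map ((TB ^^ s) M) ((TB ^^ s) N) (Tmap_iter s M N f)"
  by (induction s) (use assms in \<open>auto intro!: smooth_Tmap atlas_TB_iter\<close>)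

text \<open>At each level the map is known to be the identity on points only, so it has to be
  exchanged for \<open>id\<close> by congruence before functoriality of \<open>Tmap\<close>
  applies.\<close>

lemma Tmap_iter_id:
  assumes M: "atlas M" and v: "v \<in> pts ((TB ^^ s) M)"
  shows "Tmap_iter s M M id v = v"
  using v
proof (induction s arbitrary: v)
  case (Suc s)
  note P = atlas_TB_iter[OF M, of s]
  have v: "v \<in> pts (TB ((TB ^^ s) M))" using Suc.prems by simp
  have "Tmap ((TB ^^ s) M) ((TB ^^ s) M) (Tmap_iter s M M id) v = Tmap ((TB ^^ s) M) ((TB ^^ s) M) id v"
    by (rule Tmap_cong[OF P P smooth_map_id[OF P] v]) (simp only: Suc.IH id_apply)
  then show ?case unfolding Tmap_iter.simps Tmap_id[OF P v] .
qed simp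

lemma Tmap_iter_compose:
  assumes M: "atlas M" and N: "atlas N" and P: "atlas P"
    and f: "smooth_map M N f" and g: "smooth_map N P g" and v: "v \<in> pts ((TB ^^ s) M)"
  shows "Tmap_iter s M P (g \<circ> f) v = Tmap_iter s N P g (Tmap_iter s M N f v)"
  using v
proof (induction s arbitrary: v)
  case (Suc s)
  note M' = atlas_TB_iter[OF M, of s] and N' = atlas_TB_iter[OF N, of s] and P' = atlas_TB_iter[OF P, of s]
  note f' = smooth_Tmap_iter[OF M N f, of s] and g' = smooth_Tmap_iter[OF N P g, of s]
  have v: "v \<in> pts (TB ((TB ^^ s) M))" using Suc.prems by simp
  have "Tmap ((TB ^^ s) M) ((TB ^^ s) P) (Tmap_iter s M P (g \<circ> f)) v =
      Tmap ((TB ^^ s) M) ((TB ^^ s) P) (Tmap_iter s N P g \<circ> Tmap_iter s M N f) v"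
    by (rule Tmap_cong[OF M' P' smooth_map_compose[OF M' N' P' f' g'] v]) (simp only: Suc.IH o_apply)
  then show ?case unfolding Tmap_iter.simps Tmap_compose[OF M' N' P' f' g' v] .
qed simp

lemma Tmap_iter_cong:
  assumes M: "atlas M" and N: "atlas N" and f: "smooth_map M N f" and v: "v \<in> pts ((TB ^^ s) M)"
    and eq: "\<And>p. p \<in> pts M \<Longrightarrow> g p = f p"
  shows "Tmap_iter s M N g v = Tmap_iter s M N f v"
  using v
proof (induction s arbitrary: v)
  case (Suc s)
  have v: "v \<in> pts (TB ((TB ^^ s) M))" using Suc.prems by simp
  show ?case
    unfolding Tmap_iter.simps
    by (rule Tmap_cong[OF atlas_TB_iter[OF M] atlas_TB_iter[OF N] smooth_Tmap_iter[OF M N f] v])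
       (rule Suc.IH)
qed (use eq in simp)

section \<open>Velocities of curves\<close>

lemma higher_deriv_cong:
  fixes f g :: "real \<Rightarrow> real"
  assumes "open J" "\<And>s. s \<in> J \<Longrightarrow> f s = g s" "t \<in> J"
  shows "(deriv ^^ l) f t = (deriv ^^ l) g t"
  using assms(3)
proof (induction l arbitrary: t)
  case (Suc l)
  have "\<forall>\<^sub>F s in nhds t. (deriv ^^ l) f s = (deriv ^^ l) g s"
    using eventually_nhds_in_open[OF assms(1) Suc.prems] by eventually_elim (rule Suc.IH)
  then have "deriv ((deriv ^^ l) f) t = deriv ((deriv ^^ l) g) t" by (rule deriv_cong_ev) simp
  then show ?case by simp
qed (use assms in simp)

lemma differentiable_cong_open:
  fixes f g :: "real \<Rightarrow> real"
  assumes "open J" "\<And>s. s \<in> J \<Longrightarrow> f s = g s" "t \<in> J" "g differentiable (at t)"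
  shows "f differentiable (at t)"
proof -
  have "\<forall>\<^sub>F s in nhds t. f s = g s"
    using eventually_nhds_in_open[OF assms(1,3)] by eventually_elim (rule assms(2))
  then show ?thesis
    using assms(4) DERIV_cong_ev[OF refl _ refl, of f g t] unfolding real_differentiable_def by blast
qed

definition vel :: "('a, 'i) manif \<Rightarrow> (real \<Rightarrow> ('a, 'i) pt) \<Rightarrow> real \<Rightarrow> ('a, 'i) pt" where
  "vel M \<gamma> t = Vec (\<gamma> t) (\<lambda>i a. if i \<in> idx M \<and> \<gamma> t \<in> cdom M i \<and> a < mdim M
     then deriv (\<lambda>s. chart M i (\<gamma> s) a) t else 0)"

lemma vel_foot [simp]: "foot (vel M \<gamma> t) = \<gamma> t"
  by (simp add: vel_def)

lemma vel_components:
  "i \<in> idx M \<Longrightarrow> \<gamma> t \<in> cdom M i \<Longrightarrow> a < mdim M \<Longrightarrow>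
    components (vel M \<gamma> t) i a = deriv (\<lambda>s. chart M i (\<gamma> s) a) t"
  by (simp add: vel_def)

lemma vel_cong:
  assumes "open I" "\<And>s. s \<in> I \<Longrightarrow> \<gamma> s = \<delta> s" "t \<in> I"
  shows "vel M \<gamma> t = vel M \<delta> t"
proof -
  have "deriv (\<lambda>s. chart M i (\<gamma> s) a) t = deriv (\<lambda>s. chart M i (\<delta> s) a) t" for i a
    using higher_deriv_cong[of I "\<lambda>s. chart M i (\<gamma> s) a" "\<lambda>s. chart M i (\<delta> s) a" t 1] assms by simp
  then show ?thesis using assms(2)[OF assms(3)] by (simp add: vel_def cong: if_cong)
qed

abbreviation smooth_curve :: "real set \<Rightarrow> ('p, 'i) mfd \<Rightarrow> (real \<Rightarrow> 'p) \<Rightarrow> bool" where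
  "smooth_curve I M \<gamma> \<equiv> smooth_map (interval_mfd I) M \<gamma>"

lemma vel_in:
  assumes I: "open I" and M: "atlas M" and g: "smooth_curve I M \<gamma>" and t: "t \<in> I"
  shows "vel M \<gamma> t \<in> pts (TB M)"
proof -
  have "tangent_at M (\<gamma> t) (\<lambda>i a. if i \<in> idx M \<and> \<gamma> t \<in> cdom M i \<and> a < mdim M
     then deriv (\<lambda>s. chart M i (\<gamma> s) a) t else 0)"
    unfolding tangent_at_def
  proof (intro conjI ballI impI allI)
    show "\<gamma> t \<in> pts M" by (rule curve_in[OF I M g t])
    show "(if i \<in> idx M \<and> \<gamma> t \<in> cdom M i \<and> a < mdim M
       then deriv (\<lambda>s. chart M i (\<gamma> s) a) t else 0) = 0"
      if "\<not> (i \<in> idx M \<and> \<gamma> t \<in> cdom M i \<and> a < mdim M)" for i a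
      by (rule if_not_P[OF that])
    fix i j a assume i: "i \<in> idx M" "\<gamma> t \<in> cdom M i" and j: "j \<in> idx M" "\<gamma> t \<in> cdom M j" and a: "a < mdim M"
    show "(if j \<in> idx M \<and> \<gamma> t \<in> cdom M j \<and> a < mdim M then deriv (\<lambda>s. chart M j (\<gamma> s) a) t else 0) =
       (\<Sum>b<mdim M. jacobian M i M j id (\<gamma> t) a b *
         (if i \<in> idx M \<and> \<gamma> t \<in> cdom M i \<and> b < mdim M then deriv (\<lambda>s. chart M i (\<gamma> s) b) t else 0))"
      using curve_chain_rule[OF I M M g smooth_map_id[OF M] t i j(1) _ a] i j a by simp
  qed
  then show ?thesis unfolding TB_pts vel_def by blast
qed

lemma smooth_vel:
  assumes I: "open I" and M: "atlas M" and g: "smooth_curve I M \<gamma>"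
  shows "smooth_curve I (TB M) (vel M \<gamma>)"
proof (rule curve_smoothI[OF I TB_atlas[OF M]])
  fix t assume t: "t \<in> I"
  obtain j where j: "j \<in> idx M" "\<gamma> t \<in> cdom M j" using pts_cdom[OF M curve_in[OF I M g t]] by blast
  let ?J = "{s \<in> I. \<gamma> s \<in> cdom M j}"
  have J: "open ?J" by (rule curve_open[OF I g cdom_open[OF M j(1)]])
  have d: "(deriv ^^ l) (\<lambda>s. chart (TB M) j (vel M \<gamma> s) a) differentiable (at s)"
    if a: "a < mdim (TB M)" and s: "s \<in> ?J" for a l s
  proof (cases "a < mdim M")
    case True
    then have "(\<lambda>s. chart (TB M) j (vel M \<gamma> s) a) = (\<lambda>s. chart M j (\<gamma> s) a)" by (simp add: TB_chart)
    then show ?thesis using curve_smooth[OF I M g _ j(1) _ True, of s] s by simp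
  next
    case False
    let ?g = "\<lambda>s. chart M j (\<gamma> s) (a - mdim M)"
    have a': "a - mdim M < mdim M" using a False by simp
    have "chart (TB M) j (vel M \<gamma> s) a = deriv ?g s" if "s \<in> ?J" for s
      using that False a' j by (simp add: TB_chart vel_components)
    \<comment> \<open>A fibre coordinate of the velocity is itself a derivative, so its derivative
      of order \<open>l\<close> is one of order \<open>l + 1\<close> of the curve.\<close>
    then have "(deriv ^^ l) (\<lambda>s. chart (TB M) j (vel M \<gamma> s) a) s = (deriv ^^ Suc l) ?g s" if "s \<in> ?J" for s
      unfolding funpow_Suc_right o_apply by (rule higher_deriv_cong[OF J]) (use that in auto)
    then show ?thesis
      by (rule differentiable_cong_open[OF J _ s]) (use curve_smooth[OF I M g _ j(1) _ a', of s "Suc l"] s in auto)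
  qed
  have "vel M \<gamma> ` ?J \<subseteq> cdom (TB M) j" using vel_in[OF I M g] by (auto simp: TB_cdom)
  then show "\<exists>j\<in>idx (TB M). \<exists>J. open J \<and> t \<in> J \<and> J \<subseteq> I \<and> vel M \<gamma> ` J \<subseteq> cdom (TB M) j \<and>
      (\<forall>a<mdim (TB M). \<forall>l. \<forall>s\<in>J. (deriv ^^ l) (\<lambda>s. chart (TB M) j (vel M \<gamma> s) a) differentiable (at s))"
    using j t J d by (intro bexI[of _ j] exI[of _ ?J]) auto
qed

lemma smooth_curve_compose:
  "open I \<Longrightarrow> atlas M \<Longrightarrow> atlas N \<Longrightarrow> smooth_curve I M \<gamma> \<Longrightarrow> smooth_map M N f \<Longrightarrow>
    smooth_curve I N (f \<circ> \<gamma>)"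
  by (rule smooth_map_compose[OF interval_atlas])

lemma Tmap_vel:
  assumes I: "open I" and M: "atlas M" and N: "atlas N" and g: "smooth_curve I M \<gamma>"
    and f: "smooth_map M N f" and t: "t \<in> I"
  shows "Tmap M N f (vel M \<gamma> t) = vel N (f \<circ> \<gamma>) t"
proof -
  note v = vel_in[OF I M g t] and fg = smooth_curve_compose[OF I M N g f]
  obtain i where i: "i \<in> idx M" "\<gamma> t \<in> cdom M i" using pts_cdom[OF M curve_in[OF I M g t]] by blast
  obtain j where j: "j \<in> idx N" "f (\<gamma> t) \<in> cdom N j" using pts_cdom[OF N curve_in[OF I N fg t]] by auto
  show ?thesis
  proof (rule TB_eqI[OF Tmap_in[OF M N f v] vel_in[OF I N fg t] _ j(1)])
    fix a assume a: "a < mdim N"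
    have "components (Tmap M N f (vel M \<gamma> t)) j a =
      (\<Sum>b<mdim M. jacobian M i N j f (\<gamma> t) a b * components (vel M \<gamma> t) i b)"
      using Tmap_components[OF M N f v i(1) _ j(1) _ a] i j by simp
    also have "\<dots> = deriv (\<lambda>s. chart N j (f (\<gamma> s)) a) t"
      using curve_chain_rule[OF I M N g f t i j a] i by (simp add: vel_components)
    also have "\<dots> = components (vel N (f \<circ> \<gamma>) t) j a" using j a by (simp add: vel_components)
    finally show "components (Tmap M N f (vel M \<gamma> t)) j a = components (vel N (f \<circ> \<gamma>) t) j a" .
  qed (use j in auto)
qed

primrec iter_vel :: "nat \<Rightarrow> ('a, 'i) manif \<Rightarrow> (real \<Rightarrow> ('a, 'i) pt) \<Rightarrow> real \<Rightarrow> ('a, 'i) pt" where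
  "iter_vel 0 M \<gamma> = \<gamma>"
| "iter_vel (Suc s) M \<gamma> = vel ((TB ^^ s) M) (iter_vel s M \<gamma>)"

lemma smooth_iter_vel:
  "open I \<Longrightarrow> atlas M \<Longrightarrow> smooth_curve I M \<gamma> \<Longrightarrow> smooth_curve I ((TB ^^ s) M) (iter_vel s M \<gamma>)"
  by (induction s) (auto intro: smooth_vel atlas_TB_iter)

lemma iter_vel_in: "open I \<Longrightarrow> atlas M \<Longrightarrow> smooth_curve I M \<gamma> \<Longrightarrow> t \<in> I \<Longrightarrow> iter_vel s M \<gamma> t \<in> pts ((TB ^^ s) M)"
  by (rule curve_in[OF _ atlas_TB_iter smooth_iter_vel])

lemma foot_iter_vel: "foot \<circ> iter_vel (Suc s) M \<gamma> = iter_vel s M \<gamma>"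
  by (rule ext) simp

lemma feet_iter_vel: "(foot ^^ s) (iter_vel s M \<gamma> t) = \<gamma> t"
  by (induction s) (simp_all add: funpow_swap1)

text \<open>Splits off the outer \<open>a\<close> velocities as those of a curve in
  \<open>T^b M\<close>, the form in which naturality with respect to a map defined on
  \<open>T^b M\<close> can be used.\<close>

lemma iter_vel_add: "iter_vel a ((TB ^^ b) M) (iter_vel b M \<gamma>) = iter_vel (a + b) M \<gamma>"
  by (induction a) (simp_all add: funpow_add)

lemma Tmap_iter_iter_vel:
  assumes I: "open I" and M: "atlas M" and N: "atlas N" and g: "smooth_curve I M \<gamma>"
    and f: "smooth_map M N f" and t: "t \<in> I"
  shows "Tmap_iter s M N f (iter_vel s M \<gamma> t) = iter_vel s N (f \<circ> \<gamma>) t"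
  using t
proof (induction s arbitrary: t)
  case (Suc s)
  have "Tmap_iter (Suc s) M N f (iter_vel (Suc s) M \<gamma> t) =
      vel ((TB ^^ s) N) (Tmap_iter s M N f \<circ> iter_vel s M \<gamma>) t"
    unfolding Tmap_iter.simps iter_vel.simps
    by (rule Tmap_vel[OF I atlas_TB_iter[OF M] atlas_TB_iter[OF N] smooth_iter_vel[OF I M g]
          smooth_Tmap_iter[OF M N f] Suc.prems])
  also have "\<dots> = vel ((TB ^^ s) N) (iter_vel s N (f \<circ> \<gamma>)) t"
    by (rule vel_cong[OF I _ Suc.prems]) (simp only: o_apply[of "Tmap_iter s M N f"] Suc.IH)
  finally show ?case unfolding iter_vel.simps .
qed simp

text \<open>The foot of a velocity is the point of the curve, so the projection undoes the
  differentiation number \<open>b + 1\<close>, and naturality carries it past the \<open>a\<close>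
  outer ones. The result depends on \<open>a + b\<close> only, which is prominence.\<close>

lemma proj1_iter_vel:
  assumes I: "open I" and M: "atlas M" and g: "smooth_curve I M \<gamma>" and t: "t \<in> I"
  shows "proj1 a b M (iter_vel (a + Suc b) M \<gamma> t) = iter_vel (a + b) M \<gamma> t"
proof -
  note B = atlas_TB_iter[OF M, of b]
  have "proj1 a b M (iter_vel a ((TB ^^ Suc b) M) (iter_vel (Suc b) M \<gamma>) t) =
      iter_vel a ((TB ^^ b) M) (foot \<circ> iter_vel (Suc b) M \<gamma>) t"
    unfolding proj1_def
    using Tmap_iter_iter_vel[OF I TB_atlas[OF B] B _ smooth_foot[OF B] t, of "iter_vel (Suc b) M \<gamma>" a]
      smooth_iter_vel[OF I M g, of "Suc b"] by (simp only: funpow.simps o_apply[of TB])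
  then show ?thesis unfolding iter_vel_add foot_iter_vel .
qed

lemma prominent_iter_vel:
  assumes I: "open I" and M: "atlas M" and g: "smooth_curve I M \<gamma>" and t: "t \<in> I"
  shows "prominent r M (iter_vel r M \<gamma> t)"
  unfolding prominent_def
proof (intro conjI ballI)
  show "iter_vel r M \<gamma> t \<in> pts ((TB ^^ r) M)" by (rule iter_vel_in[OF I M g t])
  have *: "proj1 a b M (iter_vel r M \<gamma> t) = iter_vel (r - 1) M \<gamma> t" if "a + Suc b = r" for a b
    using proj1_iter_vel[OF I M g t, of a b] that by auto
  fix q assume "q \<in> {1..r}"
  then show "proj1 0 (r - 1) M (iter_vel r M \<gamma> t) = proj1 (q - 1) (r - q) M (iter_vel r M \<gamma> t)"
    using *[of 0 "r - 1"] *[of "q - 1" "r - q"] by simp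
qed

section \<open>Coordinates of iterated velocities\<close>

text \<open>The number of binary digits \<open>1\<close>, that is, the size of the subset encoded by
  \<open>n\<close>. The defining equation would loop as a rewrite rule and is withdrawn from the
  simplifier.\<close>

fun popcount :: "nat \<Rightarrow> nat" where
  "popcount n = (if n = 0 then 0 else n mod 2 + popcount (n div 2))"

declare popcount.simps [simp del]

lemma popcount_rec: "popcount n = n mod 2 + popcount (n div 2)"
  by (cases "n = 0") (simp_all add: popcount.simps[of n] popcount.simps[of 0])

lemma popcount_0 [simp]: "popcount 0 = 0"
  by (simp add: popcount.simps)

lemma popcount_double [simp]: "popcount (2 * n) = popcount n" "popcount (Suc (2 * n)) = Suc (popcount n)"
  by (simp_all add: popcount_rec[of "2 * n"] popcount_rec[of "Suc (2 * n)"])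

text \<open>The digits of \<open>h\<close> and \<open>l\<close> do not interact; hence inserting or
  deleting a digit \<open>0\<close> between them does not change the number of ones.\<close>

lemma popcount_concat: "l < 2 ^ b \<Longrightarrow> popcount (2 ^ b * h + l) = popcount h + popcount l"
proof (induction b arbitrary: l)
  case (Suc b)
  have "(2 ^ Suc b * h + l) div 2 = 2 ^ b * h + l div 2" "(2 ^ Suc b * h + l) mod 2 = l mod 2"
    by (simp_all add: mult.assoc)
  then show ?case
    using Suc.IH[of "l div 2"] Suc.prems popcount_rec[of l] popcount_rec[of "2 ^ Suc b * h + l"] by simp
qed simp

lemma popcount_high: "l < 2 ^ b \<Longrightarrow> popcount (2 ^ b + l) = Suc (popcount l)"
  using popcount_concat[of l b 1] popcount_rec[of 1] by simp

lemma popcount_ones: "popcount (2 ^ k - 1) = k"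
proof (induction k)
  case (Suc k)
  have "(2::nat) ^ Suc k - 1 = 2 ^ k + (2 ^ k - 1)" by simp
  then show ?case using popcount_high[of "2 ^ k - 1" k] Suc by simp
qed simp

lemma popcount_le: "A < 2 ^ r \<Longrightarrow> popcount A \<le> r"
proof (induction r arbitrary: A)
  case (Suc r)
  have "A mod 2 \<le> 1" by simp
  moreover have "popcount (A div 2) \<le> r" using Suc.prems by (intro Suc.IH) simp
  ultimately show ?case unfolding popcount_rec[of A] by linarith
qed simp

lemma ones_mono: "k \<le> r \<Longrightarrow> (2::nat) ^ k - 1 < 2 ^ r"
  by (metis diff_less less_le_trans one_le_numeral power_increasing zero_less_numeral zero_less_one zero_less_power)

text \<open>A number not of the form \<open>2 ^ k - 1\<close> has a digit \<open>0\<close> below a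
  digit \<open>1\<close>. Its position is \<open>b\<close>, the digits above it form
  \<open>h > 0\<close> and those below it form \<open>l\<close>. Induction on the number: an even
  one has the gap at position \<open>0\<close>, an odd one is stripped of its last digit.\<close>

lemma gap_exists:
  assumes "A \<noteq> 2 ^ popcount A - 1"
  shows "\<exists>b h l. A = 2 ^ Suc b * h + l \<and> l < 2 ^ b \<and> h > 0"
  using assms
proof (induction A rule: less_induct)
  case (less A)
  show ?case
  proof (cases "even A")
    case True
    then obtain h where h: "A = 2 * h" by blast
    \<comment> \<open>The case \<open>A = 0\<close> is excluded, being
      \<open>2 ^ 0 - 1\<close>.\<close>
    then have "h > 0" using less.prems by (cases h) auto
    then show ?thesis using h by (intro exI[of _ 0] exI[of _ h] exI[of _ 0]) simp
  next
    case False
    then obtain B where B: "A = Suc (2 * B)" using oddE by fastforce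
    have "B \<noteq> 2 ^ popcount B - 1"
    proof
      assume e: "B = 2 ^ popcount B - 1"
      have pA: "popcount A = Suc (popcount B)" using B by simp
      have "(1::nat) \<le> 2 ^ popcount B" by simp
      then have "Suc (2 * B) = 2 * 2 ^ popcount B - 1" using e by linarith
      then have "A = 2 ^ popcount A - 1" unfolding pA power_Suc using B by (rule trans[rotated])
      then show False using less.prems by blast
    qed
    then obtain b h l where "B = 2 ^ Suc b * h + l" "l < 2 ^ b" "h > 0"
      using less.IH[of B] B by auto
    then show ?thesis
      using B by (intro exI[of _ "Suc b"] exI[of _ h] exI[of _ "Suc (2 * l)"]) simp
  qed
qed

lemma block_lt: "A < n \<Longrightarrow> c < m \<Longrightarrow> A * m + c < n * (m::nat)"
proof -
  assume "A < n" "c < m"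
  then have "A * m + c < Suc A * m" by simp
  also have "\<dots> \<le> n * m" using \<open>A < n\<close> by (intro mult_le_mono) auto
  finally show ?thesis .
qed

section \<open>Blocks of coordinates\<close>

lemma TB_iter_cdom:
  "atlas M \<Longrightarrow> v \<in> cdom ((TB ^^ s) M) i \<Longrightarrow> i \<in> idx M \<Longrightarrow> v \<in> pts ((TB ^^ s) M)"
  using cdom_pts[OF atlas_TB_iter] by (metis TB_iter_sel(2))

lemma TB_iter_cdom_iff:
  assumes "atlas M" "i \<in> idx M" "v \<in> pts ((TB ^^ s) M)"
  shows "v \<in> cdom ((TB ^^ s) M) i \<longleftrightarrow> (foot ^^ s) v \<in> cdom M i"
  using assms(3)
proof (induction s arbitrary: v)
  case (Suc s)
  then have v: "v \<in> pts (TB ((TB ^^ s) M))" by simp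
  have "v \<in> cdom ((TB ^^ Suc s) M) i \<longleftrightarrow> foot v \<in> cdom ((TB ^^ s) M) i"
    using v by (simp add: TB_cdom)
  then show ?case using Suc.IH[OF TB_foot[OF v]] by (simp add: funpow_swap1)
qed simp

lemma TB_iter_foot: "v \<in> pts ((TB ^^ s) M) \<Longrightarrow> (foot ^^ s) v \<in> pts M"
proof (induction s arbitrary: v)
  case (Suc s)
  then have "foot v \<in> pts ((TB ^^ s) M)" by (intro TB_foot) simp
  then show ?case using Suc.IH by (simp add: funpow_swap1)
qed simp

text \<open>Block \<open>0\<close>, that of the empty subset, holds the coordinates of the base
  point.\<close>

lemma TB_iter_chart_base:
  "c < mdim M \<Longrightarrow> chart ((TB ^^ s) M) i v c = chart M i ((foot ^^ s) v) c"
proof (induction s arbitrary: v)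
  case (Suc s)
  have "(1::nat) * mdim M \<le> 2 ^ s * mdim M" by (intro mult_le_mono1) simp
  then have "c < 2 ^ s * mdim M" using Suc.prems by linarith
  then show ?case using Suc.IH[OF Suc.prems, of "foot v"] by (simp add: TB_chart funpow_swap1[of foot])
qed simp

text \<open>One more velocity doubles the number of blocks. The lower half is kept; in the upper
  half, where digit \<open>s\<close> is \<open>1\<close>, each block is the derivative of the block
  with that digit cleared. So every digit \<open>1\<close> accounts for one derivative. The
  parameter \<open>t\<close> varies in the induction because the block has to be known on a
  neighbourhood before it is differentiated.\<close>

lemma iter_vel_coord:
  assumes I: "open I" and M: "atlas M" and g: "smooth_curve I M \<gamma>" and i: "i \<in> idx M"
    and c: "c < mdim M"
  shows "t \<in> I \<Longrightarrow> \<gamma> t \<in> cdom M i \<Longrightarrow> A < 2 ^ s \<Longrightarrow>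
    chart ((TB ^^ s) M) i (iter_vel s M \<gamma> t) (A * mdim M + c) =
      (deriv ^^ popcount A) (\<lambda>s. chart M i (\<gamma> s) c) t"
proof (induction s arbitrary: t A)
  case (Suc s)
  let ?X = "(TB ^^ s) M"
  show ?case
  proof (cases "A < 2 ^ s")
    case True
    then have "A * mdim M + c < 2 ^ s * mdim M" using c by (intro block_lt)
    then show ?thesis using Suc.IH[OF Suc.prems(1,2) True] by (simp add: TB_chart)
  next
    case False
    define B where "B = A - 2 ^ s"
    have A: "A = 2 ^ s + B" "B < 2 ^ s" using False Suc.prems(3) by (auto simp: B_def)
    have lt: "B * mdim M + c < 2 ^ s * mdim M" using c A by (intro block_lt)
    let ?J = "{t \<in> I. \<gamma> t \<in> cdom M i}"
    have J: "open ?J" by (rule curve_open[OF I g cdom_open[OF M i]])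
    have zc: "iter_vel s M \<gamma> t \<in> cdom ?X i"
      using TB_iter_cdom_iff[OF M i iter_vel_in[OF I M g Suc.prems(1)]] Suc.prems(2) by (simp add: feet_iter_vel)
    have "chart ((TB ^^ Suc s) M) i (iter_vel (Suc s) M \<gamma> t) (A * mdim M + c) =
       components (vel ?X (iter_vel s M \<gamma>) t) i (B * mdim M + c)"
      by (simp add: TB_chart A(1) algebra_simps)
    also have "\<dots> = deriv (\<lambda>t. chart ?X i (iter_vel s M \<gamma> t) (B * mdim M + c)) t"
      by (rule vel_components) (use i zc lt in auto)
    also have "\<dots> = deriv ((deriv ^^ popcount B) (\<lambda>s. chart M i (\<gamma> s) c)) t"
      using higher_deriv_cong[OF J, of "\<lambda>t. chart ?X i (iter_vel s M \<gamma> t) (B * mdim M + c)"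
          "(deriv ^^ popcount B) (\<lambda>s. chart M i (\<gamma> s) c)" t 1] Suc.IH[of _ B] A(2) Suc.prems by simp
    also have "\<dots> = (deriv ^^ popcount A) (\<lambda>s. chart M i (\<gamma> s) c) t"
      unfolding A(1) popcount_high[OF A(2)] by simp
    finally show ?thesis .
  qed
qed simp

lemma TB_iter_eqI:
  assumes M: "atlas M" and i: "i \<in> idx M" and v: "v \<in> cdom ((TB ^^ s) M) i" "w \<in> cdom ((TB ^^ s) M) i"
    and eq: "\<And>A c. A < 2 ^ s \<Longrightarrow> c < mdim M \<Longrightarrow>
       chart ((TB ^^ s) M) i v (A * mdim M + c) = chart ((TB ^^ s) M) i w (A * mdim M + c)"
  shows "v = w"
proof -
  note P = atlas_TB_iter[OF M, of s]
  have i': "i \<in> idx ((TB ^^ s) M)" using i by simp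
  have "chart ((TB ^^ s) M) i v = chart ((TB ^^ s) M) i w"
  proof (rule coords_eqI[OF chart_coords[OF P i' v(1)] chart_coords[OF P i' v(2)]])
    fix n assume n: "n < mdim ((TB ^^ s) M)"
    then have "mdim M > 0" by (cases "mdim M") auto
    then have "n div mdim M < 2 ^ s" "n mod mdim M < mdim M"
      using n by (auto simp: less_mult_imp_div_less)
    from eq[OF this] show "chart ((TB ^^ s) M) i v n = chart ((TB ^^ s) M) i w n" by simp
  qed
  then show ?thesis using chart_inj[OF P i'] v by (auto dest: inj_onD)
qed

section \<open>Curves with prescribed derivatives\<close>

text \<open>The polynomial with \<open>k\<close> terms whose derivatives at \<open>0\<close> are the
  entries of \<open>y\<close>. Dividing by factorials turns differentiation into a shift of
  \<open>y\<close>.\<close>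

definition taylor :: "(nat \<Rightarrow> real) \<Rightarrow> nat \<Rightarrow> real \<Rightarrow> real" where
  "taylor y k t = (\<Sum>l<k. y l * t ^ l / fact l)"

lemma DERIV_taylor:
  "(taylor y (Suc k) has_field_derivative taylor (\<lambda>l. y (Suc l)) k t) (at t)"
proof -
  have "((\<lambda>t. y 0 + (\<Sum>l<k. y (Suc l) / fact (Suc l) * t ^ Suc l)) has_field_derivative
     0 + (\<Sum>l<k. y (Suc l) / fact (Suc l) * (real (Suc l) * t ^ l))) (at t)"
    by (intro DERIV_add DERIV_sum DERIV_const DERIV_cmult) (use DERIV_pow[of "Suc _" t] in simp)
  moreover have "y (Suc l) / fact (Suc l) * (real (Suc l) * t ^ l) = y (Suc l) * t ^ l / fact l" for l
    by (simp add: fact_Suc field_simps del: of_nat_Suc)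
  moreover have "taylor y (Suc k) = (\<lambda>t. y 0 + (\<Sum>l<k. y (Suc l) / fact (Suc l) * t ^ Suc l))"
    by (rule ext) (simp only: taylor_def sum.lessThan_Suc_shift, simp)
  ultimately show ?thesis by (simp only: taylor_def add_0)
qed

lemma taylor_0: "taylor y k 0 = (if k = 0 then 0 else y 0)"
  by (cases k) (simp_all add: taylor_def sum.lessThan_Suc_shift del: sum.lessThan_Suc)

lemma taylor_zero [simp]: "taylor y 0 = (\<lambda>t. 0)"
  by (simp add: taylor_def fun_eq_iff)

lemma higher_deriv_taylor: "(deriv ^^ j) (taylor y k) = taylor (\<lambda>l. y (l + j)) (k - j)"
proof (induction j)
  case (Suc j)
  show ?case
  proof (cases "k - j")
    case 0
    then have "k - Suc j = 0" by simp
    then show ?thesis unfolding funpow.simps o_apply Suc.IH 0 by simp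
  next
    case (Suc n)
    have "deriv (taylor (\<lambda>l. y (l + j)) (Suc n)) = taylor (\<lambda>l. y (Suc l + j)) n"
      by (rule ext) (rule DERIV_imp_deriv[OF DERIV_taylor])
    moreover have "k - Suc j = n" using Suc by simp
    ultimately show ?thesis using Suc.IH Suc by simp
  qed
qed simp

lemma taylor_differentiable: "taylor y k differentiable (at t)"
proof (cases k)
  case (Suc n)
  show ?thesis unfolding Suc real_differentiable_def using DERIV_taylor by blast
qed simp

text \<open>Taylor polynomials in the chart, on an interval short enough for their values to stay in
  the open chart image. The curve is therefore smooth in a single chart throughout its
  interval.\<close>

lemma exists_curve:
  assumes M: "atlas M" and i: "i \<in> idx M" "p \<in> cdom M i"
    and y0: "\<And>c. c < mdim M \<Longrightarrow> y 0 c = chart M i p c"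
  obtains d \<gamma> where "d > 0" "smooth_curve {-d<..<d} M \<gamma>" "\<gamma> 0 = p"
    "\<And>t. t \<in> {-d<..<d} \<Longrightarrow> \<gamma> t \<in> cdom M i"
    "\<And>l c. l \<le> k \<Longrightarrow> c < mdim M \<Longrightarrow> (deriv ^^ l) (\<lambda>s. chart M i (\<gamma> s) c) 0 = y l c"
proof -
  \<comment> \<open>\<open>Suc k\<close> terms, so that derivatives up to and including order
    \<open>k\<close> are prescribed.\<close>
  define P where "P c = taylor (\<lambda>l. y l c) (Suc k)" for c
  define x where "x t = (\<lambda>c. if c < mdim M then P c t else 0)" for t
  define \<gamma> where "\<gamma> t = param M i (x t)" for t
  have P0: "P c 0 = y 0 c" for c by (simp add: P_def taylor_0)
  have x0: "x 0 = chart M i p"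
    by (rule coords_eqI[of _ "mdim M"]) (use P0 y0 chart_coords[OF M i] in \<open>auto simp: x_def coords_def\<close>)
  obtain e where e: "e > 0" "\<And>u. u \<in> coords (mdim M) \<Longrightarrow> (\<And>a. a < mdim M \<Longrightarrow> \<bar>u a - x 0 a\<bar> < e) \<Longrightarrow>
      u \<in> chart M i ` cdom M i"
    by (rule openin_coords_box[OF chart_image_open[OF M i(1)], of "x 0"]) (use x0 i in auto)
  have "\<forall>\<^sub>F t in at 0. \<forall>c\<in>{..<mdim M}. \<bar>P c t - P c 0\<bar> < e"
  proof (intro eventually_ball_finite ballI)
    fix c
    have "isCont (P c) 0" unfolding P_def
      by (rule DERIV_isCont[OF DERIV_taylor])
    then show "\<forall>\<^sub>F t in at 0. \<bar>P c t - P c 0\<bar> < e"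
      using e(1) by (auto simp: isCont_def tendsto_iff dist_real_def)
  qed simp
  then obtain d where d: "d > 0" "\<And>t. t \<noteq> 0 \<Longrightarrow> \<bar>t\<bar> < d \<Longrightarrow> \<forall>c<mdim M. \<bar>P c t - P c 0\<bar> < e"
    unfolding eventually_at by (auto simp: dist_real_def)
  have xin: "x t \<in> chart M i ` cdom M i" if "t \<in> {-d<..<d}" for t
  proof (rule e(2))
    show "x t \<in> coords (mdim M)" by (auto simp: x_def coords_def)
    show "\<bar>x t a - x 0 a\<bar> < e" if a: "a < mdim M" for a
      using d(2)[of t] \<open>t \<in> {-d<..<d}\<close> e(1) a by (cases "t = 0") (auto simp: x_def abs_less_iff)
  qed
  have \<gamma>in: "\<gamma> t \<in> cdom M i" if "t \<in> {-d<..<d}" for t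
    unfolding \<gamma>_def by (rule param_in[OF M i(1) xin[OF that] order_refl])
  have ch: "chart M i (\<gamma> t) c = P c t" if "t \<in> {-d<..<d}" "c < mdim M" for t c
    using chart_param[OF M i(1) xin[OF that(1)]] that(2) by (simp add: \<gamma>_def x_def)
  have I: "open {-d<..<d}" by simp
  have hd: "(deriv ^^ l) (\<lambda>s. chart M i (\<gamma> s) c) t = (deriv ^^ l) (P c) t"
    if "t \<in> {-d<..<d}" "c < mdim M" for l t c
    by (rule higher_deriv_cong[OF I _ that(1)]) (use ch that in auto)
  have df: "(deriv ^^ l) (\<lambda>s. chart M i (\<gamma> s) c) differentiable (at t)"
    if "t \<in> {-d<..<d}" "c < mdim M" for l t c
    by (rule differentiable_cong_open[OF I hd that(1)])
       (use that in \<open>simp_all add: P_def higher_deriv_taylor taylor_differentiable\<close>)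
  have "smooth_curve {-d<..<d} M \<gamma>"
  proof (rule curve_smoothI[OF I M])
    fix t assume "t \<in> {-d<..<d}"
    then show "\<exists>j\<in>idx M. \<exists>J. open J \<and> t \<in> J \<and> J \<subseteq> {-d<..<d} \<and> \<gamma> ` J \<subseteq> cdom M j \<and>
      (\<forall>a<mdim M. \<forall>l. \<forall>s\<in>J. (deriv ^^ l) (\<lambda>s. chart M j (\<gamma> s) a) differentiable (at s))"
      using i(1) I \<gamma>in df by (intro bexI[of _ i] exI[of _ "{-d<..<d}"]) auto
  qed
  moreover have "\<gamma> 0 = p" using param_chart[OF M i] by (simp add: \<gamma>_def x0)
  moreover have "(deriv ^^ l) (\<lambda>s. chart M i (\<gamma> s) c) 0 = y l c" if "l \<le> k" "c < mdim M" for l c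
    using hd[of 0 c l] d(1) that by (simp add: P_def higher_deriv_taylor taylor_0)
  ultimately show ?thesis using that d(1) \<gamma>in by blast
qed

section \<open>Prominent elements\<close>

text \<open>For \<open>N = 2 ^ b * m\<close> and \<open>n = A * m + c\<close> this inserts a digit
  \<open>0\<close> at position \<open>b\<close> of \<open>A\<close>: the digits above move up by one
  place, those below and the offset \<open>c\<close> stay.\<close>

definition insert_bit :: "nat \<Rightarrow> nat \<Rightarrow> nat" where
  "insert_bit N n = (n div N) * (2 * N) + n mod N"

lemma insert_bit_block:
  assumes "w < N" shows "insert_bit N (h * N + w) = h * (2 * N) + w"
proof -
  have "(h * N + w) div N = h" "(h * N + w) mod N = w" using assms by simp_all
  then show ?thesis by (simp only: insert_bit_def)
qed

lemma insert_bit_less: "n < 2 ^ a * N \<Longrightarrow> insert_bit N n < 2 ^ a * (2 * N)"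
proof -
  assume n: "n < 2 ^ a * N"
  then have N: "N > 0" by (cases N) auto
  have "n div N < 2 ^ a" using n by (simp add: less_mult_imp_div_less)
  moreover have "n mod N < 2 * N" using mod_less_divisor[OF N, of n] N by linarith
  ultimately show ?thesis unfolding insert_bit_def by (rule block_lt)
qed

lemma insert_bit_add: "N > 0 \<Longrightarrow> insert_bit N (2 ^ a * N + n) = 2 ^ a * (2 * N) + insert_bit N n"
  by (simp add: insert_bit_def algebra_simps)

text \<open>The projection keeps the first half of the coordinates, and the tangent map of a
  selection of coordinates makes the same selection in both halves, its Jacobian having unit vectors
  as rows. Hence \<open>T^a\<close> of the projection reads off the blocks whose digit at the
  projected level is \<open>0\<close>.\<close>

lemma Tmap_iter_foot_coord:
  assumes Y: "atlas Y" and i: "i \<in> idx Y"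
  shows "v \<in> cdom ((TB ^^ a) (TB Y)) i \<Longrightarrow>
     Tmap_iter a (TB Y) Y foot v \<in> cdom ((TB ^^ a) Y) i \<and>
     (\<forall>n<2 ^ a * mdim Y. chart ((TB ^^ a) Y) i (Tmap_iter a (TB Y) Y foot v) n =
        chart ((TB ^^ a) (TB Y)) i v (insert_bit (mdim Y) n))"
proof (induction a arbitrary: v)
  case 0
  then show ?case by (auto simp: TB_cdom TB_chart insert_bit_def)
next
  case (Suc a)
  let ?N = "mdim Y" and ?X' = "(TB ^^ a) (TB Y)" and ?Y' = "(TB ^^ a) Y" and ?F = "Tmap_iter a (TB Y) Y foot"
  have X': "atlas ?X'" by (intro atlas_TB_iter TB_atlas Y)
  have Y': "atlas ?Y'" by (intro atlas_TB_iter Y)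
  have F: "smooth_map ?X' ?Y' ?F" by (intro smooth_Tmap_iter TB_atlas smooth_foot Y)
  have iX: "i \<in> idx ?X'" and iY: "i \<in> idx ?Y'" using i by simp_all
  have v: "v \<in> pts (TB ?X')" "foot v \<in> cdom ?X' i" using Suc.prems by (simp_all add: TB_cdom)
  note IH = Suc.IH[OF v(2)]
  have cd: "Tmap ?X' ?Y' ?F v \<in> cdom (TB ?Y') i"
    using Tmap_in[OF X' Y' F v(1)] IH by (simp add: TB_cdom)
  have "chart (TB ?Y') i (Tmap ?X' ?Y' ?F v) n = chart (TB ?X') i v (insert_bit ?N n)"
    if n: "n < 2 ^ Suc a * ?N" for n
  proof (cases "n < 2 ^ a * ?N")
    case True
    then show ?thesis using IH insert_bit_less[OF True] by (simp add: TB_chart)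
  next
    case False
    define n' where "n' = n - 2 ^ a * ?N"
    have n': "n = 2 ^ a * ?N + n'" "n' < 2 ^ a * ?N" using n False by (auto simp: n'_def)
    then have N: "?N > 0" by (cases "?N") auto
    have b: "insert_bit ?N n' < mdim ?X'" using insert_bit_less[OF n'(2)] by simp
    have "chart (TB ?Y') i (Tmap ?X' ?Y' ?F v) n = components (Tmap ?X' ?Y' ?F v) i n'"
      by (simp add: TB_chart n'(1))
    also have "\<dots> = (\<Sum>b<mdim ?X'. jacobian ?X' i ?Y' i ?F (foot v) n' b * components v i b)"
      using Tmap_components[OF X' Y' F v(1) iX v(2) iY] IH n' by simp
    also have "\<dots> = (\<Sum>b<mdim ?X'. (if insert_bit ?N n' = b then 1 else 0) * components v i b)"
    proof (intro sum.cong refl arg_cong2[of _ _ _ _ "(*)"])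
      fix b assume "b \<in> {..<mdim ?X'}"
      then show "jacobian ?X' i ?Y' i ?F (foot v) n' b = (if insert_bit ?N n' = b then 1 else 0)"
        by (intro jacobian_coord[OF X' iX v(2) _ pts_open[OF X'] cdom_pts[OF X' iX v(2)]])
           (use Suc.IH n' in auto)
    qed
    also have "\<dots> = components v i (insert_bit ?N n')"
      using b by (simp add: if_distrib[of "\<lambda>y. y * _"] cong: if_cong)
    also have "\<dots> = chart (TB ?X') i v (insert_bit ?N n)"
      unfolding n'(1) insert_bit_add[OF N] by (simp add: TB_chart)
    finally show ?thesis .
  qed
  then show ?case using cd by simp
qed

text \<open>Every projection is compared with the topmost one, which drops the highest digit. For
  that one the inserted \<open>0\<close> is a leading digit and leaves the index as it is.\<close>

lemma prominent_insert_bit: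
  assumes M: "atlas M" and i: "i \<in> idx M" and Z: "prominent (Suc s) M Z" and zi: "Z \<in> cdom ((TB ^^ Suc s) M) i"
    and b: "b \<le> s" and n: "n < 2 ^ s * mdim M"
  defines "x \<equiv> chart ((TB ^^ Suc s) M) i Z"
  shows "x (insert_bit (2 ^ b * mdim M) n) = x n"
proof -
  have co: "chart ((TB ^^ s) M) i (proj1 a b M Z) n = x (insert_bit (2 ^ b * mdim M) n)"
    if ab: "a + b = s" for a b
  proof -
    have e: "(TB ^^ a) (TB ((TB ^^ b) M)) = (TB ^^ Suc s) M" "(TB ^^ a) ((TB ^^ b) M) = (TB ^^ s) M"
      using ab by (simp_all add: funpow_add[symmetric, THEN fun_cong, unfolded o_apply] flip: funpow_swap1)
    have e3: "2 ^ a * mdim ((TB ^^ b) M) = 2 ^ s * mdim M" using ab by (simp add: power_add[symmetric])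
    have i': "i \<in> idx ((TB ^^ b) M)" using i by simp
    have zi': "Z \<in> cdom ((TB ^^ a) (TB ((TB ^^ b) M))) i" unfolding e by (rule zi)
    have "chart ((TB ^^ a) ((TB ^^ b) M)) i (Tmap_iter a (TB ((TB ^^ b) M)) ((TB ^^ b) M) foot Z) n =
        chart ((TB ^^ a) (TB ((TB ^^ b) M))) i Z (insert_bit (mdim ((TB ^^ b) M)) n)"
      by (rule conjunct2[OF Tmap_iter_foot_coord[OF atlas_TB_iter[OF M] i' zi'], rule_format])
         (unfold e3, rule n)
    then show ?thesis unfolding e proj1_def x_def by (simp only: TB_iter_sel)
  qed
  \<comment> \<open>The prominence condition with \<open>q = Suc s - b\<close>, so that
    \<open>q - 1 = s - b\<close> and \<open>Suc s - q = b\<close>.\<close>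
  have "proj1 0 s M Z = proj1 (s - b) b M Z"
    using Z b unfolding prominent_def by (auto dest!: bspec[of _ _ "Suc s - b"])
  then have "x (insert_bit (2 ^ b * mdim M) n) = x (insert_bit (2 ^ s * mdim M) n)"
    using co[of "s - b" b] co[of 0 s] b by simp
  also have "insert_bit (2 ^ s * mdim M) n = n" using n by (simp add: insert_bit_def)
  finally show ?thesis .
qed

text \<open>As long as \<open>A\<close> has a digit \<open>0\<close> below a digit \<open>1\<close>,
  prominence allows this \<open>0\<close> to be deleted. The number decreases and its number of ones
  does not change, so the process ends at \<open>2 ^ popcount A - 1\<close>.\<close>

lemma prominent_coord:
  assumes M: "atlas M" and i: "i \<in> idx M" and Z: "prominent (Suc s) M Z" and zi: "Z \<in> cdom ((TB ^^ Suc s) M) i"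
    and c: "c < mdim M"
  defines "x \<equiv> chart ((TB ^^ Suc s) M) i Z"
  shows "A < 2 ^ Suc s \<Longrightarrow> x (A * mdim M + c) = x ((2 ^ popcount A - 1) * mdim M + c)"
proof (induction A rule: less_induct)
  case (less A)
  show ?case
  proof (cases "A = 2 ^ popcount A - 1")
    case False
    then obtain b h l where A: "A = 2 ^ Suc b * h + l" "l < 2 ^ b" "h > 0" using gap_exists by blast
    have "(2::nat) ^ Suc b * 1 \<le> 2 ^ Suc b * h" using A(3) by (intro mult_le_mono2) simp
    then have "(2::nat) ^ Suc b < 2 ^ Suc s" using A(1) less.prems by linarith
    then have "Suc b < Suc s" by (rule power_less_imp_less_exp[rotated]) simp
    then have b: "b \<le> s" by simp
    \<comment> \<open>\<open>A\<close> with its digit \<open>0\<close> at position \<open>b\<close>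
      deleted.\<close>
    let ?B = "2 ^ b * h + l"
    have BA: "?B < A" using A by simp

    have h: "h < 2 ^ (s - b)"
    proof (rule ccontr)
      assume "\<not> h < 2 ^ (s - b)"
      then have "(2::nat) ^ Suc b * 2 ^ (s - b) \<le> 2 ^ Suc b * h" by (intro mult_le_mono2) simp
      moreover have "(2::nat) ^ Suc b * 2 ^ (s - b) = 2 ^ Suc s" using b by (simp flip: power_add)
      ultimately show False using A(1) less.prems by linarith
    qed
    \<comment> \<open>One digit fewer than \<open>A\<close>: the equations coming from prominence
      concern indices of the bundle one level lower.\<close>
    have Bs: "?B < 2 ^ s"
    proof -
      have "h * 2 ^ b + l < 2 ^ (s - b) * 2 ^ b" by (rule block_lt[OF h A(2)])
      then show ?thesis using b by (simp add: mult.commute flip: power_add)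
    qed
    have lt: "l * mdim M + c < 2 ^ b * mdim M" by (rule block_lt[OF A(2) c])
    have "?B * mdim M + c = h * (2 ^ b * mdim M) + (l * mdim M + c)" by (simp add: algebra_simps)
    then have "insert_bit (2 ^ b * mdim M) (?B * mdim M + c) = h * (2 * (2 ^ b * mdim M)) + (l * mdim M + c)"
      using insert_bit_block[OF lt] by (simp only:)
    also have "\<dots> = A * mdim M + c" by (simp add: A(1) algebra_simps)
    finally have "x (A * mdim M + c) = x (?B * mdim M + c)"
      using prominent_insert_bit[OF M i Z zi b block_lt[OF Bs c]] unfolding x_def by simp
    also have "\<dots> = x ((2 ^ popcount ?B - 1) * mdim M + c)"
      using less.IH[OF BA] Bs by simp
    also have "popcount ?B = popcount A"
    proof -
      have "l < 2 ^ Suc b" using A(2) by simp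
      then show ?thesis unfolding A(1) popcount_concat[OF A(2)] by (simp only: popcount_concat)
    qed
    finally show ?thesis .
  qed simp
qed

section \<open>Prominent elements and jets as iterated velocities\<close>

lemma curveI: "d > 0 \<Longrightarrow> smooth_curve {-d<..<d} M \<gamma> \<Longrightarrow> curve M \<gamma>"
  unfolding curve_def by (intro exI[of _ "-d"] exI[of _ d]) simp

lemma curveE:
  assumes "curve M \<gamma>" obtains I where "open I" "0 \<in> I" "smooth_curve I M \<gamma>"
  using assms unfolding curve_def by (metis greaterThanLessThan_iff open_greaterThanLessThan)

text \<open>The hypothesis is the symmetry of the blocks and not prominence, so that the curve found
  here can also be used to deduce prominence from symmetry.\<close>

lemma coord_imp_iter_vel:
  assumes M: "atlas M" and i: "i \<in> idx M" and zi: "Z \<in> cdom ((TB ^^ r) M) i"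
  defines "x \<equiv> chart ((TB ^^ r) M) i Z"
  assumes sym: "\<And>A c. A < 2 ^ r \<Longrightarrow> c < mdim M \<Longrightarrow>
     x (A * mdim M + c) = x ((2 ^ popcount A - 1) * mdim M + c)"
  shows "\<exists>\<gamma>. curve M \<gamma> \<and> iter_vel r M \<gamma> 0 = Z"
proof -
  let ?p = "(foot ^^ r) Z"
  have Zp: "Z \<in> pts ((TB ^^ r) M)" by (rule TB_iter_cdom[OF M zi i])
  have i: "i \<in> idx M" "?p \<in> cdom M i" using i TB_iter_cdom_iff[OF M i Zp] zi by blast+
  obtain d \<gamma> where \<gamma>: "d > 0" "smooth_curve {-d<..<d} M \<gamma>" "\<gamma> 0 = ?p"
    "\<And>t. t \<in> {-d<..<d} \<Longrightarrow> \<gamma> t \<in> cdom M i"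
    "\<And>l c. l \<le> r \<Longrightarrow> c < mdim M \<Longrightarrow>
       (deriv ^^ l) (\<lambda>s. chart M i (\<gamma> s) c) 0 = x ((2 ^ l - 1) * mdim M + c)"
  \<comment> \<open>The derivatives of order \<open>l\<close> are read off the representative block
    \<open>2 ^ l - 1\<close>; for \<open>l = 0\<close> this is the block of the base point, as
    required of a curve through it.\<close>
  proof (rule exists_curve[OF M i, where k = r and y = "\<lambda>l c. x ((2 ^ l - 1) * mdim M + c)"])
    show "x ((2 ^ 0 - 1) * mdim M + c) = chart M i ?p c" if "c < mdim M" for c
      unfolding x_def
      using TB_iter_chart_base[OF that, of r i Z] by (simp only: power_0 diff_self_eq_0 mult_0 add_0)
  qed blast
  have I: "open {-d<..<d}" "0 \<in> {-d<..<d}" using \<gamma>(1) by simp_all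
  have zc: "iter_vel r M \<gamma> 0 \<in> cdom ((TB ^^ r) M) i"
    using TB_iter_cdom_iff[OF M i(1) iter_vel_in[OF I(1) M \<gamma>(2) I(2)]] i(2) \<gamma>(3) by (simp only: feet_iter_vel)
  have "iter_vel r M \<gamma> 0 = Z"
  proof (rule TB_iter_eqI[OF M i(1) zc zi])
    fix A c assume A: "A < (2::nat) ^ r" and c: "c < mdim M"
    have "chart ((TB ^^ r) M) i (iter_vel r M \<gamma> 0) (A * mdim M + c) =
       (deriv ^^ popcount A) (\<lambda>s. chart M i (\<gamma> s) c) 0"
      by (rule iter_vel_coord[OF I(1) M \<gamma>(2) i(1) c I(2) _ A]) (use \<gamma>(4)[OF I(2)] in simp)
    also have "\<dots> = x ((2 ^ popcount A - 1) * mdim M + c)" by (rule \<gamma>(5)[OF popcount_le[OF A] c])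
    also have "\<dots> = x (A * mdim M + c)" by (rule sym[OF A c, symmetric])
    finally show "chart ((TB ^^ r) M) i (iter_vel r M \<gamma> 0) (A * mdim M + c) = chart ((TB ^^ r) M) i Z (A * mdim M + c)"
      unfolding x_def .
  qed
  then show ?thesis using curveI[OF \<gamma>(1,2)] by blast
qed

lemma prominent_iff_coord:
  assumes M: "atlas M" and r: "r \<ge> 1" and i: "i \<in> idx M" and zi: "Z \<in> cdom ((TB ^^ r) M) i"
  defines "x \<equiv> chart ((TB ^^ r) M) i Z"
  shows "prominent r M Z \<longleftrightarrow> (\<forall>A<2 ^ r. \<forall>c<mdim M.
     x (A * mdim M + c) = x ((2 ^ popcount A - 1) * mdim M + c))"
proof
  assume Z: "prominent r M Z"
  obtain s where s: "r = Suc s" using r by (cases r) auto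
  show "\<forall>A<2 ^ r. \<forall>c<mdim M. x (A * mdim M + c) = x ((2 ^ popcount A - 1) * mdim M + c)"
    using prominent_coord[OF M i, of s Z] Z zi unfolding x_def s by blast
next
  assume sym: "\<forall>A<2 ^ r. \<forall>c<mdim M. x (A * mdim M + c) = x ((2 ^ popcount A - 1) * mdim M + c)"
  have "\<exists>\<gamma>. curve M \<gamma> \<and> iter_vel r M \<gamma> 0 = Z"
    by (rule coord_imp_iter_vel[OF M i zi]) (use sym in \<open>unfold x_def, blast\<close>)
  then obtain \<gamma> where \<gamma>: "curve M \<gamma>" "iter_vel r M \<gamma> 0 = Z" by blast
  obtain I where I: "open I" "0 \<in> I" "smooth_curve I M \<gamma>" using \<gamma>(1) by (rule curveE)
  show "prominent r M Z" using prominent_iter_vel[OF I(1) M I(3,2)] \<gamma>(2) by metis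
qed

lemma prominent_imp_iter_vel:
  assumes M: "atlas M" and r: "r \<ge> 1" and Z: "prominent r M Z"
  shows "\<exists>\<gamma>. curve M \<gamma> \<and> iter_vel r M \<gamma> 0 = Z"
proof -
  have Zp: "Z \<in> pts ((TB ^^ r) M)" using Z by (simp only: prominent_def)
  obtain i where i: "i \<in> idx M" "(foot ^^ r) Z \<in> cdom M i" using pts_cdom[OF M TB_iter_foot[OF Zp]] by blast
  have zi: "Z \<in> cdom ((TB ^^ r) M) i" using TB_iter_cdom_iff[OF M i(1) Zp] i(2) by blast
  show ?thesis
    by (rule coord_imp_iter_vel[OF M i(1) zi]) (use prominent_iff_coord[OF M r i(1) zi] Z in blast)
qed

text \<open>Contact of order \<open>k\<close>, defined with all charts, becomes a single equation in
  the iterated tangent bundle. From left to right one chart is enough; from right to left every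
  chart gives its derivatives back. Contact is thereby seen to be an equivalence relation.\<close>

lemma jet0_iff_iter_vel:
  assumes M: "atlas M" and g: "curve M \<gamma>" and d: "curve M \<delta>"
  shows "\<delta> \<in> jet0 k M \<gamma> \<longleftrightarrow> iter_vel k M \<delta> 0 = iter_vel k M \<gamma> 0"
proof -
  obtain I where I: "open I" "0 \<in> I" "smooth_curve I M \<gamma>" using g by (rule curveE)
  obtain J where J: "open J" "0 \<in> J" "smooth_curve J M \<delta>" using d by (rule curveE)
  show ?thesis
  proof
    assume jet: "\<delta> \<in> jet0 k M \<gamma>"
    then have eq: "\<delta> 0 = \<gamma> 0" by (simp add: jet0_def)
    obtain i where i: "i \<in> idx M" "\<gamma> 0 \<in> cdom M i" using pts_cdom[OF M curve_in[OF I(1) M I(3,2)]] by blast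
    show "iter_vel k M \<delta> 0 = iter_vel k M \<gamma> 0"
    proof (rule TB_iter_eqI[OF M i(1)])
      show "iter_vel k M \<delta> 0 \<in> cdom ((TB ^^ k) M) i"
        using TB_iter_cdom_iff[OF M i(1) iter_vel_in[OF J(1) M J(3,2)]] i eq by (simp add: feet_iter_vel)
      show "iter_vel k M \<gamma> 0 \<in> cdom ((TB ^^ k) M) i"
        using TB_iter_cdom_iff[OF M i(1) iter_vel_in[OF I(1) M I(3,2)]] i by (simp add: feet_iter_vel)
      fix A c assume A: "A < (2::nat) ^ k" and c: "c < mdim M"
      show "chart ((TB ^^ k) M) i (iter_vel k M \<delta> 0) (A * mdim M + c) =
            chart ((TB ^^ k) M) i (iter_vel k M \<gamma> 0) (A * mdim M + c)"
        using iter_vel_coord[OF I(1) M I(3) i(1) c I(2) i(2) A] iter_vel_coord[OF J(1) M J(3) i(1) c J(2) _ A]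
          jet i eq c popcount_le[OF A] by (simp add: jet0_def)
    qed
  next
    assume eq: "iter_vel k M \<delta> 0 = iter_vel k M \<gamma> 0"
    have 0: "\<delta> 0 = \<gamma> 0" using arg_cong[OF eq, of "foot ^^ k"] by (simp add: feet_iter_vel)
    \<comment> \<open>The derivative of order \<open>l\<close> is the entry of block
      \<open>2 ^ l - 1\<close>, which exists because \<open>l \<le> k\<close>.\<close>
    have "(deriv ^^ l) (\<lambda>t. chart M i (\<delta> t) c) 0 = (deriv ^^ l) (\<lambda>t. chart M i (\<gamma> t) c) 0"
      if i: "i \<in> idx M" "\<gamma> 0 \<in> cdom M i" and l: "l \<le> k" and c: "c < mdim M" for i l c
      using iter_vel_coord[OF I(1) M I(3) i(1) c I(2) i(2) ones_mono[OF l]]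
        iter_vel_coord[OF J(1) M J(3) i(1) c J(2) _ ones_mono[OF l]] eq 0 i by (simp only: popcount_ones)
    then show "\<delta> \<in> jet0 k M \<gamma>" using d 0 by (simp add: jet0_def)
  qed
qed

section \<open>Submanifolds and pulled back atlases\<close>

text \<open>The index set may be as large as the family of all slice charts. Second countability
  passes to the subspace \<open>S\<close>, which is therefore Lindelof.\<close>

lemma countable_subcover:
  assumes X: "atlas X" and sc: "second_countable (mtop X)" and S: "S \<subseteq> pts X"
    and U: "\<And>a. a \<in> A \<Longrightarrow> openin (mtop X) (U a)" and cov: "S \<subseteq> (\<Union>a\<in>A. U a)"
  obtains B where "B \<subseteq> A" "countable B" "S \<subseteq> (\<Union>a\<in>B. U a)"
proof -
  have "Lindelof_space (subtopology (mtop X) S)"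
    by (intro second_countable_imp_Lindelof_space second_countable_subtopology sc)
  moreover have "\<And>V. V \<in> (\<lambda>a. U a \<inter> S) ` A \<Longrightarrow> openin (subtopology (mtop X) S) V"
    using U by (auto simp: openin_subtopology)
  moreover have "\<Union>((\<lambda>a. U a \<inter> S) ` A) = topspace (subtopology (mtop X) S)"
    using cov S by (auto simp: topspace_mtop[OF X])
  ultimately have "\<exists>V. countable V \<and> V \<subseteq> (\<lambda>a. U a \<inter> S) ` A \<and> \<Union>V = topspace (subtopology (mtop X) S)"
    by (rule Lindelof_spaceD)
  then obtain V where V: "countable V" "V \<subseteq> (\<lambda>a. U a \<inter> S) ` A" "\<Union>V = S"
    using S by (auto simp: topspace_mtop[OF X] Int_absorb1)
  then obtain B where B: "B \<subseteq> A" "countable B" "V = (\<lambda>a. U a \<inter> S) ` B"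
    using countable_subset_image[of V "\<lambda>a. U a \<inter> S" A] by auto
  show ?thesis by (rule that[OF B(1,2)]) (use V(3) B(3) in auto)
qed

lemma Hausdorff_mtopI:
  assumes X: "atlas X" and Y: "atlas Y" and f: "smooth_map X Y f" and inj: "inj_on f (pts X)"
    and H: "Hausdorff_space (mtop Y)"
  shows "Hausdorff_space (mtop X)"
  by (rule Hausdorff_space_injective_preimage[OF H, of _ f])
     (use f inj in \<open>auto simp: smooth_map_def topspace_mtop[OF X]\<close>)

lemma openin_coords_slice:
  assumes "openin (Euclidean_space n) Q" "k \<le> n"
  shows "openin (Euclidean_space k) (Q \<inter> coords k)"
  unfolding openin_coords_iff
proof (intro conjI ballI)
  fix x assume x: "x \<in> Q \<inter> coords k"
  then obtain d where d: "d > 0" "\<And>y. y \<in> coords n \<Longrightarrow> (\<And>a. a < n \<Longrightarrow> \<bar>y a - x a\<bar> < d) \<Longrightarrow> y \<in> Q"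
    by (rule_tac openin_coords_box[OF assms(1), of x]) auto
  have "y \<in> Q \<inter> coords k" if y: "y \<in> coords k" "\<forall>a<k. \<bar>y a - x a\<bar> < d" for y
  proof -
    have "\<bar>y a - x a\<bar> < d" for a
      using y x d(1) by (cases "a < k") (auto simp: coords_def)
    then have "y \<in> Q" using y coords_mono[OF assms(2)] by (intro d(2)) auto
    then show ?thesis using y by simp
  qed
  then show "\<exists>d>0. \<forall>y\<in>coords k. (\<forall>a<k. \<bar>y a - x a\<bar> < d) \<longrightarrow> y \<in> Q \<inter> coords k" using d(1) by blast
qed simp

lemma smooth_between_fewer: "smooth_between m n S f \<Longrightarrow> k \<le> n \<Longrightarrow> smooth_between m k S f"
  by (auto simp: smooth_between_iff)

lemma compatible_chartD:
  assumes "compatible_chart X U \<phi>"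
  shows "openin (mtop X) U" "inj_on \<phi> U" "openin (Euclidean_space (mdim X)) (\<phi> ` U)"
    "i \<in> idx X \<Longrightarrow> smooth_between (mdim X) (mdim X) (chart X i ` (U \<inter> cdom X i)) (\<lambda>x. \<phi> (param X i x))"
    "i \<in> idx X \<Longrightarrow> smooth_between (mdim X) (mdim X) (\<phi> ` (U \<inter> cdom X i)) (\<lambda>x. chart X i (the_inv_into U \<phi> x))"
  using assms unfolding compatible_chart_def by blast+

text \<open>By invariance of domain: \<^const>\<open>compatible_chart\<close> only provides the openness of \<open>\<phi> ` U\<close>.\<close>

lemma compatible_chart_open:
  assumes X: "atlas X" and cc: "compatible_chart X U \<phi>" and W: "openin (mtop X) W" "W \<subseteq> U"
  shows "openin (Euclidean_space (mdim X)) (\<phi> ` W)"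
proof -
  note c = compatible_chartD[OF cc]
  have op: "openin (Euclidean_space (mdim X)) (\<phi> ` (W \<inter> cdom X i))" if i: "i \<in> idx X" for i
  proof -
    let ?Q = "chart X i ` (W \<inter> cdom X i)"
    have Q: "openin (Euclidean_space (mdim X)) ?Q" by (rule chart_open[OF X W(1) i])
    have in_U: "param X i x \<in> U" if "x \<in> ?Q" for x
      using that W(2) param_chart[OF X i] by auto
    have "continuous_map (subtopology (Euclidean_space (mdim X)) ?Q) (Euclidean_space (mdim X)) (\<lambda>x. \<phi> (param X i x))"
    proof (rule smooth_between_cont_on[OF Q])
      show "smooth_between (mdim X) (mdim X) ?Q (\<lambda>x. \<phi> (param X i x))"
        by (rule smooth_between_subset[OF c(4)[OF i]]) (use W in auto)
      show "\<phi> (param X i x) \<in> coords (mdim X)" if "x \<in> ?Q" for x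
        using in_U[OF that] openin_coords_subset[OF c(3)] by auto
    qed
    moreover have "inj_on (\<lambda>x. \<phi> (param X i x)) ?Q"
    proof (rule inj_onI)
      fix x y assume x: "x \<in> ?Q" and y: "y \<in> ?Q" and eq: "\<phi> (param X i x) = \<phi> (param X i y)"
      have "param X i x = param X i y" using c(2) eq in_U[OF x] in_U[OF y] by (meson inj_onD)
      then have "chart X i (param X i x) = chart X i (param X i y)" by simp
      then show "x = y" using x y chart_param[OF X i] by auto
    qed
    ultimately have "openin (Euclidean_space (mdim X)) ((\<lambda>x. \<phi> (param X i x)) ` ?Q)"
      by (rule invariance_of_domain_Euclidean_space[OF Q])
    moreover have "(\<lambda>x. \<phi> (param X i x)) ` ?Q = \<phi> ` (W \<inter> cdom X i)"
      using param_chart[OF X i] by (auto simp: image_image intro!: image_cong)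
    ultimately show ?thesis by simp
  qed
  have "W \<subseteq> pts X" using W(1) openin_mtop_iff[OF X] by blast
  then have "W = (\<Union>i\<in>idx X. W \<inter> cdom X i)" using pts_cdom[OF X] by blast
  then have "\<phi> ` W = (\<Union>i\<in>idx X. \<phi> ` (W \<inter> cdom X i))" by (metis image_UN)
  then show ?thesis using op by auto
qed

section \<open>Submanifolds covered by slice charts\<close>

text \<open>The hypothesis under which \<open>submfd\<close> describes an embedded submanifold. It
  asks for some slice chart at every point of \<open>S\<close>; the conclusions concern the atlas of
  all slice charts.\<close>

locale slice_cover =
  fixes X :: "('p, 'i) mfd" and k :: nat and S :: "'p set"
  assumes manX: "manifold X" and k: "k \<le> mdim X"
    and cover: "p \<in> S \<Longrightarrow> \<exists>U \<phi>. (U, \<phi>) \<in> idx (submfd X k S) \<and> p \<in> U"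
begin

abbreviation "Y \<equiv> submfd X k S"

lemma X: "atlas X" by (rule manifold_atlas[OF manX])

lemma Y_sel [simp]: "mdim Y = k" "pts Y = S" "cdom Y (U, \<phi>) = U \<inter> S" "chart Y (U, \<phi>) = \<phi>"
  by (simp_all add: submfd_def)

lemma Y_idx:
  "(U, \<phi>) \<in> idx Y \<longleftrightarrow> compatible_chart X U \<phi> \<and> \<phi> ` (U \<inter> S) = {x \<in> \<phi> ` U. \<forall>a\<ge>k. x a = 0}"
  by (simp add: submfd_def)

lemma Y_idx_compatible: "(U, \<phi>) \<in> idx Y \<Longrightarrow> compatible_chart X U \<phi>"
  unfolding Y_idx by (rule conjunct1)

lemma S_pts: "S \<subseteq> pts X"
proof
  fix p assume "p \<in> S"
  then obtain U \<phi> where "(U, \<phi>) \<in> idx Y" "p \<in> U" using cover by blast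
  then show "p \<in> pts X" using compatible_chartD(1) openin_mtop_iff[OF X] unfolding Y_idx by blast
qed

lemma slice_image:
  assumes "(U, \<phi>) \<in> idx Y" "W \<subseteq> U"
  shows "\<phi> ` (W \<inter> S) = \<phi> ` W \<inter> coords k"
proof -
  have inj: "inj_on \<phi> U" and eq: "\<phi> ` (U \<inter> S) = {x \<in> \<phi> ` U. \<forall>a\<ge>k. x a = 0}"
    using assms(1) compatible_chartD(2) unfolding Y_idx by blast+
  have "\<phi> p \<in> coords k" if "p \<in> W \<inter> S" for p
  proof -
    have "\<phi> p \<in> \<phi> ` (U \<inter> S)" using that assms(2) by auto
    then show ?thesis unfolding eq by (simp add: coords_def)
  qed
  moreover have "p \<in> S" if "p \<in> W" "\<phi> p \<in> coords k" for p
  proof -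
    have "\<phi> p \<in> \<phi> ` (U \<inter> S)" unfolding eq using that assms(2) by (auto simp: coords_def)
    then obtain q where "q \<in> U \<inter> S" "\<phi> p = \<phi> q" by auto
    then show ?thesis using inj that(1) assms(2) by (auto dest: inj_onD)
  qed
  ultimately show ?thesis by blast
qed

lemma slice_open:
  assumes "(U, \<phi>) \<in> idx Y" "openin (mtop X) W" "W \<subseteq> U"
  shows "openin (Euclidean_space k) (\<phi> ` (W \<inter> S))"
  unfolding slice_image[OF assms(1,3)]
  by (rule openin_coords_slice[OF compatible_chart_open[OF X _ assms(2,3)] k]) (use assms(1) Y_idx in blast)

lemma param_slice:
  assumes "(U, \<phi>) \<in> idx Y" "p \<in> U \<inter> S"
  shows "param Y (U, \<phi>) (\<phi> p) = p" "the_inv_into U \<phi> (\<phi> p) = p"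
proof -
  have inj: "inj_on \<phi> U" using assms(1) compatible_chartD(2) unfolding Y_idx by blast
  then show "the_inv_into U \<phi> (\<phi> p) = p" using assms(2) by (intro the_inv_into_f_f) auto
  have "inj_on \<phi> (U \<inter> S)" using inj by (rule inj_on_subset) auto
  then show "param Y (U, \<phi>) (\<phi> p) = p" using assms(2) unfolding param_def by (simp add: the_inv_into_f_f)
qed

lemma chart_inverse_smooth:
  assumes "(U, \<phi>) \<in> idx Y" "i \<in> idx X" "W \<subseteq> U \<inter> cdom X i"
  shows "smooth_between k (mdim X) (\<phi> ` (W \<inter> S)) (\<lambda>x. chart X i (the_inv_into U \<phi> x))"
proof (rule smooth_between_slice[OF _ k])
  show "smooth_between (mdim X) (mdim X) (\<phi> ` (U \<inter> cdom X i)) (\<lambda>x. chart X i (the_inv_into U \<phi> x))"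
    by (rule compatible_chartD(5)[OF Y_idx_compatible[OF assms(1)] assms(2)])
  show "\<phi> ` (W \<inter> S) \<subseteq> \<phi> ` (U \<inter> cdom X i)" using assms(3) by auto
  show "\<phi> ` (W \<inter> S) \<subseteq> coords k" using slice_image[OF assms(1), of W] assms(3) by blast
qed

text \<open>Two slice charts are compared through a chart of \<open>X\<close>, to which both are
  smoothly related. Such a chart covers only part of the overlap, hence the local criterion for
  smoothness.\<close>

lemma atlas_Y: "atlas Y"
proof -
  have 1: "pts Y = (\<Union>i\<in>idx Y. cdom Y i)" using cover by (force simp: submfd_def)
  have 2: "inj_on (chart Y (U, \<phi>)) (cdom Y (U, \<phi>))" if "(U, \<phi>) \<in> idx Y" for U \<phi>
    using that compatible_chartD(2) unfolding Y_idx by (auto intro: inj_on_subset)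
  have 3: "openin (Euclidean_space (mdim Y)) (chart Y (U, \<phi>) ` (cdom Y (U, \<phi>) \<inter> cdom Y (V, \<psi>)))"
    if "(U, \<phi>) \<in> idx Y" "(V, \<psi>) \<in> idx Y" for U \<phi> V \<psi>
  proof -
    have "cdom Y (U, \<phi>) \<inter> cdom Y (V, \<psi>) = (U \<inter> V) \<inter> S" by auto
    moreover have "openin (mtop X) (U \<inter> V)"
      by (rule openin_Int[OF compatible_chartD(1)[OF Y_idx_compatible[OF that(1)]]
            compatible_chartD(1)[OF Y_idx_compatible[OF that(2)]]])
    ultimately show ?thesis using slice_open[OF that(1), of "U \<inter> V"] by simp
  qed
  have 4: "smooth_between (mdim Y) (mdim Y) (chart Y (U, \<phi>) ` (cdom Y (U, \<phi>) \<inter> cdom Y (V, \<psi>)))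
          (\<lambda>x. chart Y (V, \<psi>) (param Y (U, \<phi>) x))" if u: "(U, \<phi>) \<in> idx Y" and v: "(V, \<psi>) \<in> idx Y" for U \<phi> V \<psi>
  proof (rule smooth_between_local[OF 3[OF u v]])
    fix x assume "x \<in> chart Y (U, \<phi>) ` (cdom Y (U, \<phi>) \<inter> cdom Y (V, \<psi>))"
    then obtain p where p: "p \<in> U" "p \<in> V" "p \<in> S" "x = \<phi> p" by auto
    obtain i where i: "i \<in> idx X" "p \<in> cdom X i" using pts_cdom[OF X] S_pts p(3) by blast
    have cu: "compatible_chart X U \<phi>" and cv: "compatible_chart X V \<psi>" using u v unfolding Y_idx by blast+
    let ?W = "U \<inter> V \<inter> cdom X i"
    \<comment> \<open>The transition map with a detour through the chart \<open>i\<close> of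
      \<open>X\<close>.\<close>
    let ?g = "\<lambda>x. \<psi> (param X i (chart X i (the_inv_into U \<phi> x)))"
    have W: "openin (mtop X) ?W"
      using compatible_chartD(1)[OF cu] compatible_chartD(1)[OF cv] cdom_open[OF X i(1)] by auto
    have T: "openin (Euclidean_space k) (\<phi> ` (?W \<inter> S))" by (rule slice_open[OF u W]) auto
    have inv: "the_inv_into U \<phi> y \<in> ?W \<inter> S \<and> the_inv_into U \<phi> y = param Y (U, \<phi>) y" if "y \<in> \<phi> ` (?W \<inter> S)" for y
    proof -
      from that obtain q where q: "q \<in> ?W \<inter> S" "y = \<phi> q" by blast
      then show ?thesis using param_slice[OF u, of q] by auto
    qed
    have "smooth_between k (mdim X) (\<phi> ` (?W \<inter> S)) ?g"
    proof (rule smooth_between_compose[OF T chart_open_sub[OF X W i(1)], where G = "\<lambda>x. \<psi> (param X i x)"])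
      show "smooth_between (mdim X) (mdim X) (chart X i ` ?W) (\<lambda>x. \<psi> (param X i x))"
        by (rule smooth_between_subset[OF compatible_chartD(4)[OF cv i(1)]]) auto
      show "smooth_between k (mdim X) (\<phi> ` (?W \<inter> S)) (\<lambda>x. chart X i (the_inv_into U \<phi> x))"
        by (rule chart_inverse_smooth[OF u i(1)]) auto
      show "chart X i (the_inv_into U \<phi> y) \<in> chart X i ` ?W" if "y \<in> \<phi> ` (?W \<inter> S)" for y
        using inv[OF that] by blast
    qed auto
    then have "smooth_between k k (\<phi> ` (?W \<inter> S)) ?g" by (rule smooth_between_fewer[OF _ k])
    moreover have "\<psi> (param Y (U, \<phi>) y) a = ?g y a" if "y \<in> \<phi> ` (?W \<inter> S)" for y a
    proof -
      have "param X i (chart X i (the_inv_into U \<phi> y)) = the_inv_into U \<phi> y"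
        by (rule param_chart[OF X i(1)]) (use inv[OF that] in blast)
      then show ?thesis using inv[OF that] by simp
    qed
    ultimately show "\<exists>T g. openin (Euclidean_space (mdim Y)) T \<and> x \<in> T \<and>
         T \<subseteq> chart Y (U, \<phi>) ` (cdom Y (U, \<phi>) \<inter> cdom Y (V, \<psi>)) \<and> smooth_between (mdim Y) (mdim Y) T g \<and>
         (\<forall>y\<in>T. \<forall>a<mdim Y. chart Y (V, \<psi>) (param Y (U, \<phi>) y) a = g y a)"
      using T p i by (intro exI[of _ "\<phi> ` (?W \<inter> S)"] exI[of _ ?g]) auto
  qed
  show ?thesis unfolding atlas_def
  proof (intro conjI ballI)
    show "pts Y = (\<Union>i\<in>idx Y. cdom Y i)" by (rule 1)
  next
    fix i assume "i \<in> idx Y"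
    then show "inj_on (chart Y i) (cdom Y i)" using 2[of "fst i" "snd i"] by simp
  next
    fix i j assume "i \<in> idx Y" "j \<in> idx Y"
    then show "openin (Euclidean_space (mdim Y)) (chart Y i ` (cdom Y i \<inter> cdom Y j))"
      "smooth_between (mdim Y) (mdim Y) (chart Y i ` (cdom Y i \<inter> cdom Y j)) (\<lambda>x. chart Y j (param Y i x))"
      using 3[of "fst i" "snd i" "fst j" "snd j"] 4[of "fst i" "snd i" "fst j" "snd j"]
      by (simp_all only: prod.collapse)
  qed
qed

lemma smooth_inclusion: "smooth_map Y X id"
proof (rule smooth_mapI[OF atlas_Y X])
  fix p assume "p \<in> pts Y"
  then have p: "p \<in> S" by simp
  obtain U \<phi> where u: "(U, \<phi>) \<in> idx Y" "p \<in> U" using cover[OF p] by blast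
  obtain i where i: "i \<in> idx X" "p \<in> cdom X i" using pts_cdom[OF X] S_pts p by blast
  let ?W = "U \<inter> cdom X i"
  have cu: "compatible_chart X U \<phi>" using u unfolding Y_idx by blast
  have W: "openin (mtop X) ?W" using compatible_chartD(1)[OF cu] cdom_open[OF X i(1)] by auto
  have T: "openin (Euclidean_space k) (\<phi> ` (?W \<inter> S))" by (rule slice_open[OF u(1) W]) auto
  have o: "openin (mtop Y) (?W \<inter> S)"
    using T openin_in_chart[OF atlas_Y u(1), of "?W \<inter> S"] by auto
  have "smooth_between k (mdim X) (\<phi> ` (?W \<inter> S)) (local_rep Y (U, \<phi>) X i id)"
  proof (rule smooth_between_cong[OF T chart_inverse_smooth[OF u(1) i(1)]])
    fix x a assume "x \<in> \<phi> ` (?W \<inter> S)"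
    then obtain q where q: "q \<in> ?W \<inter> S" "x = \<phi> q" by blast
    then show "local_rep Y (U, \<phi>) X i id x a = chart X i (the_inv_into U \<phi> x) a"
      using param_slice[OF u(1), of q] by auto
  qed auto
  then show "\<exists>i\<in>idx Y. \<exists>j\<in>idx X. \<exists>U. openin (mtop Y) U \<and> p \<in> U \<and>
       U \<subseteq> cdom Y i \<and> id ` U \<subseteq> cdom X j \<and> smooth_between (mdim Y) (mdim X) (chart Y i ` U) (local_rep Y i X j id)"
    using u i o p by (intro bexI[of _ "(U, \<phi>)"] bexI[of _ i] exI[of _ "?W \<inter> S"]) auto
qed

text \<open>The universal property of an embedded submanifold. It is applied to the iterated tangent
  maps, restricted to prominent elements.\<close>

lemma smooth_into:
  assumes N: "atlas N" and f: "smooth_map N X f" and fS: "\<And>p. p \<in> pts N \<Longrightarrow> f p \<in> S"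
  shows "smooth_map N Y f"
proof (rule smooth_mapI[OF N atlas_Y])
  fix p assume p: "p \<in> pts N"
  obtain j where j: "j \<in> idx N" "p \<in> cdom N j" using pts_cdom[OF N p] by blast
  obtain U \<phi> where u: "(U, \<phi>) \<in> idx Y" "f p \<in> U" using cover[OF fS[OF p]] by blast
  obtain i where i: "i \<in> idx X" "f p \<in> cdom X i" using pts_cdom[OF X] S_pts fS[OF p] by blast
  let ?W = "U \<inter> cdom X i"
  let ?D = "cdom N j \<inter> f -` ?W"
  have cu: "compatible_chart X U \<phi>" using u unfolding Y_idx by blast
  have W: "openin (mtop X) ?W" using compatible_chartD(1)[OF cu] cdom_open[OF X i(1)] by auto
  have D: "openin (mtop N) ?D" "openin (Euclidean_space (mdim N)) (chart N j ` ?D)"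
    by (rule smooth_map_open_chart[OF N f W j(1)])+
  have inD: "param N j x \<in> ?D" if "x \<in> chart N j ` ?D" for x
    by (rule param_in[OF N j(1) that]) blast
  have "smooth_between (mdim N) (mdim X) (chart N j ` ?D) (\<lambda>x. \<phi> (param X i (local_rep N j X i f x)))"
  proof (rule smooth_between_compose[OF D(2) chart_open_sub[OF X W i(1)], where G = "\<lambda>x. \<phi> (param X i x)"])
    show "smooth_between (mdim X) (mdim X) (chart X i ` ?W) (\<lambda>x. \<phi> (param X i x))"
      by (rule compatible_chartD(4)[OF cu i(1)])
    show "smooth_between (mdim N) (mdim X) (chart N j ` ?D) (local_rep N j X i f)"
      by (rule smooth_between_subset[OF smooth_mapD[OF f j(1) i(1)]]) auto
    show "local_rep N j X i f x \<in> chart X i ` ?W" if "x \<in> chart N j ` ?D" for x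
      using inD[OF that] by blast
  qed auto
  then have "smooth_between (mdim N) k (chart N j ` ?D) (local_rep N j Y (U, \<phi>) f)"
  proof (rule smooth_between_cong[OF D(2) smooth_between_fewer[OF _ k]])
    fix x a assume "x \<in> chart N j ` ?D"
    then have "f (param N j x) \<in> cdom X i" using inD by blast
    then show "local_rep N j Y (U, \<phi>) f x a = \<phi> (param X i (local_rep N j X i f x)) a"
      using param_chart[OF X i(1)] by simp
  qed
  moreover have "f ` ?D \<subseteq> U \<inter> S" using fS cdom_pts[OF N j(1)] by auto
  ultimately show "\<exists>i\<in>idx N. \<exists>j\<in>idx Y. \<exists>U. openin (mtop N) U \<and> p \<in> U \<and>
       U \<subseteq> cdom N i \<and> f ` U \<subseteq> cdom Y j \<and> smooth_between (mdim N) (mdim Y) (chart N i ` U) (local_rep N i Y j f)"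
    using u i j D(1) by (intro bexI[of _ j] bexI[of _ "(U, \<phi>)"] exI[of _ ?D]) auto
qed

lemma manifold_Y: "manifold Y"
proof -
  have "Hausdorff_space (mtop Y)"
    by (rule Hausdorff_mtopI[OF atlas_Y X smooth_inclusion]) (use manX in \<open>auto simp: manifold_iff\<close>)
  moreover have "second_countable (mtop Y)"
  proof -
    have op: "openin (mtop X) (fst a)" if "a \<in> idx Y" for a
      using that compatible_chartD(1)[of X "fst a" "snd a"] Y_idx[of "fst a" "snd a"] by simp
    have cv: "S \<subseteq> (\<Union>a\<in>idx Y. fst a)" using cover by fastforce
    have sc: "second_countable (mtop X)" using manX by (simp add: manifold_iff)
    obtain B where B: "B \<subseteq> idx Y" "countable B" "S \<subseteq> (\<Union>a\<in>B. fst a)"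
      by (rule countable_subcover[OF X sc S_pts op cv])
    show ?thesis
    proof (rule second_countable_mtopI[OF atlas_Y B(1,2)])
      show "pts Y \<subseteq> (\<Union>i\<in>B. cdom Y i)" using B(3) by (fastforce simp: submfd_def)
    qed
  qed
  ultimately show ?thesis using atlas_Y by (simp add: manifold_iff)
qed

end

section \<open>Atlases pulled back along a bijection\<close>

text \<open>The index \<open>\<kappa> j\<close> names the chart of \<open>Y\<close> whose pullback
  along \<open>h\<close> is the chart \<open>j\<close> of \<open>V\<close>. Only a subfamily of the
  atlas of \<open>Y\<close> is matched in this way; it covers \<open>Y\<close> because
  \<open>h\<close> is onto.\<close>

locale pullback_atlas =
  fixes V :: "('q, 'j) mfd" and Y :: "('p, 'i) mfd" and h :: "'q \<Rightarrow> 'p" and \<kappa> :: "'j \<Rightarrow> 'i"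
  assumes Y: "manifold Y" and dim: "mdim V = mdim Y" and pts: "pts V = (\<Union>j\<in>idx V. cdom V j)"
    and inj: "inj_on h (pts V)" and onto: "h ` pts V = pts Y"
    and idx: "j \<in> idx V \<Longrightarrow> \<kappa> j \<in> idx Y" and cdom: "j \<in> idx V \<Longrightarrow> h ` cdom V j = cdom Y (\<kappa> j)"
    and chart: "j \<in> idx V \<Longrightarrow> v \<in> cdom V j \<Longrightarrow> chart V j v = chart Y (\<kappa> j) (h v)"
begin

lemma Yp: "atlas Y" by (rule manifold_atlas[OF Y])

lemma cdom_sub: "j \<in> idx V \<Longrightarrow> cdom V j \<subseteq> pts V"
  using pts by auto

lemma chart_image: "j \<in> idx V \<Longrightarrow> A \<subseteq> cdom V j \<Longrightarrow> chart V j ` A = chart Y (\<kappa> j) ` (h ` A)"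
  using chart by (auto simp: image_image intro!: image_cong)

lemma h_Int: "i \<in> idx V \<Longrightarrow> j \<in> idx V \<Longrightarrow> h ` (cdom V i \<inter> cdom V j) = cdom Y (\<kappa> i) \<inter> cdom Y (\<kappa> j)"
  using inj_on_image_Int[OF inj cdom_sub cdom_sub, of i j] cdom by simp

lemma V_chart_inj: "j \<in> idx V \<Longrightarrow> inj_on (chart V j) (cdom V j)"
proof (rule inj_onI)
  fix v w assume j: "j \<in> idx V" and v: "v \<in> cdom V j" and w: "w \<in> cdom V j" and eq: "chart V j v = chart V j w"
  have "chart Y (\<kappa> j) (h v) = chart Y (\<kappa> j) (h w)" using eq chart[OF j v] chart[OF j w] by simp
  moreover have "h v \<in> cdom Y (\<kappa> j)" "h w \<in> cdom Y (\<kappa> j)" using cdom[OF j] v w by blast+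
  ultimately have "h v = h w" using chart_inj[OF Yp idx[OF j]] by (meson inj_onD)
  then show "v = w" using inj cdom_sub[OF j] v w by (meson inj_onD subsetD)
qed

lemma V_param: "j \<in> idx V \<Longrightarrow> v \<in> cdom V j \<Longrightarrow> param V j (chart V j v) = v"
  unfolding param_def by (rule the_inv_into_f_f[OF V_chart_inj])

lemma atlas_V: "atlas V"
  unfolding atlas_def
proof (intro conjI ballI)
  fix i j assume i: "i \<in> idx V" and j: "j \<in> idx V"
  have im: "chart V i ` (cdom V i \<inter> cdom V j) = chart Y (\<kappa> i) ` (cdom Y (\<kappa> i) \<inter> cdom Y (\<kappa> j))"
    using chart_image[OF i, of "cdom V i \<inter> cdom V j"] h_Int[OF i j] by simp
  show op: "openin (Euclidean_space (mdim V)) (chart V i ` (cdom V i \<inter> cdom V j))"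
    unfolding im dim by (rule overlap_open[OF Yp idx[OF i] idx[OF j]])
  show "smooth_between (mdim V) (mdim V) (chart V i ` (cdom V i \<inter> cdom V j)) (\<lambda>x. chart V j (param V i x))"
  proof (rule smooth_between_cong[OF op])
    show "smooth_between (mdim V) (mdim V) (chart V i ` (cdom V i \<inter> cdom V j))
       (\<lambda>x. chart Y (\<kappa> j) (param Y (\<kappa> i) x))"
      unfolding im dim by (rule overlap_smooth[OF Yp idx[OF i] idx[OF j]])
    fix x a assume "x \<in> chart V i ` (cdom V i \<inter> cdom V j)"
    then obtain v where v: "v \<in> cdom V i" "v \<in> cdom V j" "x = chart V i v" by auto
    have "h v \<in> cdom Y (\<kappa> i)" using cdom[OF i] v(1) by blast
    then have "param Y (\<kappa> i) x = h v" using param_chart[OF Yp idx[OF i]] chart[OF i v(1)] v(3) by simp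
    then show "chart V j (param V i x) a = chart Y (\<kappa> j) (param Y (\<kappa> i) x) a"
      using V_param[OF i v(1)] v(3) chart[OF j v(2)] by simp
  qed
qed (use pts V_chart_inj in auto)

lemma smooth_h: "smooth_map V Y h"
proof (rule smooth_mapI[OF atlas_V Yp])
  fix v assume "v \<in> pts V"
  then obtain j where j: "j \<in> idx V" "v \<in> cdom V j" using pts by auto
  have "smooth_between (mdim V) (mdim Y) (chart V j ` cdom V j) (local_rep V j Y (\<kappa> j) h)"
    by (rule smooth_between_cong[OF chart_image_open[OF atlas_V j(1)], of _ "\<lambda>x. x"])
       (use chart[OF j(1)] V_param[OF j(1)] in \<open>auto simp: smooth_between_iff smooth_fun_coord\<close>)
  then show "\<exists>i\<in>idx V. \<exists>j\<in>idx Y. \<exists>U. openin (mtop V) U \<and> v \<in> U \<and>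
       U \<subseteq> cdom V i \<and> h ` U \<subseteq> cdom Y j \<and> smooth_between (mdim V) (mdim Y) (chart V i ` U) (local_rep V i Y j h)"
    using j idx[OF j(1)] cdom[OF j(1)] cdom_open[OF atlas_V j(1)]
    by (intro bexI[of _ j] bexI[of _ "\<kappa> j"] exI[of _ "cdom V j"]) auto
qed

text \<open>In matched charts \<open>h\<close> and any left inverse of it are both represented by
  the identity.\<close>

lemma smooth_inverse:
  assumes g: "\<And>v. v \<in> pts V \<Longrightarrow> g (h v) = v"
  shows "smooth_map Y V g"
proof (rule smooth_mapI[OF Yp atlas_V])
  fix y assume "y \<in> pts Y"
  then obtain v where v: "v \<in> pts V" "y = h v" using onto by auto
  then obtain j where j: "j \<in> idx V" "v \<in> cdom V j" using pts by auto
  have gU: "g w \<in> cdom V j \<and> chart V j (g w) = chart Y (\<kappa> j) w" if w: "w \<in> cdom Y (\<kappa> j)" for w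
  proof -
    obtain u where "u \<in> cdom V j" "w = h u" using w cdom[OF j(1)] by blast
    then show ?thesis using g[of u] cdom_sub[OF j(1)] chart[OF j(1)] by auto
  qed
  have "smooth_between (mdim Y) (mdim V) (chart Y (\<kappa> j) ` cdom Y (\<kappa> j)) (local_rep Y (\<kappa> j) V j g)"
    by (rule smooth_between_cong[OF chart_image_open[OF Yp idx[OF j(1)]], of _ "\<lambda>x. x"])
       (use gU param_chart[OF Yp idx[OF j(1)]] in \<open>auto simp: smooth_between_iff smooth_fun_coord\<close>)
  then show "\<exists>i\<in>idx Y. \<exists>j\<in>idx V. \<exists>U. openin (mtop Y) U \<and> y \<in> U \<and>
       U \<subseteq> cdom Y i \<and> g ` U \<subseteq> cdom V j \<and> smooth_between (mdim Y) (mdim V) (chart Y i ` U) (local_rep Y i V j g)"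
    using j v idx[OF j(1)] cdom[OF j(1)] cdom_open[OF Yp idx[OF j(1)]] gU
    by (intro bexI[of _ j] bexI[of _ "\<kappa> j"] exI[of _ "cdom Y (\<kappa> j)"]) auto
qed

lemma manifold_V: "manifold V"
proof -
  have "Hausdorff_space (mtop V)"
    by (rule Hausdorff_mtopI[OF atlas_V Yp smooth_h inj]) (use Y in \<open>simp add: manifold_iff\<close>)
  moreover have "second_countable (mtop V)"
  proof -
    have op: "openin (mtop Y) (cdom Y (\<kappa> j))" if "j \<in> idx V" for j by (rule cdom_open[OF Yp idx[OF that]])
    have cv: "pts Y \<subseteq> (\<Union>j\<in>idx V. cdom Y (\<kappa> j))" unfolding onto[symmetric] pts using cdom by blast
    have sc: "second_countable (mtop Y)" using Y by (simp add: manifold_iff)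
    obtain B where B: "B \<subseteq> idx V" "countable B" "pts Y \<subseteq> (\<Union>j\<in>B. cdom Y (\<kappa> j))"
      by (rule countable_subcover[OF Yp sc subset_refl op cv])
    show ?thesis
    proof (rule second_countable_mtopI[OF atlas_V B(1,2)], rule subsetI)
      fix v assume v: "v \<in> pts V"
      then obtain j where j: "j \<in> B" "h v \<in> cdom Y (\<kappa> j)" using B(3) onto by blast
      then obtain u where "u \<in> cdom V j" "h v = h u" using cdom B(1) by blast
      then have "v = u" using inj v cdom_sub[of j] B(1) j(1) by (meson inj_onD subsetD)
      then show "v \<in> (\<Union>j\<in>B. cdom V j)" using \<open>u \<in> cdom V j\<close> j(1) by blast
    qed
  qed
  ultimately show ?thesis using atlas_V by (simp add: manifold_iff)
qed

end

text \<open>If \<open>v\<close> solves the linear system for \<open>f \<circ> \<theta>\<close>, then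
  the image of \<open>v\<close> under the differential of \<open>\<theta>\<close> solves it for
  \<open>f\<close>. This settles all charts of \<open>Y\<close> at once.\<close>

lemma surjective_submersion_factor:
  assumes Z: "atlas Z" and Y: "atlas Y" and M: "atlas M"
    and g: "surjective_submersion Z M g" and \<theta>: "smooth_map Z Y \<theta>" and onto: "\<theta> ` pts Z = pts Y"
    and f: "smooth_map Y M f" and eq: "\<And>z. z \<in> pts Z \<Longrightarrow> f (\<theta> z) = g z"
  shows "surjective_submersion Y M f"
  unfolding surjective_submersion_def
proof (intro conjI ballI impI allI)
  have gp: "g ` pts Z = pts M" and gs: "smooth_map Z M g" using g by (simp_all add: surjective_submersion_def)
  show "smooth_map Y M f" by (rule f)
  show "f ` pts Y = pts M" unfolding onto[symmetric] gp[symmetric] using eq by force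
  fix y j i and w :: "nat \<Rightarrow> real"
  assume "y \<in> pts Y" and j: "j \<in> idx Y" "y \<in> cdom Y j" and i: "i \<in> idx M" "f y \<in> cdom M i"
  then obtain z where z: "z \<in> pts Z" "y = \<theta> z" using onto by auto
  obtain l where l: "l \<in> idx Z" "z \<in> cdom Z l" using pts_cdom[OF Z z(1)] by blast
  have gz: "g z \<in> cdom M i" using eq[OF z(1)] z(2) i(2) by simp
  from g have "\<exists>v. \<forall>a<mdim M. (\<Sum>b<mdim Z. jacobian Z l M i g z a b * v b) = w a"
    unfolding surjective_submersion_def using z(1) l i(1) gz by blast
  then obtain v where v: "\<And>a. a < mdim M \<Longrightarrow> (\<Sum>b<mdim Z. jacobian Z l M i g z a b * v b) = w a" by blast
  have *: "(\<Sum>c<mdim Y. jacobian Y j M i f y a c * (\<Sum>b<mdim Z. jacobian Z l Y j \<theta> z c b * v b)) = w a"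
    if a: "a < mdim M" for a
  proof -
    have "(\<Sum>c<mdim Y. jacobian Y j M i f y a c * jacobian Z l Y j \<theta> z c b) = jacobian Z l M i g z a b"
      if b: "b < mdim Z" for b
    proof -
      have "jacobian Z l M i g z a b = jacobian Z l M i (f \<circ> \<theta>) z a b"
        by (rule jacobian_cong[OF Z l b pts_open[OF Z] z(1)]) (use eq in simp)
      then show ?thesis
        using jacobian_compose_maps[OF Z Y M \<theta> f l, of j i a b] j i z(2) a b by simp
    qed
    then show ?thesis unfolding matvec_assoc using v[OF a] by simp
  qed
  show "\<exists>v. \<forall>a<mdim M. (\<Sum>b<mdim Y. jacobian Y j M i f y a b * v b) = w a"
    by (rule exI[of _ "\<lambda>c. \<Sum>b<mdim Z. jacobian Z l Y j \<theta> z c b * v b"]) (use * in blast)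
qed

section \<open>Slice charts of the osculating bundle\<close>

text \<open>A chart followed by a global diffeomorphism \<open>L\<close> of the coordinate space,
  with inverse \<open>K\<close>. Images under \<open>L\<close> are preimages under \<open>K\<close>,
  which gives their openness.\<close>

lemma compatible_chart_diffeo:
  assumes X: "atlas X" and i: "i \<in> idx X"
    and L: "smooth_between (mdim X) (mdim X) (coords (mdim X)) L" "\<And>x. x \<in> coords (mdim X) \<Longrightarrow> L x \<in> coords (mdim X)"
    and K: "smooth_between (mdim X) (mdim X) (coords (mdim X)) K" "\<And>x. x \<in> coords (mdim X) \<Longrightarrow> K x \<in> coords (mdim X)"
    and KL: "\<And>x. x \<in> coords (mdim X) \<Longrightarrow> K (L x) = x" and LK: "\<And>x. x \<in> coords (mdim X) \<Longrightarrow> L (K x) = x"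
  shows "compatible_chart X (cdom X i) (\<lambda>p. L (chart X i p))"
proof -
  let ?coords = "coords (mdim X)" and ?\<phi> = "\<lambda>p. L (chart X i p)"
  have ch: "chart X i p \<in> ?coords" if "p \<in> cdom X i" for p by (rule chart_coords[OF X i that])
  have inj: "inj_on ?\<phi> (cdom X i)"
  proof (rule inj_onI)
    fix p q assume p: "p \<in> cdom X i" and q: "q \<in> cdom X i" and eq: "?\<phi> p = ?\<phi> q"
    have "chart X i p = chart X i q" using arg_cong[OF eq, of K] KL[OF ch[OF p]] KL[OF ch[OF q]] by simp
    then show "p = q" using chart_inj[OF X i] p q by (meson inj_onD)
  qed
  have im: "?\<phi> ` W = {y \<in> ?coords. K y \<in> chart X i ` W}" if W: "W \<subseteq> cdom X i" for W
  proof
    show "?\<phi> ` W \<subseteq> {y \<in> ?coords. K y \<in> chart X i ` W}" using ch W L(2) KL by auto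
    show "{y \<in> ?coords. K y \<in> chart X i ` W} \<subseteq> ?\<phi> ` W"
    proof
      fix y assume "y \<in> {y \<in> ?coords. K y \<in> chart X i ` W}"
      then obtain p where p: "y \<in> ?coords" "p \<in> W" "K y = chart X i p" by auto
      have "y = ?\<phi> p" using LK[OF p(1)] p(3) by simp
      then show "y \<in> ?\<phi> ` W" using p(2) by blast
    qed
  qed
  have op: "openin (Euclidean_space (mdim X)) (?\<phi> ` W)"
    if W: "W \<subseteq> cdom X i" and o: "openin (Euclidean_space (mdim X)) (chart X i ` W)" for W
    unfolding im[OF W] by (rule openin_preimage_smooth_between[OF openin_coords_UNIV K o])
  show ?thesis
    unfolding compatible_chart_def
  proof (intro conjI ballI)
    show "openin (mtop X) (cdom X i)" by (rule cdom_open[OF X i])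
    show "inj_on ?\<phi> (cdom X i)" by (rule inj)
    show "openin (Euclidean_space (mdim X)) (?\<phi> ` cdom X i)"
      by (rule op[OF subset_refl chart_image_open[OF X i]])
    fix j assume j: "j \<in> idx X"
    let ?W = "cdom X i \<inter> cdom X j"
    have W: "openin (mtop X) ?W" using cdom_open[OF X i] cdom_open[OF X j] by auto
    have oj: "openin (Euclidean_space (mdim X)) (chart X j ` ?W)" by (rule chart_open_sub[OF X W j]) auto
    have oi: "openin (Euclidean_space (mdim X)) (chart X i ` ?W)" by (rule overlap_open[OF X i j])
    have sub: "?W \<subseteq> cdom X i" by blast
    show "smooth_between (mdim X) (mdim X) (chart X j ` ?W) (\<lambda>x. L (chart X i (param X j x)))"
    proof (rule smooth_between_compose[OF oj openin_coords_UNIV _ L(1)])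
      show "smooth_between (mdim X) (mdim X) (chart X j ` ?W) (\<lambda>x. chart X i (param X j x))"
        using overlap_smooth[OF X j i] by (simp add: Int_commute)
      show "chart X i (param X j x) \<in> ?coords" if "x \<in> chart X j ` ?W" for x
        using that param_chart[OF X j] ch by auto
    qed
    show "smooth_between (mdim X) (mdim X) (?\<phi> ` ?W) (\<lambda>x. chart X j (the_inv_into (cdom X i) ?\<phi> x))"
    proof (rule smooth_between_cong[OF op[OF sub oi]])
      show "smooth_between (mdim X) (mdim X) (?\<phi> ` ?W) (\<lambda>x. chart X j (param X i (K x)))"
      proof (rule smooth_between_compose[OF op[OF sub oi] oi _ overlap_smooth[OF X i j]])
        show "smooth_between (mdim X) (mdim X) (?\<phi> ` ?W) K"
          by (rule smooth_between_subset[OF K(1)]) (use im[OF sub] in blast)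
        show "K x \<in> chart X i ` ?W" if "x \<in> ?\<phi> ` ?W" for x using that unfolding im[OF sub] by simp
      qed
      fix x a assume "x \<in> ?\<phi> ` ?W"
      then obtain p where p: "p \<in> ?W" "x = ?\<phi> p" by blast
      have "the_inv_into (cdom X i) ?\<phi> x = p" unfolding p(2) by (rule the_inv_into_f_f[OF inj]) (use p in simp)
      moreover have "param X i (K x) = p" using p KL[OF ch, of p] param_chart[OF X i, of p] by simp
      ultimately show "chart X j (the_inv_into (cdom X i) ?\<phi> x) a = chart X j (param X i (K x)) a" by simp
    qed
  qed
qed

text \<open>
  Coordinates of \<open>T\<^sup>r M\<close> are indexed by \<open>A * m + c\<close> with \<open>A < 2 ^ r\<close>; the bits of \<open>A\<close> are the
  tangent directions. The block \<open>2 ^ l - 1\<close> represents all blocks with \<open>l\<close> bits.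
\<close>

definition block_rep :: "nat \<Rightarrow> nat \<Rightarrow> nat" where
  "block_rep m k = (2 ^ (k div m) - 1) * m + k mod m"

text \<open>A left inverse of \<open>block_rep\<close>. In general it sends a coordinate to the
  position of its representative among the free coordinates.\<close>

definition block_num :: "nat \<Rightarrow> nat \<Rightarrow> nat" where
  "block_num m j = popcount (j div m) * m + j mod m"

lemma block_rep_num: "block_rep m (block_num m j) = (2 ^ popcount (j div m) - 1) * m + j mod m"
  by (cases "m = 0") (simp_all add: block_rep_def block_num_def)

lemma block_num_rep: "m > 0 \<Longrightarrow> block_num m (block_rep m k) = k"
  by (simp add: block_rep_def block_num_def popcount_ones del: One_nat_def)

lemma block_rep_less:
  assumes "k < (r + 1) * m" shows "block_rep m k < 2 ^ r * m"
proof -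
  have m: "m > 0" using assms by (cases m) auto
  have "k div m < r + 1" using assms by (simp add: less_mult_imp_div_less)
  then have "2 ^ (k div m) - 1 < (2::nat) ^ r" by (intro ones_mono) simp
  then show ?thesis unfolding block_rep_def by (rule block_lt) (use m in simp)
qed

lemma block_num_less:
  assumes "j < 2 ^ r * m" shows "block_num m j < (r + 1) * m"
proof -
  have m: "m > 0" using assms by (cases m) auto
  have "popcount (j div m) < r + 1"
    using popcount_le[of "j div m" r] assms by (simp add: less_mult_imp_div_less)
  then show ?thesis unfolding block_num_def by (rule block_lt) (use m in simp)
qed

text \<open>A slice chart has to place the free coordinates first, so the representatives are
  enumerated by the first \<open>(r + 1) * m\<close> indices. Any enumeration of the other
  coordinates completes the permutation, and \<open>r + 1 \<le> 2 ^ r\<close> provides the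
  room.\<close>

lemma exists_index_bijection:
  "\<exists>\<tau>. bij_betw \<tau> {..<2 ^ r * m} {..<2 ^ r * m} \<and> (\<forall>k<(r + 1) * m. \<tau> k = block_rep m k)"
proof -
  let ?n = "2 ^ r * m" and ?K = "(r + 1) * m"
  have "r + 1 \<le> 2 ^ r" using less_exp[of r] by linarith
  then have Kn: "?K \<le> ?n" by (rule mult_le_mono1)
  have inj: "inj_on (block_rep m) {..<?K}"
  proof (rule inj_on_inverseI)
    fix k assume "k \<in> {..<?K}"
    then have "m > 0" by (cases m) auto
    then show "block_num m (block_rep m k) = k" by (rule block_num_rep)
  qed
  have sub: "block_rep m ` {..<?K} \<subseteq> {..<?n}" using block_rep_less by auto
  have "card ({..<?n} - block_rep m ` {..<?K}) = card {?K..<?n}"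
    using card_Diff_subset[OF _ sub] card_image[OF inj] by simp
  then obtain \<beta> where \<beta>: "bij_betw \<beta> {?K..<?n} ({..<?n} - block_rep m ` {..<?K})"
    using finite_same_card_bij[of "{?K..<?n}" "{..<?n} - block_rep m ` {..<?K}"] by auto
  define \<tau> where "\<tau> k = (if k < ?K then block_rep m k else \<beta> k)" for k
  have "bij_betw \<tau> {..<?K} (block_rep m ` {..<?K})"
    using inj_on_imp_bij_betw[OF inj] by (rule bij_betw_cong[THEN iffD1, rotated]) (simp add: \<tau>_def)
  moreover have "bij_betw \<tau> {?K..<?n} ({..<?n} - block_rep m ` {..<?K})"
    using \<beta> by (rule bij_betw_cong[THEN iffD1, rotated]) (simp add: \<tau>_def)
  ultimately have "bij_betw \<tau> ({..<?K} \<union> {?K..<?n}) (block_rep m ` {..<?K} \<union> ({..<?n} - block_rep m ` {..<?K}))"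
    by (rule bij_betw_combine) blast
  moreover have "{..<?K} \<union> {?K..<?n} = {..<?n}" using Kn by auto
  moreover have "block_rep m ` {..<?K} \<union> ({..<?n} - block_rep m ` {..<?K}) = {..<?n}" using sub by blast
  ultimately show ?thesis by (intro exI[of _ \<tau>]) (simp add: \<tau>_def)
qed

definition index_bij :: "nat \<Rightarrow> nat \<Rightarrow> nat \<Rightarrow> nat" where
  "index_bij r m = (SOME \<tau>. bij_betw \<tau> {..<2 ^ r * m} {..<2 ^ r * m} \<and> (\<forall>k<(r + 1) * m. \<tau> k = block_rep m k))"

lemma index_bij:
  "bij_betw (index_bij r m) {..<2 ^ r * m} {..<2 ^ r * m}"
  "k < (r + 1) * m \<Longrightarrow> index_bij r m k = block_rep m k"
  using someI_ex[OF exists_index_bijection[of r m]] unfolding index_bij_def by blast+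

definition index_inv :: "nat \<Rightarrow> nat \<Rightarrow> nat \<Rightarrow> nat" where
  "index_inv r m = inv_into {..<2 ^ r * m} (index_bij r m)"

lemma index_inv:
  assumes "j < 2 ^ r * m"
  shows "index_inv r m j < 2 ^ r * m" "index_bij r m (index_inv r m j) = j"
proof -
  have j: "j \<in> index_bij r m ` {..<2 ^ r * m}" using index_bij(1) assms by (auto simp: bij_betw_def)
  show "index_inv r m j < 2 ^ r * m" using inv_into_into[OF j] by (simp add: index_inv_def)
  show "index_bij r m (index_inv r m j) = j" using f_inv_into_f[OF j] by (simp add: index_inv_def)
qed

lemma index_inv_bij: "k < 2 ^ r * m \<Longrightarrow> index_inv r m (index_bij r m k) = k"
  unfolding index_inv_def using index_bij(1) by (intro inv_into_f_f) (auto simp: bij_betw_def)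

lemma index_bij_less: "k < 2 ^ r * m \<Longrightarrow> index_bij r m k < 2 ^ r * m"
  using index_bij(1) by (auto simp: bij_betw_def)

text \<open>A linear isomorphism: representatives are kept, and every other coordinate is replaced
  by its difference from its representative. The symmetric points become the slice on which all the
  differences vanish.\<close>

definition straighten :: "nat \<Rightarrow> nat \<Rightarrow> (nat \<Rightarrow> real) \<Rightarrow> nat \<Rightarrow> real" where
  "straighten r m x k =
     (if k < (r + 1) * m then x (block_rep m k)
      else if k < 2 ^ r * m then x (index_bij r m k) - x (block_rep m (block_num m (index_bij r m k)))
      else 0)"

definition unstraighten :: "nat \<Rightarrow> nat \<Rightarrow> (nat \<Rightarrow> real) \<Rightarrow> nat \<Rightarrow> real" where
  "unstraighten r m y j =
     (if j < 2 ^ r * m then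
        (if index_inv r m j < (r + 1) * m then y (index_inv r m j)
         else y (index_inv r m j) + y (block_num m j))
      else 0)"

lemma dim_le: "(r + 1) * m \<le> 2 ^ r * (m::nat)"
proof -
  have "r + 1 \<le> 2 ^ r" using less_exp[of r] by linarith
  then show ?thesis by (rule mult_le_mono1)
qed

lemma straighten_coords: "straighten r m x \<in> coords (2 ^ r * m)"
  using dim_le[of r m] by (auto simp: straighten_def coords_def)

lemma unstraighten_coords: "unstraighten r m x \<in> coords (2 ^ r * m)"
  by (auto simp: unstraighten_def coords_def)

lemma smooth_straighten: "smooth_between n l (coords n) (straighten r m)"
proof -
  have "smooth_fun n (coords n) (\<lambda>x. x i - x j)" for i j
  proof -
    have "smooth_fun n (coords n) (\<lambda>x. x i + (- 1) * x j)"
      by (intro smooth_fun_add[OF openin_coords_UNIV] smooth_fun_mult[OF openin_coords_UNIV] smooth_fun_coord smooth_fun_const)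
    then show ?thesis by simp
  qed
  then have "smooth_fun n (coords n) (\<lambda>x. straighten r m x k)" for k
    by (cases "k < (r + 1) * m"; cases "k < 2 ^ r * m")
       (simp_all only: straighten_def if_True if_False smooth_fun_coord smooth_fun_const)
  then show ?thesis by (simp only: smooth_between_iff simp_thms)
qed

lemma smooth_unstraighten: "smooth_between n l (coords n) (unstraighten r m)"
  unfolding smooth_between_iff
proof (intro allI impI)
  fix j
  show "smooth_fun n (coords n) (\<lambda>x. unstraighten r m x j)"
    by (cases "j < 2 ^ r * m"; cases "index_inv r m j < (r + 1) * m")
       (simp_all add: unstraighten_def smooth_fun_coord smooth_fun_const smooth_fun_add[OF openin_coords_UNIV])
qed

lemma unstraighten_straighten:
  assumes "x \<in> coords (2 ^ r * m)" shows "unstraighten r m (straighten r m x) = x"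
proof (rule coords_eqI[OF unstraighten_coords assms])
  fix j assume j: "j < 2 ^ r * m"
  note ij = index_inv[OF j]
  show "unstraighten r m (straighten r m x) j = x j"
  proof (cases "index_inv r m j < (r + 1) * m")
    case True
    have "block_rep m (index_inv r m j) = j" using index_bij(2)[OF True] ij(2) by simp
    then show ?thesis using True j by (simp add: unstraighten_def straighten_def)
  next
    case False
    have "straighten r m x (index_inv r m j) = x j - x (block_rep m (block_num m j))"
      using False ij by (simp add: straighten_def)
    moreover have "straighten r m x (block_num m j) = x (block_rep m (block_num m j))"
      using block_num_less[OF j] by (simp add: straighten_def)
    ultimately show ?thesis using False j by (simp add: unstraighten_def)
  qed
qed

lemma unstraighten_block_rep:
  assumes "k < (r + 1) * m" shows "unstraighten r m y (block_rep m k) = y k"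
proof -
  have "index_inv r m (block_rep m k) = k"
    using index_inv_bij[of k r m] index_bij(2)[OF assms] assms dim_le[of r m] by simp
  then show ?thesis using assms block_rep_less[OF assms] by (simp add: unstraighten_def)
qed

lemma straighten_unstraighten:
  assumes "y \<in> coords (2 ^ r * m)" shows "straighten r m (unstraighten r m y) = y"
proof (rule coords_eqI[OF straighten_coords assms])
  fix k assume k: "k < 2 ^ r * m"
  show "straighten r m (unstraighten r m y) k = y k"
  proof (cases "k < (r + 1) * m")
    case True
    then show ?thesis using unstraighten_block_rep[OF True] by (simp add: straighten_def)
  next
    case False
    let ?j = "index_bij r m k"
    have j: "?j < 2 ^ r * m" by (rule index_bij_less[OF k])
    have "unstraighten r m y ?j = y k + y (block_num m ?j)"
      using False j index_inv_bij[OF k] by (simp add: unstraighten_def)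
    moreover have "unstraighten r m y (block_rep m (block_num m ?j)) = y (block_num m ?j)"
      by (rule unstraighten_block_rep[OF block_num_less[OF j]])
    ultimately show ?thesis using False k by (simp add: straighten_def)
  qed
qed

text \<open>For a representative the symmetry equation is trivial; for any other coordinate it says
  that the difference stored by \<open>straighten\<close> is zero.\<close>

lemma straighten_slice_iff:
  "(\<forall>k\<ge>(r + 1) * m. straighten r m x k = 0) \<longleftrightarrow>
     (\<forall>A<2 ^ r. \<forall>c<m. x (A * m + c) = x ((2 ^ popcount A - 1) * m + c))"
proof -
  have "(\<forall>k\<ge>(r + 1) * m. straighten r m x k = 0) \<longleftrightarrow> (\<forall>j<2 ^ r * m. x j = x (block_rep m (block_num m j)))"
    (is "?L \<longleftrightarrow> ?R")
  proof
    assume L: ?L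
    show ?R
    proof (intro allI impI)
      fix j assume j: "j < 2 ^ r * m"
      note ij = index_inv[OF j]
      show "x j = x (block_rep m (block_num m j))"
      proof (cases "index_inv r m j < (r + 1) * m")
        case True
        have "m > 0" using j by (cases m) auto
        moreover have "block_rep m (index_inv r m j) = j" using index_bij(2)[OF True] ij(2) by simp
        ultimately show ?thesis using block_num_rep by metis
      next
        case False
        then show ?thesis using L[rule_format, of "index_inv r m j"] ij by (simp add: straighten_def)
      qed
    qed
  next
    assume R: ?R
    show ?L
    proof (intro allI impI)
      fix k assume "k \<ge> (r + 1) * m"
      then show "straighten r m x k = 0"
        using R[rule_format, OF index_bij_less[of k r m]] by (simp add: straighten_def)
    qed
  qed
  also have "\<dots> \<longleftrightarrow> (\<forall>A<2 ^ r. \<forall>c<m. x (A * m + c) = x ((2 ^ popcount A - 1) * m + c))"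
    (is "?L \<longleftrightarrow> ?R")
  proof
    assume L: ?L
    show ?R
    proof (intro allI impI)
      fix A c assume A: "A < (2::nat) ^ r" and c: "c < m"
      show "x (A * m + c) = x ((2 ^ popcount A - 1) * m + c)"
        using L[rule_format, OF block_lt[OF A c]] c unfolding block_rep_num by simp
    qed
  next
    assume R: ?R
    show ?L
    proof (intro allI impI)
      fix j assume j: "j < 2 ^ r * m"
      then have m: "m > 0" by (cases m) auto
      show "x j = x (block_rep m (block_num m j))"
        using R[rule_format, of "j div m" "j mod m"] j m unfolding block_rep_num
        by (simp add: less_mult_imp_div_less)
    qed
  qed
  finally show ?thesis .
qed

section \<open>The comparison of jets and prominent elements\<close>

text \<open>The total space of \<open>osc\<close>, with the index shifted so that \<open>r\<close>
  is the number of tangent functors.\<close>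

definition osc_total ::
    "nat \<Rightarrow> ('a, 'i) manif \<Rightarrow> (('a, 'i) pt, ('a, 'i) pt set \<times> (('a, 'i) pt \<Rightarrow> nat \<Rightarrow> real)) mfd" where
  "osc_total r M = submfd ((TB ^^ r) M) ((r + 1) * mdim M) {Z. prominent r M Z}"

definition osc_chart ::
    "nat \<Rightarrow> ('a, 'i) manif \<Rightarrow> 'i \<Rightarrow> ('a, 'i) pt set \<times> (('a, 'i) pt \<Rightarrow> nat \<Rightarrow> real)" where
  "osc_chart r M i = (cdom ((TB ^^ r) M) i, \<lambda>p. straighten r (mdim M) (chart ((TB ^^ r) M) i p))"

lemma osc_total_sel [simp]:
  "mdim (osc_total r M) = (r + 1) * mdim M" "pts (osc_total r M) = {Z. prominent r M Z}"
  "cdom (osc_total r M) (osc_chart r M i) = cdom ((TB ^^ r) M) i \<inter> {Z. prominent r M Z}"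
  "chart (osc_total r M) (osc_chart r M i) p = straighten r (mdim M) (chart ((TB ^^ r) M) i p)"
  by (simp_all add: osc_total_def osc_chart_def submfd_def)

lemma osc_chart_idx:
  assumes M: "atlas M" and r: "r \<ge> 1" and i: "i \<in> idx M"
  shows "osc_chart r M i \<in> idx (osc_total r M)"
proof -
  let ?X = "(TB ^^ r) M" and ?\<phi> = "\<lambda>p. straighten r (mdim M) (chart ((TB ^^ r) M) i p)"
  have "compatible_chart ?X (cdom ?X i) ?\<phi>"
    by (rule compatible_chart_diffeo[OF atlas_TB_iter[OF M], where K = "unstraighten r (mdim M)"])
       (use i in \<open>simp_all add: smooth_straighten smooth_unstraighten straighten_coords unstraighten_coords
          unstraighten_straighten straighten_unstraighten\<close>)
  moreover have "prominent r M p \<longleftrightarrow> (\<forall>a\<ge>(r + 1) * mdim M. ?\<phi> p a = 0)" if "p \<in> cdom ?X i" for p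
    unfolding straighten_slice_iff by (rule prominent_iff_coord[OF M r i that])
  then have "?\<phi> ` (cdom ?X i \<inter> {Z. prominent r M Z}) = {x \<in> ?\<phi> ` cdom ?X i. \<forall>a\<ge>(r + 1) * mdim M. x a = 0}"
    by blast
  ultimately show ?thesis by (simp add: osc_total_def osc_chart_def submfd_def)
qed

lemma prominent_pts: "prominent r M Z \<Longrightarrow> Z \<in> pts ((TB ^^ r) M)"
  by (simp add: prominent_def)

lemma osc_slice_cover:
  assumes M: "manifold M" and r: "r \<ge> 1"
  shows "slice_cover ((TB ^^ r) M) ((r + 1) * mdim M) {Z. prominent r M Z}"
proof
  show "manifold ((TB ^^ r) M)" by (rule manifold_TB_iter[OF M])
  show "(r + 1) * mdim M \<le> mdim ((TB ^^ r) M)" using dim_le by simp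
  fix p assume p: "p \<in> {Z. prominent r M Z}"
  note Mp = manifold_atlas[OF M]
  obtain i where i: "i \<in> idx ((TB ^^ r) M)" "p \<in> cdom ((TB ^^ r) M) i"
    using pts_cdom[OF atlas_TB_iter[OF Mp] prominent_pts[of r M p]] p by blast
  then have "i \<in> idx M" by simp
  from osc_chart_idx[OF Mp r this] i(2)
  show "\<exists>U \<phi>. (U, \<phi>) \<in> idx (submfd ((TB ^^ r) M) ((r + 1) * mdim M) {Z. prominent r M Z}) \<and> p \<in> U"
    unfolding osc_total_def osc_chart_def by blast
qed

definition jet_to_prominent :: "nat \<Rightarrow> ('a, 'i) manif \<Rightarrow> (real \<Rightarrow> ('a, 'i) pt) set \<Rightarrow> ('a, 'i) pt" where
  "jet_to_prominent r M J = iter_vel r M (jet_rep J) 0"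

abbreviation vel_total where "vel_total r M \<equiv> total (velocity r M)"

lemma vel_total_sel [simp]:
  "mdim (vel_total r M) = (r + 1) * mdim M" "idx (vel_total r M) = idx M"
  "pts (vel_total r M) = {jet0 r M \<gamma> |\<gamma>. curve M \<gamma>}"
  "cdom (vel_total r M) i = {jet0 r M \<gamma> |\<gamma>. curve M \<gamma> \<and> \<gamma> 0 \<in> cdom M i}"
  "base (velocity r M) = M" "fproj (velocity r M) J = jet_rep J 0"
  by (simp_all add: velocity_def)

lemma vel_total_chart:
  "chart (vel_total r M) i J a = (if a < (r + 1) * mdim M
     then (deriv ^^ (a div mdim M)) (\<lambda>t. chart M i (jet_rep J t) (a mod mdim M)) 0 else 0)"
  by (simp add: velocity_def)

lemma jet0_eq:
  assumes "atlas M" "curve M \<gamma>"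
  shows "jet0 k M \<gamma> = {\<delta>. curve M \<delta> \<and> iter_vel k M \<delta> 0 = iter_vel k M \<gamma> 0}"
proof (rule Set.set_eqI)
  fix \<delta>
  show "\<delta> \<in> jet0 k M \<gamma> \<longleftrightarrow> \<delta> \<in> {\<delta>. curve M \<delta> \<and> iter_vel k M \<delta> 0 = iter_vel k M \<gamma> 0}"
  proof (cases "curve M \<delta>")
    case True
    then show ?thesis using jet0_iff_iter_vel[OF assms True] by (simp only: mem_Collect_eq simp_thms)
  qed (simp add: jet0_def)
qed

text \<open>A jet contains the curve that generates it, so the chosen representative is a curve with
  the same iterated velocity. The choice is therefore invisible to
  \<open>jet_to_prominent\<close>.\<close>

lemma jet_rep_jet0:
  assumes "atlas M" "curve M \<gamma>"
  shows "curve M (jet_rep (jet0 k M \<gamma>))" "jet_to_prominent k M (jet0 k M \<gamma>) = iter_vel k M \<gamma> 0"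
    "jet_rep (jet0 k M \<gamma>) 0 = \<gamma> 0"
proof -
  have "\<gamma> \<in> jet0 k M \<gamma>" using assms by (simp add: jet0_eq)
  then have "jet_rep (jet0 k M \<gamma>) \<in> jet0 k M \<gamma>" unfolding jet_rep_def
    by (rule someI[of "\<lambda>\<delta>. \<delta> \<in> jet0 k M \<gamma>"])
  then show "curve M (jet_rep (jet0 k M \<gamma>))" and *: "jet_to_prominent k M (jet0 k M \<gamma>) = iter_vel k M \<gamma> 0"
    by (simp_all add: jet0_eq[OF assms] jet_to_prominent_def)
  show "jet_rep (jet0 k M \<gamma>) 0 = \<gamma> 0"
    using arg_cong[OF *, of "foot ^^ k"] by (simp add: jet_to_prominent_def feet_iter_vel)
qed

lemma feet_jet_to_prominent: "(foot ^^ r) (jet_to_prominent r M J) = jet_rep J 0"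
  by (simp add: jet_to_prominent_def feet_iter_vel)

text \<open>The induced chart of jets is the straightened bundle chart seen through the comparison
  map. The first \<open>(r + 1) * m\<close> entries agree as derivatives, with \<open>m\<close> the
  dimension of \<open>M\<close>; beyond them the chart of jets is \<open>0\<close> by definition and
  the straightened chart by prominence.\<close>

lemma jet_to_prominent_chart:
  assumes M: "atlas M" and r: "r \<ge> 1" and i: "i \<in> idx M" and J: "J \<in> cdom (vel_total r M) i"
  shows "jet_to_prominent r M J \<in> cdom ((TB ^^ r) M) i \<and> prominent r M (jet_to_prominent r M J)"
    "chart (vel_total r M) i J = straighten r (mdim M) (chart ((TB ^^ r) M) i (jet_to_prominent r M J))"
proof -
  from J obtain \<delta> where \<delta>: "J = jet0 r M \<delta>" "curve M \<delta>" "\<delta> 0 \<in> cdom M i" by auto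
  define \<gamma> where "\<gamma> = jet_rep J"
  have c: "curve M \<gamma>" and \<gamma>i: "\<gamma> 0 \<in> cdom M i" and \<theta>: "jet_to_prominent r M J = iter_vel r M \<gamma> 0"
    using jet_rep_jet0[OF M \<delta>(2)] \<delta> by (simp_all add: \<gamma>_def jet_to_prominent_def)
  obtain I where I: "open I" "0 \<in> I" "smooth_curve I M \<gamma>" using c by (rule curveE)
  have zc: "iter_vel r M \<gamma> 0 \<in> cdom ((TB ^^ r) M) i"
    using TB_iter_cdom_iff[OF M i iter_vel_in[OF I(1) M I(3,2)]] \<gamma>i by (simp add: feet_iter_vel)
  have pr: "prominent r M (iter_vel r M \<gamma> 0)" by (rule prominent_iter_vel[OF I(1) M I(3,2)])
  show "jet_to_prominent r M J \<in> cdom ((TB ^^ r) M) i \<and> prominent r M (jet_to_prominent r M J)" using zc pr \<theta> by simp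
  show "chart (vel_total r M) i J = straighten r (mdim M) (chart ((TB ^^ r) M) i (jet_to_prominent r M J))"
  proof
    fix k
    show "chart (vel_total r M) i J k = straighten r (mdim M) (chart ((TB ^^ r) M) i (jet_to_prominent r M J)) k"
    proof (cases "k < (r + 1) * mdim M")
      case True
      then have m: "mdim M > 0" by (cases "mdim M") auto
      have "k div mdim M < r + 1" using True by (simp add: less_mult_imp_div_less)
      then have l: "2 ^ (k div mdim M) - 1 < (2::nat) ^ r" by (intro ones_mono) simp
      have "chart ((TB ^^ r) M) i (iter_vel r M \<gamma> 0) (block_rep (mdim M) k) =
          (deriv ^^ (k div mdim M)) (\<lambda>t. chart M i (\<gamma> t) (k mod mdim M)) 0"
        unfolding block_rep_def
        using iter_vel_coord[OF I(1) M I(3) i mod_less_divisor[OF m] I(2) \<gamma>i l] by (simp only: popcount_ones)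
      then show ?thesis using True by (simp add: vel_total_chart straighten_def \<theta> \<gamma>_def)
    next
      case False
      have "\<forall>k\<ge>(r + 1) * mdim M. straighten r (mdim M) (chart ((TB ^^ r) M) i (iter_vel r M \<gamma> 0)) k = 0"
        unfolding straighten_slice_iff using prominent_iff_coord[OF M r i zc] pr by blast
      then show ?thesis using False by (simp add: vel_total_chart \<theta>)
    qed
  qed
qed

lemma jet_to_prominent_inj:
  assumes "atlas M" shows "inj_on (jet_to_prominent r M) (pts (vel_total r M))"
proof (rule inj_onI)
  fix J K assume "J \<in> pts (vel_total r M)" "K \<in> pts (vel_total r M)" and eq: "jet_to_prominent r M J = jet_to_prominent r M K"
  then obtain \<gamma> \<delta> where "J = jet0 r M \<gamma>" "curve M \<gamma>" "K = jet0 r M \<delta>" "curve M \<delta>" by auto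
  then show "J = K" using eq jet_rep_jet0(2)[OF assms] by (simp add: jet0_eq[OF assms])
qed

lemma jet_to_prominent_onto:
  assumes M: "atlas M" and r: "r \<ge> 1"
  shows "jet_to_prominent r M ` pts (vel_total r M) = {Z. prominent r M Z}"
proof
  show "jet_to_prominent r M ` pts (vel_total r M) \<subseteq> {Z. prominent r M Z}"
  proof
    fix Z assume "Z \<in> jet_to_prominent r M ` pts (vel_total r M)"
    then obtain \<gamma> where \<gamma>: "curve M \<gamma>" "Z = iter_vel r M \<gamma> 0" using jet_rep_jet0(2)[OF M] by auto
    obtain I where I: "open I" "0 \<in> I" "smooth_curve I M \<gamma>" using \<gamma>(1) by (rule curveE)
    show "Z \<in> {Z. prominent r M Z}" using prominent_iter_vel[OF I(1) M I(3,2)] \<gamma>(2) by simp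
  qed
  show "{Z. prominent r M Z} \<subseteq> jet_to_prominent r M ` pts (vel_total r M)"
  proof
    fix Z assume "Z \<in> {Z. prominent r M Z}"
    then obtain \<gamma> where \<gamma>: "curve M \<gamma>" "iter_vel r M \<gamma> 0 = Z" using prominent_imp_iter_vel[OF M r] by blast
    then show "Z \<in> jet_to_prominent r M ` pts (vel_total r M)"
      using jet_rep_jet0(2)[OF M \<gamma>(1), of r] by (intro image_eqI[of _ _ "jet0 r M \<gamma>"]) auto
  qed
qed

lemma curve_base: "atlas M \<Longrightarrow> curve M \<gamma> \<Longrightarrow> \<gamma> 0 \<in> pts M"
  by (erule curveE) (rule curve_in)

lemma jet_to_prominent_pullback:
  assumes man: "manifold M" and r: "r \<ge> 1"
  shows "pullback_atlas (vel_total r M) (osc_total r M) (jet_to_prominent r M) (osc_chart r M)"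
proof
  note M = manifold_atlas[OF man]
  interpret slice_cover "(TB ^^ r) M" "(r + 1) * mdim M" "{Z. prominent r M Z}"
    by (rule osc_slice_cover[OF man r])
  show "manifold (osc_total r M)" unfolding osc_total_def by (rule manifold_Y)
  show "mdim (vel_total r M) = mdim (osc_total r M)" by simp
  show "pts (vel_total r M) = (\<Union>j\<in>idx (vel_total r M). cdom (vel_total r M) j)"
    using pts_cdom[OF M curve_base[OF M]] by fastforce
  show "inj_on (jet_to_prominent r M) (pts (vel_total r M))" by (rule jet_to_prominent_inj[OF M])
  show onto: "jet_to_prominent r M ` pts (vel_total r M) = pts (osc_total r M)" using jet_to_prominent_onto[OF M r] by simp
  fix i assume "i \<in> idx (vel_total r M)"
  then have i: "i \<in> idx M" by simp
  show "osc_chart r M i \<in> idx (osc_total r M)" by (rule osc_chart_idx[OF M r i])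
  show "jet_to_prominent r M ` cdom (vel_total r M) i = cdom (osc_total r M) (osc_chart r M i)"
  proof
    show "jet_to_prominent r M ` cdom (vel_total r M) i \<subseteq> cdom (osc_total r M) (osc_chart r M i)"
      using jet_to_prominent_chart(1)[OF M r i] by (simp only: osc_total_sel) blast
    show "cdom (osc_total r M) (osc_chart r M i) \<subseteq> jet_to_prominent r M ` cdom (vel_total r M) i"
    proof
      fix Z assume "Z \<in> cdom (osc_total r M) (osc_chart r M i)"
      then have Z: "Z \<in> cdom ((TB ^^ r) M) i" "prominent r M Z" by simp_all
      obtain \<gamma> where \<gamma>: "curve M \<gamma>" "iter_vel r M \<gamma> 0 = Z" using prominent_imp_iter_vel[OF M r Z(2)] by blast
      have "(foot ^^ r) Z \<in> cdom M i" using TB_iter_cdom_iff[OF M i prominent_pts[OF Z(2)]] Z(1) by blast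
      then have "\<gamma> 0 \<in> cdom M i" using \<gamma>(2) by (auto simp: feet_iter_vel)
      then show "Z \<in> jet_to_prominent r M ` cdom (vel_total r M) i"
        using \<gamma> jet_rep_jet0(2)[OF M \<gamma>(1), of r] by (intro image_eqI[of _ _ "jet0 r M \<gamma>"]) auto
    qed
  qed
  fix J assume "J \<in> cdom (vel_total r M) i"
  then show "chart (vel_total r M) i J = chart (osc_total r M) (osc_chart r M i) (jet_to_prominent r M J)"
    using jet_to_prominent_chart(2)[OF M r i] by simp
qed

lemma smooth_feet:
  fixes M :: "('a, 'i) manif"
  shows "atlas M \<Longrightarrow> smooth_map ((TB ^^ s) M) M (foot ^^ s)"
proof (induction s)
  case 0
  have e: "(foot ^^ 0) = (id :: ('a, 'i) pt \<Rightarrow> _)" "(TB ^^ 0) M = M" by simp_all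
  show ?case unfolding e by (rule smooth_map_id[OF 0])
next
  case (Suc s)
  have "smooth_map (TB ((TB ^^ s) M)) M ((foot ^^ s) \<circ> foot)"
    using Suc by (intro smooth_map_compose[where N = "(TB ^^ s) M"] TB_atlas atlas_TB_iter smooth_foot) auto
  moreover have "(foot ^^ s) \<circ> foot = foot ^^ Suc s" "TB ((TB ^^ s) M) = (TB ^^ Suc s) M"
    by (simp only: funpow_Suc_right, simp)
  ultimately show ?case by metis
qed

lemma feet_Tmap_iter: "(foot ^^ s) (Tmap_iter s M N f v) = f ((foot ^^ s) v)"
proof (induction s arbitrary: v)
  case (Suc s)
  show ?case using Suc.IH[of "foot v"] by (simp add: funpow_swap1[of foot])
qed simp

section \<open>The two functors and their natural equivalence\<close>

context
  fixes M :: "('a, 'i) manif" and r :: nat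
  assumes manM: "manifold M" and r: "r \<ge> 1"
begin

interpretation Osc: slice_cover "(TB ^^ r) M" "(r + 1) * mdim M" "{Z. prominent r M Z}"
  rewrites "submfd ((TB ^^ r) M) ((r + 1) * mdim M) {Z. prominent r M Z} = osc_total r M"
  by (rule osc_slice_cover[OF manM r]) (simp add: osc_total_def)

interpretation V: pullback_atlas "vel_total r M" "osc_total r M" "jet_to_prominent r M" "osc_chart r M"
  by (rule jet_to_prominent_pullback[OF manM r])

lemma M_atlas: "atlas M" by (rule manifold_atlas[OF manM])

lemma manifold_osc: "manifold (osc_total r M)" by (rule Osc.manifold_Y)

lemma manifold_vel: "manifold (vel_total r M)" by (rule V.manifold_V)

lemma smooth_jet_to_prominent: "smooth_map (vel_total r M) (osc_total r M) (jet_to_prominent r M)" by (rule V.smooth_h)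

lemma osc_inclusion: "smooth_map (osc_total r M) ((TB ^^ r) M) id" by (rule Osc.smooth_inclusion)

lemma osc_into:
  "atlas N \<Longrightarrow> smooth_map N ((TB ^^ r) M) f \<Longrightarrow> (\<And>p. p \<in> pts N \<Longrightarrow> prominent r M (f p)) \<Longrightarrow>
    smooth_map N (osc_total r M) f"
  using Osc.smooth_into[of N f] by simp

lemma smooth_jet_to_prominent_inverse:
  "(\<And>v. v \<in> pts (vel_total r M) \<Longrightarrow> g (jet_to_prominent r M v) = v) \<Longrightarrow> smooth_map (osc_total r M) (vel_total r M) g"
  by (rule V.smooth_inverse)

lemma smooth_osc_feet: "smooth_map (osc_total r M) M (foot ^^ r)"
proof -
  have "smooth_map (osc_total r M) M ((foot ^^ r) \<circ> id)"
    by (rule smooth_map_compose[OF Osc.atlas_Y atlas_TB_iter[OF M_atlas] M_atlas osc_inclusion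
          smooth_feet[OF M_atlas]])
  then show ?thesis by (simp only: comp_id)
qed

lemma smooth_vel_base: "smooth_map (vel_total r M) M (\<lambda>J. jet_rep J 0)"
proof -
  have "smooth_map (vel_total r M) M ((foot ^^ r) \<circ> jet_to_prominent r M)"
    by (rule smooth_map_compose[OF V.atlas_V Osc.atlas_Y M_atlas smooth_jet_to_prominent smooth_osc_feet])
  moreover have "(foot ^^ r) \<circ> jet_to_prominent r M = (\<lambda>J. jet_rep J 0)" by (rule ext) (simp add: feet_jet_to_prominent)
  ultimately show ?thesis by (simp only:)
qed

lemma vel_base_chart:
  assumes "i \<in> idx M" "J \<in> cdom (vel_total r M) i"
  shows "jet_rep J 0 \<in> cdom M i" "c < mdim M \<Longrightarrow> chart M i (jet_rep J 0) c = chart (vel_total r M) i J c"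
proof -
  show "jet_rep J 0 \<in> cdom M i" using assms(2) jet_rep_jet0(3)[OF M_atlas] by auto
  assume c: "c < mdim M"
  then have "c < (r + 1) * mdim M" by simp
  then show "chart M i (jet_rep J 0) c = chart (vel_total r M) i J c" using c by (simp add: vel_total_chart)
qed

text \<open>In a chart \<open>j\<close> of \<open>M\<close> and the chart it induces on jets, the
  projection selects the first \<open>mdim M\<close> coordinates, so its Jacobian is a unit matrix
  followed by zeros. Another chart \<open>i\<close> of the base contributes an invertible
  factor.\<close>

lemma vel_submersion: "surjective_submersion (vel_total r M) M (\<lambda>J. jet_rep J 0)"
  unfolding surjective_submersion_def
proof (intro conjI ballI impI allI)
  note M = M_atlas and Vp = V.atlas_V
  show "smooth_map (vel_total r M) M (\<lambda>J. jet_rep J 0)" by (rule smooth_vel_base)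
  show "(\<lambda>J. jet_rep J 0) ` pts (vel_total r M) = pts M"
  proof
    show "(\<lambda>J. jet_rep J 0) ` pts (vel_total r M) \<subseteq> pts M"
      using smooth_map_in[OF Vp M smooth_vel_base] by blast
    show "pts M \<subseteq> (\<lambda>J. jet_rep J 0) ` pts (vel_total r M)"
    proof
      fix p assume "p \<in> pts M"
      then obtain i where i: "i \<in> idx M" "p \<in> cdom M i" using pts_cdom[OF M] by blast
      obtain d \<gamma> where \<gamma>: "d > 0" "smooth_curve {-d<..<d} M \<gamma>" "\<gamma> 0 = p"
        by (rule exists_curve[OF M i, where y = "\<lambda>l. chart M i p" and k = 0]) auto
      have c: "curve M \<gamma>" by (rule curveI[OF \<gamma>(1,2)])
      show "p \<in> (\<lambda>J. jet_rep J 0) ` pts (vel_total r M)"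
        using jet_rep_jet0(3)[OF M c, of r] \<gamma>(3) c by (intro image_eqI[of _ _ "jet0 r M \<gamma>"]) auto
    qed
  qed
  fix J j i and w :: "nat \<Rightarrow> real"
  assume J: "J \<in> pts (vel_total r M)" "J \<in> cdom (vel_total r M) j" and jV: "j \<in> idx (vel_total r M)"
    and i: "i \<in> idx M" "jet_rep J 0 \<in> cdom M i"
  let ?p = "jet_rep J 0" and ?m = "mdim M" and ?g = "\<lambda>J. jet_rep J (0::real)"
  have j: "j \<in> idx M" using jV by simp
  have pj: "?p \<in> cdom M j" by (rule vel_base_chart(1)[OF j J(2)])
  \<comment> \<open>The vector \<open>w\<close> expressed in the chart \<open>j\<close>. The entries
    from index \<open>mdim M\<close> on are arbitrary, as the Jacobian of the projection vanishes
    there.\<close>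
  define v where "v c = (\<Sum>b<?m. jacobian M i M j id ?p c b * w b)" for c
  have "(\<Sum>b<mdim (vel_total r M). jacobian (vel_total r M) j M i ?g J a b * v b) = w a" if a: "a < ?m" for a
  proof -
    let ?n = "mdim (vel_total r M)"
    have mn: "?m \<le> ?n" by simp
    have jac: "jacobian (vel_total r M) j M j ?g J c b = (if c = b then 1 else 0)" if "c < ?m" "b < ?n" for c b
      by (rule jacobian_coord[OF Vp jV J(2) that(2) pts_open[OF Vp] J(1)])
         (rule vel_base_chart(2)[OF j _ that(1)])
    have "(\<Sum>b<?n. jacobian (vel_total r M) j M i ?g J a b * v b) =
        (\<Sum>b<?n. (\<Sum>c<?m. jacobian M j M i id ?p a c * jacobian (vel_total r M) j M j ?g J c b) * v b)"
      using jacobian_compose_maps[OF Vp M M smooth_vel_base smooth_map_id[OF M] jV J(2) j pj i(1) _ a] i(2)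
      by (simp add: comp_def)
    also have "\<dots> = (\<Sum>c<?m. jacobian M j M i id ?p a c * (\<Sum>b<?n. jacobian (vel_total r M) j M j ?g J c b * v b))"
      by (rule matvec_assoc[symmetric])
    also have "\<dots> = (\<Sum>c<?m. jacobian M j M i id ?p a c * v c)"
    proof (intro sum.cong refl arg_cong2[of _ _ _ _ "(*)"])
      fix c assume "c \<in> {..<?m}"
      then have c: "c < ?m" "c < ?n" using mn by auto
      have "(\<Sum>b<?n. jacobian (vel_total r M) j M j ?g J c b * v b) = (\<Sum>b<?n. (if c = b then 1 else 0) * v b)"
        by (intro sum.cong refl arg_cong2[of _ _ _ _ "(*)"] jac[OF c(1)]) simp
      also have "\<dots> = v c" using c(2) by (simp add: if_distrib[of "\<lambda>y. y * _"] cong: if_cong)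
      finally show "(\<Sum>b<?n. jacobian (vel_total r M) j M j ?g J c b * v b) = v c" .
    qed
    also have "\<dots> = (\<Sum>b<?m. (\<Sum>c<?m. jacobian M j M i id ?p a c * jacobian M i M j id ?p c b) * w b)"
      unfolding v_def by (rule matvec_assoc)
    also have "\<dots> = (\<Sum>b<?m. (if a = b then 1 else 0) * w b)"
    proof (intro sum.cong refl arg_cong2[of _ _ _ _ "(*)"])
      fix b assume "b \<in> {..<?m}"
      then have b: "b < ?m" by simp
      \<comment> \<open>The Jacobians of the two changes between \<open>i\<close> and
        \<open>j\<close> are inverse to each other, by the chain rule for
        \<open>id \<circ> id\<close>.\<close>
      have "jacobian M i M i (id \<circ> id) ?p a b =
          (\<Sum>c<?m. jacobian M j M i id (id ?p) a c * jacobian M i M j id ?p c b)"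
        by (rule jacobian_compose_maps[OF M M M smooth_map_id[OF M] smooth_map_id[OF M] i j _ i(1) _ a b])
           (use pj i in simp_all)
      then show "(\<Sum>c<?m. jacobian M j M i id ?p a c * jacobian M i M j id ?p c b) = (if a = b then 1 else 0)"
        using jacobian_id[OF M i b, of a] by simp
    qed
    also have "\<dots> = w a" using a by (simp add: if_distrib[of "\<lambda>y. y * _"] cong: if_cong)
    finally show ?thesis .
  qed
  then show "\<exists>v. \<forall>a<?m. (\<Sum>b<mdim (vel_total r M). jacobian (vel_total r M) j M i ?g J a b * v b) = w a"
    by (intro exI[of _ v]) blast
qed

text \<open>The condition ranges over all slice charts, for which no formula is available. It is
  transported from jets, where the charts are explicit.\<close>

lemma osc_submersion: "surjective_submersion (osc_total r M) M (foot ^^ r)"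
  by (rule surjective_submersion_factor[OF V.atlas_V Osc.atlas_Y M_atlas vel_submersion smooth_jet_to_prominent _
        smooth_osc_feet feet_jet_to_prominent])
     (rule V.onto)

end

lemma osc_eq:
  "total (osc s M) = osc_total (Suc s) M" "base (osc s M) = M" "fproj (osc s M) = foot ^^ Suc s"
  by (simp_all add: osc_def osc_total_def)

text \<open>Naturality of the comparison map. As this map is injective, every functorial identity
  for \<open>velocity_map\<close> can be checked on \<open>Tmap_iter\<close>.\<close>

lemma jet_to_prominent_velocity_map:
  assumes M: "atlas M" and N: "atlas N" and f: "smooth_map M N f" and J: "J \<in> pts (vel_total r M)"
  shows "velocity_map r M N f J \<in> pts (vel_total r N)"
    "jet_to_prominent r N (velocity_map r M N f J) = Tmap_iter r M N f (jet_to_prominent r M J)"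
proof -
  obtain \<gamma> where \<gamma>: "curve M \<gamma>" "J = jet0 r M \<gamma>" using J by auto
  have c: "curve M (jet_rep J)" unfolding \<gamma>(2) by (rule jet_rep_jet0(1)[OF M \<gamma>(1)])
  then obtain a b where ab: "a < 0" "0 < b" "smooth_curve {a<..<b} M (jet_rep J)" unfolding curve_def by blast
  have fc: "smooth_curve {a<..<b} N (f \<circ> jet_rep J)"
    by (rule smooth_curve_compose[OF _ M N ab(3) f]) simp
  then have cf: "curve N (f \<circ> jet_rep J)" unfolding curve_def using ab by blast
  then show "velocity_map r M N f J \<in> pts (vel_total r N)" by (auto simp: velocity_map_def)
  have "jet_to_prominent r N (velocity_map r M N f J) = iter_vel r N (f \<circ> jet_rep J) 0"
    unfolding velocity_map_def by (rule jet_rep_jet0(2)[OF N cf])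
  also have "\<dots> = Tmap_iter r M N f (iter_vel r M (jet_rep J) 0)"
    by (rule Tmap_iter_iter_vel[symmetric, OF _ M N ab(3) f]) (use ab in simp_all)
  finally show "jet_to_prominent r N (velocity_map r M N f J) = Tmap_iter r M N f (jet_to_prominent r M J)" by (simp only: jet_to_prominent_def)
qed

lemma prominent_Tmap_iter:
  assumes M: "atlas M" and N: "atlas N" and f: "smooth_map M N f" and r: "r \<ge> 1" and Z: "prominent r M Z"
  shows "prominent r N (Tmap_iter r M N f Z)"
proof -
  obtain J where J: "J \<in> pts (vel_total r M)" "Z = jet_to_prominent r M J"
    using jet_to_prominent_onto[OF M r] Z by (metis (no_types, lifting) imageE mem_Collect_eq)
  have "Tmap_iter r M N f Z \<in> jet_to_prominent r N ` pts (vel_total r N)"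
    using jet_to_prominent_velocity_map[OF M N f J(1)] J(2) by (metis imageI)
  then show ?thesis unfolding jet_to_prominent_onto[OF N r] by simp
qed

lemma smooth_osc_map:
  assumes M: "manifold M" and N: "manifold N" and f: "smooth_map M N f" and r: "r \<ge> 1"
  shows "smooth_map (osc_total r M) (osc_total r N) (Tmap_iter r M N f)"
proof -
  note Mp = manifold_atlas[OF M] and Np = manifold_atlas[OF N]
  note Op = manifold_atlas[OF manifold_osc[OF M r]]
  have "smooth_map (osc_total r M) ((TB ^^ r) N) (Tmap_iter r M N f \<circ> id)"
    by (rule smooth_map_compose[OF Op atlas_TB_iter[OF Mp] atlas_TB_iter[OF Np] osc_inclusion[OF M r]
          smooth_Tmap_iter[OF Mp Np f]])
  then have s: "smooth_map (osc_total r M) ((TB ^^ r) N) (Tmap_iter r M N f)" by (simp only: comp_id)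
  show ?thesis
    by (rule osc_into[OF N r Op s]) (rule prominent_Tmap_iter[OF Mp Np f r], simp)
qed

definition prominent_to_jet :: "nat \<Rightarrow> ('a, 'i) manif \<Rightarrow> ('a, 'i) pt \<Rightarrow> (real \<Rightarrow> ('a, 'i) pt) set" where
  "prominent_to_jet r M = inv_into (pts (vel_total r M)) (jet_to_prominent r M)"

lemma prominent_to_jet_jet_to_prominent: "atlas M \<Longrightarrow> J \<in> pts (vel_total r M) \<Longrightarrow> prominent_to_jet r M (jet_to_prominent r M J) = J"
  unfolding prominent_to_jet_def by (rule inv_into_f_f[OF jet_to_prominent_inj])

lemma jet_to_prominent_prominent_to_jet:
  assumes "atlas M" "r \<ge> 1" "prominent r M Z"
  shows "prominent_to_jet r M Z \<in> pts (vel_total r M)" "jet_to_prominent r M (prominent_to_jet r M Z) = Z"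
proof -
  have "Z \<in> jet_to_prominent r M ` pts (vel_total r M)" using jet_to_prominent_onto[OF assms(1,2)] assms(3) by simp
  then show "prominent_to_jet r M Z \<in> pts (vel_total r M)" "jet_to_prominent r M (prominent_to_jet r M Z) = Z"
    unfolding prominent_to_jet_def by (rule inv_into_into, rule f_inv_into_f)
qed

text \<open>On jets the map is the conjugate of \<open>Tmap_iter\<close> by the comparison
  diffeomorphism, so its smoothness requires no formula for higher derivatives of a
  composite.\<close>

lemma smooth_velocity_map:
  fixes M N :: "('a, 'i) manif"
  assumes M: "manifold M" and N: "manifold N" and f: "smooth_map M N f" and r: "r \<ge> 1"
  shows "smooth_map (vel_total r M) (vel_total r N) (velocity_map r M N f)"
proof -
  note Mp = manifold_atlas[OF M] and Np = manifold_atlas[OF N]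
  note VM = manifold_atlas[OF manifold_vel[OF M r]] and VN = manifold_atlas[OF manifold_vel[OF N r]]
  note OM = manifold_atlas[OF manifold_osc[OF M r]] and ON = manifold_atlas[OF manifold_osc[OF N r]]
  have "smooth_map (vel_total r M) (vel_total r N) (prominent_to_jet r N \<circ> (Tmap_iter r M N f \<circ> jet_to_prominent r M))"
    by (rule smooth_map_compose[OF VM ON VN smooth_map_compose[OF VM OM ON smooth_jet_to_prominent[OF M r]
          smooth_osc_map[OF M N f r]] smooth_jet_to_prominent_inverse[OF N r prominent_to_jet_jet_to_prominent[OF Np]]])
  then show ?thesis
  proof (rule smooth_map_cong[OF VM VN])
    fix J assume J: "J \<in> pts (vel_total r M)"
    note t = jet_to_prominent_velocity_map[OF Mp Np f J]
    show "velocity_map r M N f J = (prominent_to_jet r N \<circ> (Tmap_iter r M N f \<circ> jet_to_prominent r M)) J"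
      using prominent_to_jet_jet_to_prominent[OF Np t(1)] unfolding t(2) by simp
  qed
qed

lemma osc_functor: "fibered_functor (osc s :: ('a, 'i) manif \<Rightarrow> _) (osc_map s)"
  unfolding fibered_functor_def
proof (intro conjI allI impI ballI; (elim conjE)?)
  have r: "Suc s \<ge> 1" by simp
  fix M :: "('a, 'i) manif" assume M: "manifold M"
  note Mp = manifold_atlas[OF M]
  show "fibered_manifold (osc s M)"
    unfolding fibered_manifold_def osc_eq
    by (intro conjI M manifold_osc[OF M r] osc_submersion[OF M r])
  show "base (osc s M) = M" by (rule osc_eq)
  show "osc_map s M M id y = y" if "y \<in> pts (total (osc s M))" for y
    unfolding osc_map_def by (rule Tmap_iter_id[OF Mp]) (use that prominent_pts in \<open>simp add: osc_eq prominent_def\<close>)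
  fix N :: "('a, 'i) manif" assume N: "manifold N"
  note Np = manifold_atlas[OF N]
  fix f assume f: "smooth_map M N f"
  show "fibered_morphism (osc s M) (osc s N) (osc_map s M N f) f"
    unfolding fibered_morphism_def osc_eq osc_map_def
    by (intro conjI ballI f smooth_osc_map[OF M N f r] feet_Tmap_iter)
  show "osc_map s M N f y = osc_map s M N g y"
    if "\<forall>x\<in>pts M. f x = g x" "y \<in> pts (total (osc s M))" "smooth_map M N g" for g y
    unfolding osc_map_def
    by (rule Tmap_iter_cong[OF Mp Np that(3)]) (use that in \<open>simp_all add: osc_eq prominent_def\<close>)
  fix P :: "('a, 'i) manif" assume P: "manifold P"
  show "osc_map s M P (g \<circ> f) y = osc_map s N P g (osc_map s M N f y)"
    if "smooth_map N P g" "y \<in> pts (total (osc s M))" for g y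
    unfolding osc_map_def
    by (rule Tmap_iter_compose[OF Mp Np manifold_atlas[OF P] f that(1)])
       (use that in \<open>simp add: osc_eq prominent_def\<close>)
qed

lemma velocity_functor:
  assumes r: "r \<ge> 1"
  shows "fibered_functor (velocity r :: ('a, 'i) manif \<Rightarrow> _) (velocity_map r)"
  unfolding fibered_functor_def
proof (intro conjI allI impI ballI; (elim conjE)?)
  fix M :: "('a, 'i) manif" assume M: "manifold M"
  note Mp = manifold_atlas[OF M]
  have T: "jet_to_prominent r M J \<in> pts ((TB ^^ r) M)" if "J \<in> pts (vel_total r M)" for J
    using jet_to_prominent_onto[OF Mp r] that prominent_pts by blast
  have fp: "fproj (velocity r M) = (\<lambda>J. jet_rep J 0)" by (rule ext) simp
  show "fibered_manifold (velocity r M)"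
    unfolding fibered_manifold_def fp vel_total_sel(5)
    by (intro conjI M manifold_vel[OF M r] vel_submersion[OF M r])
  show "base (velocity r M) = M" by simp
  show "velocity_map r M M id y = y" if y: "y \<in> pts (vel_total r M)" for y
  proof (rule inj_onD[OF jet_to_prominent_inj[OF Mp] _ jet_to_prominent_velocity_map(1)[OF Mp Mp smooth_map_id[OF Mp] y] y])
    show "jet_to_prominent r M (velocity_map r M M id y) = jet_to_prominent r M y"
      unfolding jet_to_prominent_velocity_map(2)[OF Mp Mp smooth_map_id[OF Mp] y] by (rule Tmap_iter_id[OF Mp T[OF y]])
  qed
  fix N :: "('a, 'i) manif" assume N: "manifold N"
  note Np = manifold_atlas[OF N]
  fix f assume f: "smooth_map M N f"
  note vf = jet_to_prominent_velocity_map[OF Mp Np f]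
  show "fibered_morphism (velocity r M) (velocity r N) (velocity_map r M N f) f"
    unfolding fibered_morphism_def vel_total_sel(5)
  proof (intro conjI ballI f smooth_velocity_map[OF M N f r])
    fix y assume y: "y \<in> pts (vel_total r M)"
    have "jet_rep (velocity_map r M N f y) 0 = (foot ^^ r) (Tmap_iter r M N f (jet_to_prominent r M y))"
      unfolding vf(2)[OF y, symmetric] by (rule feet_jet_to_prominent[symmetric])
    then show "fproj (velocity r N) (velocity_map r M N f y) = f (fproj (velocity r M) y)"
      by (simp add: feet_Tmap_iter feet_jet_to_prominent)
  qed
  show "velocity_map r M N f y = velocity_map r M N g y"
    if eq: "\<forall>x\<in>pts M. f x = g x" and y: "y \<in> pts (vel_total r M)" and g: "smooth_map M N g" for g y
  proof (rule inj_onD[OF jet_to_prominent_inj[OF Np] _ vf(1)[OF y] jet_to_prominent_velocity_map(1)[OF Mp Np g y]])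
    show "jet_to_prominent r N (velocity_map r M N f y) = jet_to_prominent r N (velocity_map r M N g y)"
      unfolding vf(2)[OF y] jet_to_prominent_velocity_map(2)[OF Mp Np g y]
      by (rule Tmap_iter_cong[OF Mp Np g T[OF y]]) (use eq in blast)
  qed
  fix P :: "('a, 'i) manif" assume P: "manifold P"
  note Pp = manifold_atlas[OF P]
  show "velocity_map r M P (g \<circ> f) y = velocity_map r N P g (velocity_map r M N f y)"
    if g: "smooth_map N P g" and y: "y \<in> pts (vel_total r M)" for g y
  proof (rule inj_onD[OF jet_to_prominent_inj[OF Pp] _
        jet_to_prominent_velocity_map(1)[OF Mp Pp smooth_map_compose[OF Mp Np Pp f g] y]
        jet_to_prominent_velocity_map(1)[OF Np Pp g vf(1)[OF y]]])
    show "jet_to_prominent r P (velocity_map r M P (g \<circ> f) y) = jet_to_prominent r P (velocity_map r N P g (velocity_map r M N f y))"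
      unfolding jet_to_prominent_velocity_map(2)[OF Mp Pp smooth_map_compose[OF Mp Np Pp f g] y]
        jet_to_prominent_velocity_map(2)[OF Np Pp g vf(1)[OF y]] vf(2)[OF y]
      by (rule Tmap_iter_compose[OF Mp Np Pp f g T[OF y]])
  qed
qed

lemma prominent_to_jet_iso:
  assumes M: "manifold M"
  shows "fibered_iso (osc s M) (velocity (Suc s) M) (prominent_to_jet (Suc s) M)"
proof -
  let ?r = "Suc s"
  have r: "?r \<ge> 1" by simp
  note Mp = manifold_atlas[OF M]
  show ?thesis
    unfolding fibered_iso_def fibered_morphism_def osc_eq vel_total_sel(5)
  proof (intro conjI exI[of _ "jet_to_prominent ?r M"] ballI refl smooth_map_id[OF Mp] smooth_jet_to_prominent[OF M r]
      smooth_jet_to_prominent_inverse[OF M r prominent_to_jet_jet_to_prominent[OF Mp]])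
    fix Z assume "Z \<in> pts (osc_total ?r M)"
    then have Z: "prominent ?r M Z" by simp
    show "fproj (velocity ?r M) (prominent_to_jet ?r M Z) = id ((foot ^^ ?r) Z)"
      using feet_jet_to_prominent[of ?r M "prominent_to_jet ?r M Z"] jet_to_prominent_prominent_to_jet(2)[OF Mp r Z] by simp
    show "jet_to_prominent ?r M (prominent_to_jet ?r M Z) = Z" by (rule jet_to_prominent_prominent_to_jet(2)[OF Mp r Z])
  next
    fix J assume J: "J \<in> pts (vel_total ?r M)"
    show "(foot ^^ ?r) (jet_to_prominent ?r M J) = id (fproj (velocity ?r M) J)" unfolding feet_jet_to_prominent by simp
    show "prominent_to_jet ?r M (jet_to_prominent ?r M J) = J" by (rule prominent_to_jet_jet_to_prominent[OF Mp J])
  qed assumption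
qed

text \<open>The velocities have order \<open>r\<close>, not \<open>r - 1\<close>: a prominent
  element of the \<open>r\<close>-fold bundle has one free block for each size
  \<open>0, \<dots>, r\<close>. For \<open>r = 1\<close> prominence is vacuous, and
  \<open>osc 0\<close> is the tangent bundle, matching velocities of order \<open>1\<close>. The
  equivalence runs from prominent elements to jets, so it is given by the inverse of the comparison
  map.\<close>

theorem theorem1:
  fixes r :: nat
  assumes "r \<ge> 1"
  shows "fibered_functor
           (osc (r - 1) :: ('a, 'i) manif \<Rightarrow> _) (osc_map (r - 1)) \<and>
         naturally_equivalent
           (osc (r - 1) :: ('a, 'i) manif \<Rightarrow> _) (osc_map (r - 1))
           (velocity r) (velocity_map r)"
proof -
  obtain s where s: "r = Suc s" using assms by (cases r) auto
  have "naturally_equivalent (osc s :: ('a, 'i) manif \<Rightarrow> _) (osc_map s) (velocity r) (velocity_map r)"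
    unfolding naturally_equivalent_def
  proof (intro conjI osc_functor velocity_functor[OF assms] exI[of _ "prominent_to_jet r"] allI impI ballI; (elim conjE)?)
    fix M :: "('a, 'i) manif" assume M: "manifold M"
    show "fibered_iso (osc s M) (velocity r M) (prominent_to_jet r M)" unfolding s by (rule prominent_to_jet_iso[OF M])
    fix N :: "('a, 'i) manif" and f y
    assume N: "manifold N" and f: "smooth_map M N f" and y: "y \<in> pts (total (osc s M))"
    note Mp = manifold_atlas[OF M] and Np = manifold_atlas[OF N]
    have y: "prominent r M y" using y by (simp add: osc_eq s)
    note e = jet_to_prominent_prominent_to_jet[OF Mp assms y]
    have "prominent_to_jet r N (jet_to_prominent r N (velocity_map r M N f (prominent_to_jet r M y))) = velocity_map r M N f (prominent_to_jet r M y)"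
      by (rule prominent_to_jet_jet_to_prominent[OF Np jet_to_prominent_velocity_map(1)[OF Mp Np f e(1)]])
    then have "prominent_to_jet r N (Tmap_iter r M N f y) = velocity_map r M N f (prominent_to_jet r M y)"
      unfolding jet_to_prominent_velocity_map(2)[OF Mp Np f e(1)] e(2) .
    then show "prominent_to_jet r N (osc_map s M N f y) = velocity_map r M N f (prominent_to_jet r M y)"
      unfolding osc_map_def s .
  qed
  then show ?thesis using osc_functor[where s = s] unfolding s by simp
qed

end
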